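(* Let $s>1/2$. If $\lambda>0$, then $$(R_0^{\pm}(\lambda)u,v)_{-s,s}=\int_{\mathbb{R}^3}\Big\{\int_{\mathbb{R}^3}g_\lambda^{\pm}(x-y)\,u(y)\,dy\Big\}\,\overline{v(x)}\,dx$$ for all $u,v\in C_0^\infty(\mathbb{R}^3)$, where $$g_\lambda^{\pm}(x)=\frac{1}{2\pi^2|x|^2}+\frac{\lambda}{2\pi}\cdot\frac{e^{\pm i\lambda|x|}}{|x|}+m_\lambda(x),\qquad m_\lambda(x)=\frac{\lambda}{2\pi^2|x|}\Big[\sin(\lambda|x|)\,\mathrm{ci}(\lambda|x|)+\cos(\lambda|x|)\,\mathrm{si}(\lambda|x|)\Big].$$
   Context: For $\rho>0$, $\mathrm{ci}(\rho)=\int_\rho^{+\infty}\frac{\cos t}{t}\,dt$ and $\mathrm{si}(\rho)=-\int_\rho^{+\infty}\frac{\sin t}{t}\,dt$. With $\langle x\rangle=\sqrt{1+|x|^2}$, $L^{2,s}(\mathbb{R}^3)=\{f:\langle x\rangle^s f\in L^2\}$ and $H^{1,s}(\mathbb{R}^3)=\{f:\langle x\rangle^s(1-\Delta)^{1/2}f\in L^2\}$. For $f\in L^{2,-s}$ and $g\in L^{2,s}$, $(f,g)_{-s,s}=\int_{\mathbb{R}^3}f(x)\overline{g(x)}\,dx$. $H_0=\sqrt{-\Delta}$ (Fourier multiplier by $|\xi|$) is self-adjoint in $L^2(\mathbb{R}^3)$ with domain $H^1(\mathbb{R}^3)$, $R_0(z)=(H_0-z)^{-1}$ for $z\in\mathbb{C}\setminus[0,\infty)$.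 It is known (limiting absorption principle of Ben-Artzi and Nemirovski) that for $\lambda>0$, $s>1/2$, the limits $R_0^{\pm}(\lambda)=\lim_{\mu\downarrow0}R_0(\lambda\pm i\mu)$ exist in operator norm of bounded operators $L^{2,s}\to H^{1,-s}$. *)

theory Defs
  imports "HOL-Analysis.Analysis"
begin

text \<open>
  Elements of function spaces over \<open>\<real>\<^sup>3\<close> are represented by Borel functions; elements of
  \<open>L\<^sup>2\<close>-type spaces are identified when they agree almost everywhere. An operator picks a
  representative of its value by \<open>SOME\<close>.
\<close>

type_synonym cfun3 = "real ^ 3 \<Rightarrow> complex"


subsection \<open>Test functions and Schwartz functions\<close>

definition partial :: "3 \<Rightarrow> cfun3 \<Rightarrow> cfun3" where
  "partial i f = (\<lambda>x. frechet_derivative f (at x) (axis i 1))"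

text \<open>All iterated partial derivatives exist and are (Frechet) differentiable, hence continuous.\<close>

definition smooth :: "cfun3 \<Rightarrow> bool" where
  "smooth f \<longleftrightarrow> (\<forall>is x. foldr partial is f differentiable (at x))"

definition C0_infty :: "cfun3 set" where
  "C0_infty = {f. smooth f \<and> compact (closure {x. f x \<noteq> 0})}"

definition jbr :: "real ^ 3 \<Rightarrow> real" where
  "jbr x = sqrt (1 + (norm x)\<^sup>2)"

definition schwartz :: "cfun3 set" where
  "schwartz = {f. smooth f \<and>
     (\<forall>is (N::nat). bounded (range (\<lambda>x. of_real (jbr x ^ N) * foldr partial is f x)))}"


subsection \<open>Fourier transform\<close>

definition fourier :: "cfun3 \<Rightarrow> cfun3" where
  "fourier f = (\<lambda>\<xi>. of_real ((2 * pi) powr (- 3 / 2)) *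
     (LINT x|lborel. exp (- \<i> * of_real (x \<bullet> \<xi>)) * f x))"

definition fourier_inv :: "cfun3 \<Rightarrow> cfun3" where
  "fourier_inv f = (\<lambda>x. of_real ((2 * pi) powr (- 3 / 2)) *
     (LINT \<xi>|lborel. exp (\<i> * of_real (x \<bullet> \<xi>)) * f \<xi>))"

text \<open>The multiplier \<open>(1 - \<Delta>)\<^bsup>1/2\<^esup>\<close> on Schwartz functions.\<close>

definition bessel_schwartz :: "cfun3 \<Rightarrow> cfun3" where
  "bessel_schwartz \<phi> = fourier_inv (\<lambda>\<xi>. of_real (jbr \<xi>) * fourier \<phi> \<xi>)"


subsection \<open>Weighted spaces\<close>

definition L2w :: "real \<Rightarrow> cfun3 set" where
  "L2w s = {f \<in> borel_measurable borel.
     integrable lborel (\<lambda>x. (jbr x powr s * norm (f x))\<^sup>2)}"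

definition L2w_norm :: "real \<Rightarrow> cfun3 \<Rightarrow> real" where
  "L2w_norm s f = sqrt (LINT x|lborel. (jbr x powr s * norm (f x))\<^sup>2)"

abbreviation L2 :: "cfun3 set" where
  "L2 \<equiv> L2w 0"

text \<open>Functions of at most polynomial growth in the mean: these define tempered distributions
  \<open>\<phi> \<mapsto> \<integral> f \<phi>\<close>.\<close>

definition tempered :: "cfun3 \<Rightarrow> bool" where
  "tempered f \<longleftrightarrow> f \<in> borel_measurable borel \<and>
     (\<exists>N::nat. integrable lborel (\<lambda>x. f x / of_real (jbr x ^ N)))"

text \<open>\<open>(1 - \<Delta>)\<^bsup>1/2\<^esup> f = h\<close> in the sense of tempered distributions. No reflection or conjugate
  appears in the dual operator, because the symbol is real and even.\<close>

definition bessel_eq :: "cfun3 \<Rightarrow> cfun3 \<Rightarrow> bool" where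
  "bessel_eq f h \<longleftrightarrow> (\<forall>\<phi>\<in>schwartz.
     (LINT x|lborel. f x * bessel_schwartz \<phi> x) = (LINT x|lborel. h x * \<phi> x))"

text \<open>\<open>H\<^bsup>1,s\<^esup>\<close>. Requiring \<open>f\<close> to be a function loses nothing: a tempered distribution \<open>f\<close> with
  \<open>(1 - \<Delta>)\<^bsup>1/2\<^esup> f\<close> in \<open>L\<^bsup>2,s\<^esup>\<close> lies in \<open>L\<^bsup>2,s\<^esup>\<close>, since \<open>(1 - \<Delta>)\<^bsup>-1/2\<^esup>\<close> is bounded there.\<close>

definition H1w :: "real \<Rightarrow> cfun3 set" where
  "H1w s = {f. tempered f \<and> (\<exists>h\<in>L2w s. bessel_eq f h)}"

definition H1w_norm :: "real \<Rightarrow> cfun3 \<Rightarrow> real" where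
  "H1w_norm s f = L2w_norm s (SOME h. h \<in> L2w s \<and> bessel_eq f h)"


subsection \<open>The operator \<open>H\<^sub>0 = \<surd>(-\<Delta>)\<close> and its resolvent\<close>

text \<open>The function \<open>F\<close> is the Fourier--Plancherel transform of \<open>f\<close>.\<close>

definition L2_fourier :: "cfun3 \<Rightarrow> cfun3 \<Rightarrow> bool" where
  "L2_fourier f F \<longleftrightarrow> f \<in> L2 \<and> F \<in> L2 \<and>
     (\<forall>\<phi>\<in>schwartz. (LINT x|lborel. f x * fourier \<phi> x) = (LINT \<xi>|lborel. F \<xi> * \<phi> \<xi>))"

text \<open>To be applied to \<open>f\<close> in the domain \<open>H\<^sup>1 = H\<^bsup>1,0\<^esup>\<close> only.\<close>

definition H0 :: "cfun3 \<Rightarrow> cfun3" where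
  "H0 f = (SOME w. \<exists>F. L2_fourier f F \<and> L2_fourier w (\<lambda>\<xi>. of_real (norm \<xi>) * F \<xi>))"

definition R0 :: "complex \<Rightarrow> cfun3 \<Rightarrow> cfun3" where
  "R0 z u = (SOME f. f \<in> H1w 0 \<and> (AE x in lborel. H0 f x - z * f x = u x))"


subsection \<open>Boundary values of the resolvent\<close>

definition bounded_op :: "real \<Rightarrow> (cfun3 \<Rightarrow> cfun3) \<Rightarrow> bool" where
  "bounded_op s T \<longleftrightarrow>
     (\<forall>u\<in>L2w s. T u \<in> H1w (- s)) \<and>
     (\<forall>u\<in>L2w s. \<forall>v\<in>L2w s. \<forall>a b.
        AE x in lborel. T (\<lambda>y. a * u y + b * v y) x = a * T u x + b * T v x) \<and>
     (\<exists>C. \<forall>u\<in>L2w s. H1w_norm (- s) (T u) \<le> C * L2w_norm s u)"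

text \<open>Norm of an operator from \<open>L\<^bsup>2,s\<^esup>\<close> to \<open>H\<^bsup>1,-s\<^esup>\<close>; it is \<open>\<infinity>\<close> if the operator does not map
  boundedly into \<open>H\<^bsup>1,-s\<^esup>\<close>.\<close>

definition op_norm :: "real \<Rightarrow> (cfun3 \<Rightarrow> cfun3) \<Rightarrow> ennreal" where
  "op_norm s T = Inf (ennreal ` {C. 0 \<le> C \<and>
     (\<forall>u\<in>L2w s. T u \<in> H1w (- s) \<and> H1w_norm (- s) (T u) \<le> C * L2w_norm s u)})"

text \<open>\<open>T\<close> is the boundary value \<open>R\<^sub>0\<^sup>\<plusminus>(\<lambda>)\<close>, where the sign is \<open>\<sigma> = 1\<close> or \<open>\<sigma> = -1\<close>: the limit in
  operator norm of \<open>R\<^sub>0(\<lambda> \<plusminus> i\<mu>)\<close> as \<open>\<mu>\<close> decreases to \<open>0\<close>.\<close>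

definition R0_boundary_value :: "real \<Rightarrow> real \<Rightarrow> real \<Rightarrow> (cfun3 \<Rightarrow> cfun3) \<Rightarrow> bool" where
  "R0_boundary_value \<sigma> s l T \<longleftrightarrow> bounded_op s T \<and>
     ((\<lambda>\<mu>. op_norm s (\<lambda>u x. R0 (Complex l (\<sigma> * \<mu>)) u x - T u x)) \<longlongrightarrow> 0) (at_right 0)"

definition pairing :: "cfun3 \<Rightarrow> cfun3 \<Rightarrow> complex" where
  "pairing f g = (LINT x|lborel. f x * cnj (g x))"


subsection \<open>The kernel\<close>

text \<open>The integrals over \<open>[\<rho>, \<infinity>)\<close> converge only conditionally and are improper integrals.
  Note the sign of \<open>ci\<close>, which is opposite to that of the common \<open>Ci\<close>.\<close>

definition ci :: "real \<Rightarrow> real" where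
  "ci \<rho> = Lim at_top (\<lambda>R. integral {\<rho>..R} (\<lambda>t. cos t / t))"

definition si :: "real \<Rightarrow> real" where
  "si \<rho> = - Lim at_top (\<lambda>R. integral {\<rho>..R} (\<lambda>t. sin t / t))"

definition m_ker :: "real \<Rightarrow> real ^ 3 \<Rightarrow> real" where
  "m_ker l x = l / (2 * pi\<^sup>2 * norm x) *
     (sin (l * norm x) * ci (l * norm x) + cos (l * norm x) * si (l * norm x))"

definition g_ker :: "real \<Rightarrow> real \<Rightarrow> real ^ 3 \<Rightarrow> complex" where
  "g_ker \<sigma> l x = of_real (1 / (2 * pi\<^sup>2 * (norm x)\<^sup>2))
     + of_real (l / (2 * pi)) * (exp (\<i> * of_real (\<sigma> * l * norm x)) / of_real (norm x))
     + of_real (m_ker l x)"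

end

theory Submission
  imports Defs "HOL-Probability.Probability"
begin

text \<open>
  With \<open>z = l + i\<sigma>\<mu>\<close> the partial fraction \<open>1 / (r - z) = 1 / (r + z) + 2z / (r\<^sup>2 - z\<^sup>2)\<close> splits the resolvent of
  \<open>H\<^sub>0 = \<surd>(-\<Delta>)\<close> into \<open>(H\<^sub>0 + z)\<^bsup>-1\<^esup>\<close>, which is harmless as \<open>\<mu> \<down> 0\<close>, and \<open>2z (-\<Delta> - z\<^sup>2)\<^bsup>-1\<^esup>\<close>, which is convolution with
  the Yukawa kernel \<open>e\<^bsup>-\<kappa>|x|\<^esup> / (4\<pi>|x|)\<close> for \<open>\<kappa> = \<mu> - i\<sigma>l\<close>. In the limit the second part yields the outgoing or
  incoming wave in the kernel. The first part is a superposition of Yukawa kernels with real parameter, whose kernel is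
  \<open>1 / (2\<pi>\<^sup>2|x|\<^sup>2) - (l / (2\<pi>\<^sup>2|x|)) \<integral>\<^sub>0\<^sup>\<infinity> e\<^bsup>-l|x|t\<^esup> / (1 + t\<^sup>2) dt\<close>, and this last integral is \<open>- (sin ci + cos si)(l|x|)\<close>.
  Convergence in \<open>H\<^bsup>1,-s\<^esup>\<close> implies convergence of the pairing with a test function, because a test function is
  \<open>(1 - \<Delta>)\<^bsup>1/2\<^esup>\<close> applied to a Schwartz function.
\<close>

section \<open>Schwartz functions\<close>

text \<open>The symbol \<open>1 / (|\<xi>| - z)\<close> has no integrable limit: it blows up on the
  whole sphere \<open>|\<xi>| = l\<close>, so the limit cannot be taken under the frequency
  integral. The partial fraction confines this singularity to \<open>1 / (|\<xi>|^2 - z^2)\<close>,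
  whose kernel is explicit and bounded by \<open>1 / (4 \<pi> |x|)\<close> uniformly in \<mu>; that
  limit is taken in x-space. The companion \<open>1 / (|\<xi>| + z)\<close> is bounded by
  \<open>1 / l\<close>; its limit is taken in \<xi>-space and turned into a kernel only afterwards,
  at the real point \<open>l\<close>. The operators are chosen by \<open>SOME\<close>, so nothing
  pointwise is known about \<open>R0 z u\<close>, and everything goes through integrals against
  Schwartz functions. Hence the Fourier theory is developed by duality, with one device behind
  inversion, uniqueness and the L^2 bound: averaging with Gaussians, whose transforms are explicit.
  Transforms of radial functions are likewise obtained from Gaussians and not from integration over
  spheres.\<close>

lemma partialI: "(f has_derivative f') (at x) \<Longrightarrow> partial i f x = f' (axis i 1)"
  unfolding partial_def using frechet_derivative_at by metis

lemma partial_foldr_snoc: "foldr partial is (partial i f) = foldr partial (is @ [i]) f"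
  by simp

text \<open>Smoothness is a greatest fixed point: a class of differentiable functions that
  \<open>partial\<close> maps into itself consists of smooth functions. The membership proofs below
  exhibit such a class instead of computing iterated derivatives.\<close>

lemma smooth_coinduct:
  assumes "f \<in> C" and diff: "\<And>f x. f \<in> C \<Longrightarrow> f differentiable (at x)"
    and part: "\<And>f i. f \<in> C \<Longrightarrow> partial i f \<in> C"
  shows "smooth f" and "foldr partial is f \<in> C"
proof -
  have *: "foldr partial is f \<in> C" for "is"
    by (induction "is") (use assms(1) part in auto)
  then show "smooth f" unfolding smooth_def using diff by blast
  show "foldr partial is f \<in> C" by (rule *)
qed

lemma smooth_differentiable: "smooth f \<Longrightarrow> f differentiable (at x)"
  unfolding smooth_def by (metis foldr_Nil id_apply)

lemma smooth_partial: "smooth f \<Longrightarrow> smooth (partial i f)"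
  unfolding smooth_def using partial_foldr_snoc by metis

section \<open>The weight \<open>jbr\<close>, the Japanese bracket\<close>

lemma jbr_ge1: "1 \<le> jbr x" and jbr_pos [simp]: "0 < jbr x" and jbr_ge0 [simp]: "0 \<le> jbr x"
  and jbr_neq0 [simp]: "jbr x \<noteq> 0"
proof -
  show "1 \<le> jbr x" unfolding jbr_def by simp
  then show "0 < jbr x" by linarith
  then show "0 \<le> jbr x" "jbr x \<noteq> 0" by linarith+
qed

lemma jbr_square: "(jbr x)\<^sup>2 = 1 + (norm x)\<^sup>2"
  unfolding jbr_def by simp

lemma norm_le_jbr: "norm x \<le> jbr x"
  unfolding jbr_def by (simp add: real_le_rsqrt)

lemma jbr_uminus [simp]: "jbr (- x) = jbr x" unfolding jbr_def by simp

lemma continuous_on_jbr [continuous_intros]: "continuous_on S jbr"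
  unfolding jbr_def by (intro continuous_intros)

lemma borel_measurable_jbr [measurable]: "jbr \<in> borel_measurable borel"
  by (intro borel_measurable_continuous_onI continuous_on_jbr)

lemma has_derivative_jbr:
  "(jbr has_derivative (\<lambda>h. (x \<bullet> h) / jbr x)) (at x)"
proof -
  have *: "jbr = (\<lambda>x. sqrt (1 + x \<bullet> x))" unfolding jbr_def by (simp add: power2_norm_eq_inner)
  show ?thesis unfolding *
    by (rule derivative_eq_intros has_derivative_ident refl add_pos_nonneg zero_less_one inner_ge_zero
        | simp add: fun_eq_iff inner_commute field_simps)+
qed

section \<open>Rapid decay and the Schwartz space\<close>

definition decaying :: "cfun3 \<Rightarrow> bool" where
  "decaying f \<longleftrightarrow> (\<forall>N::nat. \<exists>B. \<forall>x. jbr x ^ N * norm (f x) \<le> B)"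

lemma decaying_iff_bounded:
  "decaying f \<longleftrightarrow> (\<forall>N::nat. bounded (range (\<lambda>x. of_real (jbr x ^ N) * f x)))"
  unfolding decaying_def bounded_iff by (simp add: norm_mult norm_power)

lemma decayingD: "decaying f \<Longrightarrow> \<exists>B\<ge>0. \<forall>x. jbr x ^ N * norm (f x) \<le> B"
proof -
  assume "decaying f"
  then obtain B where B: "\<forall>x. jbr x ^ N * norm (f x) \<le> B" unfolding decaying_def by blast
  then have "B \<ge> 0" by (meson jbr_ge0 mult_nonneg_nonneg norm_ge_zero order_trans zero_le_power)
  with B show ?thesis by blast
qed

lemma decaying_add: "decaying f \<Longrightarrow> decaying g \<Longrightarrow> decaying (\<lambda>x. f x + g x)"
  unfolding decaying_def
proof
  fix N :: nat
  assume "\<forall>N. \<exists>B. \<forall>x. jbr x ^ N * cmod (f x) \<le> B" "\<forall>N. \<exists>B. \<forall>x. jbr x ^ N * cmod (g x) \<le> B"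
  then obtain A B where A: "\<And>x. jbr x ^ N * cmod (f x) \<le> A" and B: "\<And>x. jbr x ^ N * cmod (g x) \<le> B"
    by metis
  have "jbr x ^ N * cmod (f x + g x) \<le> A + B" for x
  proof -
    have "jbr x ^ N * cmod (f x + g x) \<le> jbr x ^ N * cmod (f x) + jbr x ^ N * cmod (g x)"
      by (metis distrib_left jbr_ge0 mult_left_mono norm_triangle_ineq zero_le_power)
    then show ?thesis using A[of x] B[of x] by linarith
  qed
  then show "\<exists>B. \<forall>x. jbr x ^ N * cmod (f x + g x) \<le> B" by blast
qed

lemma schwartz_iff: "f \<in> schwartz \<longleftrightarrow> smooth f \<and> (\<forall>is. decaying (foldr partial is f))"
  unfolding schwartz_def decaying_iff_bounded by blast

lemma schwartz_coinduct:
  assumes "f \<in> C" and diff: "\<And>f x. f \<in> C \<Longrightarrow> f differentiable (at x)"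
    and part: "\<And>f i. f \<in> C \<Longrightarrow> partial i f \<in> C"
    and decay: "\<And>f. f \<in> C \<Longrightarrow> decaying f"
  shows "f \<in> schwartz"
  unfolding schwartz_iff using smooth_coinduct[OF assms(1) diff part] decay by blast

lemma schwartz_smooth: "f \<in> schwartz \<Longrightarrow> smooth f"
  unfolding schwartz_def by blast

lemma schwartz_differentiable: "f \<in> schwartz \<Longrightarrow> f differentiable (at x)"
  using schwartz_smooth smooth_differentiable by blast

lemma schwartz_partial: "f \<in> schwartz \<Longrightarrow> partial i f \<in> schwartz"
  unfolding schwartz_iff partial_foldr_snoc using smooth_partial by blast

lemma schwartz_decaying: "f \<in> schwartz \<Longrightarrow> decaying f"
  unfolding schwartz_iff by (metis foldr_Nil id_apply)

lemma schwartz_continuous_on: "f \<in> schwartz \<Longrightarrow> continuous_on S f"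
  by (meson continuous_at_imp_continuous_on differentiable_imp_continuous_within schwartz_differentiable)

lemma schwartz_measurable [measurable_dest]: "f \<in> schwartz \<Longrightarrow> f \<in> borel_measurable borel"
  by (intro borel_measurable_continuous_onI schwartz_continuous_on)

lemma partial_add:
  assumes "f differentiable (at x)" "g differentiable (at x)"
  shows "partial i (\<lambda>x. f x + g x) x = partial i f x + partial i g x"
proof -
  have "((\<lambda>x. f x + g x) has_derivative (\<lambda>h. frechet_derivative f (at x) h + frechet_derivative g (at x) h)) (at x)"
    using assms by (intro has_derivative_add) (auto simp: frechet_derivative_works)
  from partialI[OF this] show ?thesis by (simp add: partial_def)
qed

lemma partial_mult:
  assumes "f differentiable (at x)" "g differentiable (at x)"
  shows "partial i (\<lambda>x. f x * g x) x = partial i f x * g x + f x * partial i g x"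
proof -
  have "((\<lambda>x. f x * g x) has_derivative (\<lambda>h. f x * frechet_derivative g (at x) h + frechet_derivative f (at x) h * g x)) (at x)"
    using assms by (intro has_derivative_mult) (auto simp: frechet_derivative_works)
  from partialI[OF this] show ?thesis by (simp add: partial_def)
qed

subsection \<open>Symbols\<close>

text \<open>A class of multipliers stable under \<open>partial\<close>: the derivative of
  \<open>jbr\<close> is a coordinate divided by \<open>jbr\<close>, which is why the inverse is a
  generator. The inverse also serves to invert the Bessel operator and to place a polynomial weight
  inside a test function.\<close>

inductive symb :: "cfun3 \<Rightarrow> bool" where
  const: "symb (\<lambda>_. c)"
| coord: "symb (\<lambda>x. of_real (x $ i))"
| jbr: "symb (\<lambda>x. of_real (jbr x))"
| inverse_jbr: "symb (\<lambda>x. of_real (inverse (jbr x)))"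
| add: "symb a \<Longrightarrow> symb b \<Longrightarrow> symb (\<lambda>x. a x + b x)"
| mult: "symb a \<Longrightarrow> symb b \<Longrightarrow> symb (\<lambda>x. a x * b x)"

lemma has_derivative_cof_real:
  "(f has_derivative f') F \<Longrightarrow> ((\<lambda>x. complex_of_real (f x)) has_derivative (\<lambda>h. of_real (f' h))) F"
  by (rule bounded_linear.has_derivative[OF bounded_linear_of_real])

lemma has_derivative_coord: "((\<lambda>x. complex_of_real (x $ i)) has_derivative (\<lambda>h. of_real (h $ i))) (at x)"
  by (intro has_derivative_cof_real bounded_linear_imp_has_derivative bounded_linear_vec_nth)

lemma has_derivative_inverse_jbr:
  "((\<lambda>x. inverse (jbr x)) has_derivative (\<lambda>h. - ((x \<bullet> h) * inverse (jbr x) ^ 3))) (at x)"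
  by (rule has_derivative_eq_rhs[OF Deriv.has_derivative_inverse[OF jbr_neq0 has_derivative_jbr]])
    (auto simp: fun_eq_iff field_simps power3_eq_cube)

lemma symb_differentiable: "symb m \<Longrightarrow> m differentiable (at x)"
proof (induction rule: symb.induct)
  case (coord i) show ?case using has_derivative_coord differentiableI by blast
next
  case jbr show ?case using has_derivative_cof_real[OF has_derivative_jbr] differentiableI by blast
next
  case inverse_jbr
  show ?case using has_derivative_cof_real[OF has_derivative_inverse_jbr] differentiableI by blast
qed (auto intro: differentiable_add differentiable_mult)

lemma partial_coord: "partial i (\<lambda>x. of_real (x $ j)) = (\<lambda>x. of_real (if i = j then 1 else 0))"
  by (rule ext, subst partialI[OF has_derivative_coord]) (simp add: axis_def)

lemma symb_partial: "symb m \<Longrightarrow> symb (partial i m)"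
proof (induction rule: symb.induct)
  case (const c)
  have "partial i (\<lambda>_. c) = (\<lambda>_. 0)" by (rule ext, subst partialI[OF has_derivative_const]) simp
  then show ?case by (simp add: symb.const)
next
  case (coord j)
  show ?case unfolding partial_coord by (rule symb.const)
next
  case jbr
  have "partial i (\<lambda>x. of_real (jbr x)) = (\<lambda>x. of_real (x $ i) * of_real (inverse (jbr x)))"
    by (rule ext, subst partialI[OF has_derivative_cof_real[OF has_derivative_jbr]])
      (simp add: inner_axis field_simps)
  then show ?case by (simp only: symb.intros)
next
  case inverse_jbr
  have "partial i (\<lambda>x. of_real (inverse (jbr x))) =
    (\<lambda>x. (-1) * (of_real (x $ i) * (of_real (inverse (jbr x)) * (of_real (inverse (jbr x)) * of_real (inverse (jbr x))))))"
    by (rule ext, subst partialI[OF has_derivative_cof_real[OF has_derivative_inverse_jbr]])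
      (simp add: inner_axis power3_eq_cube)
  then show ?case by (simp only: symb.intros)
next
  case (add a b)
  have "partial i (\<lambda>x. a x + b x) = (\<lambda>x. partial i a x + partial i b x)"
    using add symb_differentiable by (intro ext partial_add) auto
  then show ?case using add by (auto intro: symb.intros)
next
  case (mult a b)
  have "partial i (\<lambda>x. a x * b x) = (\<lambda>x. partial i a x * b x + a x * partial i b x)"
    using mult symb_differentiable by (intro ext partial_mult) auto
  then show ?case using mult by (auto intro: symb.intros)
qed

lemma symb_growth: "symb m \<Longrightarrow> \<exists>B\<ge>0. \<exists>N. \<forall>x. norm (m x) \<le> B * jbr x ^ N"
proof (induction rule: symb.induct)
  case (const c)
  show ?case by (rule exI[of _ "norm c"]) (auto intro!: exI[of _ 0])
next
  case (coord i)
  have "\<bar>x $ i\<bar> \<le> 1 * jbr x ^ 1" for x :: "real^3"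
    using norm_le_jbr[of x] component_le_norm_cart[of x i] by simp
  then show ?case by (metis norm_of_real zero_le_one)
next
  case jbr
  show ?case by (rule exI[of _ 1]) (auto intro!: exI[of _ 1])
next
  case inverse_jbr
  have "inverse (jbr x) \<le> 1" for x using jbr_ge1[of x] by (simp add: inverse_le_1_iff)
  then show ?case by (intro exI[of _ 1] conjI exI[of _ 0]) (auto simp: norm_inverse)
next
  case (add a b)
  then obtain A N B M where A: "A \<ge> 0" "\<And>x. norm (a x) \<le> A * jbr x ^ N"
    and B: "B \<ge> 0" "\<And>x. norm (b x) \<le> B * jbr x ^ M" by blast
  have "norm (a x + b x) \<le> (A + B) * jbr x ^ (N + M)" for x
  proof -
    have "norm (a x + b x) \<le> A * jbr x ^ N + B * jbr x ^ M"
      using A(2)[of x] B(2)[of x] norm_triangle_ineq[of "a x" "b x"] by linarith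
    also have "\<dots> \<le> A * jbr x ^ (N + M) + B * jbr x ^ (N + M)"
      using A(1) B(1) jbr_ge1[of x] by (intro add_mono mult_left_mono power_increasing) auto
    finally show ?thesis by (simp add: algebra_simps)
  qed
  then show ?case using A(1) B(1) by (intro exI[of _ "A + B"]) auto
next
  case (mult a b)
  then obtain A N B M where A: "A \<ge> 0" "\<And>x. norm (a x) \<le> A * jbr x ^ N"
    and B: "B \<ge> 0" "\<And>x. norm (b x) \<le> B * jbr x ^ M" by blast
  have "norm (a x * b x) \<le> (A * B) * jbr x ^ (N + M)" for x
  proof -
    have "norm (a x * b x) \<le> (A * jbr x ^ N) * (B * jbr x ^ M)"
      unfolding norm_mult using A B by (intro mult_mono) auto
    then show ?thesis by (simp add: power_add mult_ac)
  qed
  then show ?case using A(1) B(1) by (intro exI[of _ "A * B"]) auto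
qed

lemma symb_power: "symb a \<Longrightarrow> symb (\<lambda>x. a x ^ n)"
  by (induction n) (auto intro: symb.intros)

lemma decaying_symb_mult:
  assumes "symb m" "decaying f" shows "decaying (\<lambda>x. m x * f x)"
  unfolding decaying_def
proof
  fix N
  obtain B M where B: "B \<ge> 0" "\<And>x. norm (m x) \<le> B * jbr x ^ M" using symb_growth[OF assms(1)] by blast
  obtain A where A: "\<And>x. jbr x ^ (M + N) * norm (f x) \<le> A" using assms(2) unfolding decaying_def by metis
  have "jbr x ^ N * norm (m x * f x) \<le> B * A" for x
  proof -
    have "jbr x ^ N * norm (m x * f x) = norm (m x) * (jbr x ^ N * norm (f x))" by (simp add: norm_mult)
    also have "\<dots> \<le> (B * jbr x ^ M) * (jbr x ^ N * norm (f x))" using B by (intro mult_right_mono) auto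
    also have "\<dots> = B * (jbr x ^ (M + N) * norm (f x))" by (simp add: power_add)
    also have "\<dots> \<le> B * A" using A B by (intro mult_left_mono) auto
    finally show ?thesis .
  qed
  then show "\<exists>B. \<forall>x. jbr x ^ N * norm (m x * f x) \<le> B" by blast
qed

text \<open>Sums are included because the product rule turns a single product into two; the products
  alone are not visibly stable under \<open>partial\<close>.\<close>

inductive_set symb_schwartz :: "cfun3 set" where
  base: "symb m \<Longrightarrow> f \<in> schwartz \<Longrightarrow> (\<lambda>x. m x * f x) \<in> symb_schwartz"
| sum: "f \<in> symb_schwartz \<Longrightarrow> g \<in> symb_schwartz \<Longrightarrow> (\<lambda>x. f x + g x) \<in> symb_schwartz"

lemma symb_schwartz_differentiable: "f \<in> symb_schwartz \<Longrightarrow> f differentiable (at x)"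
  by (induction rule: symb_schwartz.induct)
    (auto intro: differentiable_add differentiable_mult symb_differentiable schwartz_differentiable)

lemma symb_schwartz_subset: "f \<in> symb_schwartz \<Longrightarrow> f \<in> schwartz"
proof (erule schwartz_coinduct)
  fix f x assume "f \<in> symb_schwartz" then show "f differentiable (at x)" by (rule symb_schwartz_differentiable)
next
  fix f i assume "f \<in> symb_schwartz" then show "partial i f \<in> symb_schwartz"
  proof (induction rule: symb_schwartz.induct)
    case (base m f)
    have "partial i (\<lambda>x. m x * f x) = (\<lambda>x. partial i m x * f x + m x * partial i f x)"
      using base by (intro ext partial_mult symb_differentiable schwartz_differentiable)
    moreover have "(\<lambda>x. partial i m x * f x + m x * partial i f x) \<in> symb_schwartz"
      using base symb_partial schwartz_partial by (intro symb_schwartz.intros) auto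
    ultimately show ?case by simp
  next
    case (sum f g)
    have "partial i (\<lambda>x. f x + g x) = (\<lambda>x. partial i f x + partial i g x)"
      using sum by (intro ext partial_add symb_schwartz_differentiable)
    then show ?case using sum by (auto intro: symb_schwartz.intros)
  qed
next
  fix f assume "f \<in> symb_schwartz" then show "decaying f"
    by (induction rule: symb_schwartz.induct) (auto intro: decaying_add decaying_symb_mult schwartz_decaying)
qed

lemma schwartz_symb_mult: "symb m \<Longrightarrow> f \<in> schwartz \<Longrightarrow> (\<lambda>x. m x * f x) \<in> schwartz"
  by (rule symb_schwartz_subset[OF symb_schwartz.base])

lemma schwartz_const_mult: "f \<in> schwartz \<Longrightarrow> (\<lambda>x. c * f x) \<in> schwartz"
  by (intro schwartz_symb_mult symb.const)

lemma schwartz_coord_mult: "f \<in> schwartz \<Longrightarrow> (\<lambda>x. of_real (x $ i) * f x) \<in> schwartz"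
  by (intro schwartz_symb_mult symb.coord)

lemma schwartz_add:
  assumes "f \<in> schwartz" "g \<in> schwartz" shows "(\<lambda>x. f x + g x) \<in> schwartz"
proof -
  have "(\<lambda>x. 1 * f x + 1 * g x) \<in> symb_schwartz" using assms by (intro symb_schwartz.intros symb.const)
  then show ?thesis using symb_schwartz_subset by simp
qed

section \<open>Reflection, conjugation and test functions\<close>

lemma schwartz_uminus_arg:
  assumes "f \<in> schwartz" shows "(\<lambda>x. f (- x)) \<in> schwartz"
proof (rule schwartz_coinduct[where C = "{g. \<exists>f\<in>schwartz. g = (\<lambda>x. f (- x))}"])
  have D: "((\<lambda>x. f (- x)) has_derivative (\<lambda>h. frechet_derivative f (at (- x)) (- h))) (at x)"
    if "f \<in> schwartz" for f and x :: "real^3"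
    by (rule has_derivative_compose[where g = f and f = uminus, OF has_derivative_minus[OF has_derivative_ident]])
      (use schwartz_differentiable[OF that] frechet_derivative_works in blast)
  show "(\<lambda>x. f (- x)) \<in> {g. \<exists>f\<in>schwartz. g = (\<lambda>x. f (- x))}" using assms by blast
  fix g assume "g \<in> {g. \<exists>f\<in>schwartz. g = (\<lambda>x. f (- x))}"
  then obtain f where f: "f \<in> schwartz" "g = (\<lambda>x. f (- x))" by blast
  show "g differentiable (at x)" for x using D f differentiableI by blast
  show "partial i g \<in> {g. \<exists>f\<in>schwartz. g = (\<lambda>x. f (- x))}" for i
  proof -
    have "partial i g = (\<lambda>x. (-1) * partial i f (- x))"
    proof
      fix x
      have "linear (frechet_derivative f (at (- x)))"
        using linear_frechet_derivative schwartz_differentiable f by blast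
      then show "partial i g x = (-1) * partial i f (- x)"
        unfolding f(2) partialI[OF D[OF f(1)]] by (simp add: partial_def linear_neg)
    qed
    then show ?thesis
      using schwartz_const_mult[OF schwartz_partial[OF f(1), of i], of "-1"]
      by (intro CollectI bexI[of _ "\<lambda>x. (-1) * partial i f x"])
  qed
  show "decaying g"
    using schwartz_decaying[OF f(1)] unfolding f(2) decaying_def by (metis jbr_uminus)
qed

lemma schwartz_cnj:
  assumes "f \<in> schwartz" shows "(\<lambda>x. cnj (f x)) \<in> schwartz"
proof (rule schwartz_coinduct[where C = "{g. \<exists>f\<in>schwartz. g = (\<lambda>x. cnj (f x))}"])
  have D: "((\<lambda>x. cnj (f x)) has_derivative (\<lambda>h. cnj (frechet_derivative f (at x) h))) (at x)"
    if "f \<in> schwartz" for f and x :: "real^3"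
    by (rule bounded_linear.has_derivative[OF bounded_linear_cnj])
      (use schwartz_differentiable[OF that] frechet_derivative_works in blast)
  show "(\<lambda>x. cnj (f x)) \<in> {g. \<exists>f\<in>schwartz. g = (\<lambda>x. cnj (f x))}" using assms by blast
  fix g assume "g \<in> {g. \<exists>f\<in>schwartz. g = (\<lambda>x. cnj (f x))}"
  then obtain f where f: "f \<in> schwartz" "g = (\<lambda>x. cnj (f x))" by blast
  show "g differentiable (at x)" for x using D f differentiableI by blast
  show "partial i g \<in> {g. \<exists>f\<in>schwartz. g = (\<lambda>x. cnj (f x))}" for i
  proof -
    have "partial i g = (\<lambda>x. cnj (partial i f x))"
      unfolding f(2) partialI[OF D[OF f(1)]] by (simp add: partial_def fun_eq_iff partialI[OF D[OF f(1)]])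
    then show ?thesis using schwartz_partial[OF f(1)] by blast
  qed
  show "decaying g"
    using schwartz_decaying[OF f(1)] unfolding f(2) decaying_def by simp
qed

text \<open>The compact set \<open>K\<close> is fixed once, as the closed support of the given
  function. Its complement is open, so derivatives vanish there as well, and every member of the
  class is bounded against any weight by compactness of \<open>K\<close>.\<close>

lemma C0_infty_schwartz:
  assumes "f \<in> C0_infty" shows "f \<in> schwartz"
proof -
  define K where "K = closure {x. f x \<noteq> 0}"
  have K: "compact K" "smooth f" "\<And>x. x \<notin> K \<Longrightarrow> f x = 0"
    using assms closure_subset[of "{x. f x \<noteq> 0}"] unfolding C0_infty_def K_def by auto
  show ?thesis
  proof (rule schwartz_coinduct[where C = "{f. smooth f \<and> (\<forall>x. x \<notin> K \<longrightarrow> f x = 0)}"])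
    show "f \<in> {f. smooth f \<and> (\<forall>x. x \<notin> K \<longrightarrow> f x = 0)}" using K by blast
    fix f :: cfun3 assume "f \<in> {f. smooth f \<and> (\<forall>x. x \<notin> K \<longrightarrow> f x = 0)}"
    then have f: "smooth f" "\<And>x. x \<notin> K \<Longrightarrow> f x = 0" by auto
    show "f differentiable (at x)" for x using f smooth_differentiable by blast
    have "partial i f x = 0" if "x \<notin> K" for x i
    proof -
      have "open (- K)" "x \<in> - K" using K that by (auto simp: compact_imp_closed open_Compl)
      then have "(f has_derivative (\<lambda>h. 0)) (at x)"
        by (intro has_derivative_transform_within_open[OF has_derivative_const[of 0]]) (auto simp: f(2))
      from partialI[OF this] show ?thesis .
    qed
    then show "partial i f \<in> {f. smooth f \<and> (\<forall>x. x \<notin> K \<longrightarrow> f x = 0)}" for i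
      using smooth_partial[OF f(1)] by blast
    show "decaying f" unfolding decaying_def
    proof
      fix N
      have "continuous_on K f"
        by (meson continuous_at_imp_continuous_on differentiable_imp_continuous_within f(1) smooth_differentiable)
      then have "continuous_on K (\<lambda>x. jbr x ^ N * norm (f x))" by (intro continuous_intros)
      then have "bounded ((\<lambda>x. jbr x ^ N * norm (f x)) ` K)"
        using K(1) compact_continuous_image compact_imp_bounded by blast
      then obtain B where "B > 0" and B: "\<forall>y\<in>(\<lambda>x. jbr x ^ N * norm (f x)) ` K. norm y \<le> B"
        unfolding bounded_pos by blast
      have "jbr x ^ N * norm (f x) \<le> B" for x
      proof (cases "x \<in> K")
        case True then show ?thesis using bspec[OF B, of "jbr x ^ N * norm (f x)"] by auto
      next
        case False then show ?thesis using f(2) \<open>B > 0\<close> by simp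
      qed
      then show "\<exists>B. \<forall>x. jbr x ^ N * cmod (f x) \<le> B" by blast
    qed
  qed
qed

subsection \<open>Gaussians\<close>

definition gaussian :: "real \<Rightarrow> real^3 \<Rightarrow> real^3 \<Rightarrow> real" where
  "gaussian c y x = exp (- (c * (norm (x - y))\<^sup>2))"

lemma has_derivative_gaussian:
  "(gaussian c y has_derivative (\<lambda>h. - (2 * c * ((x - y) \<bullet> h) * gaussian c y x))) (at x)"
proof -
  have *: "gaussian c y = (\<lambda>x. exp (- (c * ((x - y) \<bullet> (x - y)))))"
    unfolding gaussian_def by (simp add: power2_norm_eq_inner)
  show ?thesis unfolding *
    apply (rule derivative_eq_intros refl)+
    apply (auto simp: fun_eq_iff inner_commute algebra_simps)
    done
qed

lemma decaying_gaussian: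
  assumes "c > 0" shows "decaying (\<lambda>x. of_real (gaussian c y x))"
  unfolding decaying_def
proof
  fix N :: nat
  \<comment> \<open>By the triangle inequality \<open>jbr x \<le> C + norm (x - y)\<close>, so the
    claim becomes one about a single real variable \<open>r\<close>: large \<open>r\<close> are
    covered by the limit, small \<open>r\<close> by monotonicity.\<close>
  define C where "C = 1 + norm y"
  have "((\<lambda>r::real. (C + r) ^ N * exp (- (c * r\<^sup>2))) \<longlongrightarrow> 0) at_top"
    using assms unfolding C_def by real_asymp
  then have "\<forall>\<^sub>F r in at_top. (C + r) ^ N * exp (- (c * r\<^sup>2)) < 1"
    by (rule order_tendstoD) simp
  then obtain R where R: "\<And>r. r \<ge> R \<Longrightarrow> (C + r) ^ N * exp (- (c * r\<^sup>2)) < 1"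
    unfolding eventually_at_top_linorder by blast
  have C: "C \<ge> 1" unfolding C_def by simp
  have "jbr x ^ N * gaussian c y x \<le> 1 + (C + \<bar>R\<bar>) ^ N" for x
  proof -
    define r where "r = norm (x - y)"
    have "jbr x \<le> C + r"
    proof -
      have "jbr x \<le> 1 + norm x" unfolding jbr_def
        by (rule real_le_lsqrt) (auto simp: power2_eq_square algebra_simps)
      also have "norm x \<le> norm y + r" unfolding r_def by norm
      finally show ?thesis unfolding C_def by simp
    qed
    then have *: "jbr x ^ N * gaussian c y x \<le> (C + r) ^ N * exp (- (c * r\<^sup>2))"
      unfolding gaussian_def r_def[symmetric] by (intro mult_right_mono power_mono) auto
    show ?thesis
    proof (cases "r \<ge> R")
      case True
      moreover have "(C + \<bar>R\<bar>) ^ N \<ge> 0" using C by auto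
      ultimately show ?thesis using R[of r] * by linarith
    next
      case False
      have "(C + r) ^ N * exp (- (c * r\<^sup>2)) \<le> (C + \<bar>R\<bar>) ^ N * 1"
        using False C assms unfolding r_def by (intro mult_mono power_mono) auto
      then show ?thesis using * by linarith
    qed
  qed
  then show "\<exists>B. \<forall>x. jbr x ^ N * cmod (of_real (gaussian c y x)) \<le> B"
    unfolding gaussian_def by auto
qed

text \<open>Differentiation only changes the factor in front of the Gaussian, and that factor
  remains a symbol.\<close>

lemma schwartz_gaussian:
  assumes "c > 0" shows "(\<lambda>x. of_real (gaussian c y x)) \<in> schwartz"
proof (rule schwartz_coinduct[where C = "{f. \<exists>m. symb m \<and> f = (\<lambda>x. m x * of_real (gaussian c y x))}"])
  let ?C = "{f. \<exists>m. symb m \<and> f = (\<lambda>x. m x * of_real (gaussian c y x))}"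
  show "(\<lambda>x. complex_of_real (gaussian c y x)) \<in> ?C"
    using symb.const[of 1] by (intro CollectI exI[of _ "\<lambda>_. 1"]) auto
  have g: "(\<lambda>x. complex_of_real (gaussian c y x)) differentiable (at x)" for x
    using has_derivative_cof_real[OF has_derivative_gaussian] differentiableI by blast
  fix f assume "f \<in> ?C"
  then obtain m where m: "symb m" and f: "f = (\<lambda>x. m x * of_real (gaussian c y x))" by blast
  show "f differentiable (at x)" for x
    unfolding f using g symb_differentiable[OF m] by (intro differentiable_mult)
  show "partial i f \<in> ?C" for i
  proof -
    have "partial i f x = (partial i m x + (of_real (- 2 * c) * m x) * (of_real (x $ i) + of_real (- y $ i)))
        * of_real (gaussian c y x)" for x
      unfolding f partial_mult[OF symb_differentiable[OF m] g]
        partialI[OF has_derivative_cof_real[OF has_derivative_gaussian]]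
      by (simp add: inner_axis algebra_simps)
    moreover have "symb (\<lambda>x. partial i m x + (of_real (- 2 * c) * m x) * (of_real (x $ i) + of_real (- y $ i)))"
      using m symb_partial by (intro symb.intros) auto
    ultimately show ?thesis by blast
  qed
  show "decaying f" unfolding f using m assms by (intro decaying_symb_mult decaying_gaussian)
qed

section \<open>Integration on three-space\<close>

definition radial_measure :: "real measure" where
  "radial_measure = density lborel (\<lambda>a. ennreal (indicator {0..} a * (4 * pi * a\<^sup>2)))"

text \<open>Both measures give a half-line \<open>{..a}\<close> the volume of the ball of radius
  \<open>a\<close>, and half-lines generate the Borel sets. This replaces polar coordinates for
  integrands that depend on the norm only.\<close>

lemma distr_norm_lborel: "distr (lborel :: (real^3) measure) borel norm = radial_measure"
proof (rule measure_eqI_generator_eq[where E = "range atMost" and \<Omega> = UNIV and A = "\<lambda>n::nat. {..real n}"])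
  show "Int_stable (range (atMost :: real \<Rightarrow> _))" by (auto simp: Int_stable_def intro!: image_eqI)
  show "sets (distr lborel borel (norm :: real^3 \<Rightarrow> real)) = sigma_sets UNIV (range atMost)"
    "sets radial_measure = sigma_sets UNIV (range atMost)"
    by (simp_all add: radial_measure_def borel_eq_atMost)
  show "range (\<lambda>n. {..real n}) \<subseteq> range atMost" by blast
  show "(\<Union>i. {..real i}) = UNIV" using real_arch_simple by auto
  have 1: "emeasure (distr (lborel :: (real^3) measure) borel norm) {..a} = ennreal (if a \<ge> 0 then 4/3 * pi * a^3 else 0)" for a
  proof -
    have "emeasure (distr (lborel :: (real^3) measure) borel norm) {..a} = emeasure lborel (cball (0 :: real^3) a)"
      by (subst emeasure_distr) (auto intro!: arg_cong2[where f = emeasure])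
    also have "\<dots> = ennreal (if a \<ge> 0 then 4/3 * pi * a^3 else 0)"
      using emeasure_cball[of a "0 :: real^3"] by (cases "a \<ge> 0") (auto simp: unit_ball_vol_3)
    finally show ?thesis .
  qed
  show "emeasure (distr (lborel :: (real^3) measure) borel norm) {..real i} \<noteq> \<infinity>" for i
    unfolding 1 by simp
  fix X :: "real set" assume "X \<in> range atMost"
  then obtain a where X: "X = {..a}" by blast
  have "emeasure radial_measure {..a} = (\<integral>\<^sup>+x. ennreal (indicator {0..} x * (4 * pi * x\<^sup>2)) * indicator {..a} x \<partial>lborel)"
    unfolding radial_measure_def by (subst emeasure_density) auto
  also have "\<dots> = ennreal (if a \<ge> 0 then 4/3 * pi * a^3 else 0)"
  proof (cases "a \<ge> 0")
    case True
    have "(\<integral>\<^sup>+x. ennreal (indicator {0..} x * (4 * pi * x\<^sup>2)) * indicator {..a} x \<partial>lborel)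
        = (\<integral>\<^sup>+x. ennreal (4 * pi * x\<^sup>2) * indicator {0..a} x \<partial>lborel)"
      by (intro nn_integral_cong) (auto split: split_indicator)
    also have "\<dots> = ennreal (4/3 * pi * a^3 - 4/3 * pi * 0^3)"
      by (rule nn_integral_FTC_Icc) (use True in \<open>auto intro!: derivative_eq_intros simp: power2_eq_square\<close>)
    finally show ?thesis using True by simp
  next
    case False
    have "(\<integral>\<^sup>+x. ennreal (indicator {0..} x * (4 * pi * x\<^sup>2)) * indicator {..a} x \<partial>lborel)
        = (\<integral>\<^sup>+x. 0 \<partial>(lborel :: real measure))"
      by (intro nn_integral_cong) (use False in \<open>auto split: split_indicator\<close>)
    with False show ?thesis by simp
  qed
  finally show "emeasure (distr lborel borel (norm :: real^3 \<Rightarrow> real)) X = emeasure radial_measure X"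
    unfolding X 1 by simp
qed simp_all

lemma
  fixes f :: "real \<Rightarrow> 'b::{banach, second_countable_topology}"
  assumes [measurable]: "f \<in> borel_measurable borel"
  shows integrable_radial_iff: "integrable lborel (\<lambda>x::real^3. f (norm x)) \<longleftrightarrow>
      integrable lborel (\<lambda>a. (indicator {0..} a * (4 * pi * a\<^sup>2)) *\<^sub>R f a)"
    and integral_radial: "(LINT x::real^3|lborel. f (norm x)) =
      (LBINT a. (indicator {0..} a * (4 * pi * a\<^sup>2)) *\<^sub>R f a)"
proof -
  have "integrable lborel (\<lambda>x::real^3. f (norm x)) \<longleftrightarrow> integrable radial_measure f"
    unfolding distr_norm_lborel[symmetric] by (subst integrable_distr_eq) auto
  also have "\<dots> \<longleftrightarrow> integrable lborel (\<lambda>a. (indicator {0..} a * (4 * pi * a\<^sup>2)) *\<^sub>R f a)"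
    unfolding radial_measure_def by (subst integrable_density) auto
  finally show "integrable lborel (\<lambda>x::real^3. f (norm x)) \<longleftrightarrow>
      integrable lborel (\<lambda>a. (indicator {0..} a * (4 * pi * a\<^sup>2)) *\<^sub>R f a)" .
  have "(LINT x::real^3|lborel. f (norm x)) = integral\<^sup>L radial_measure f"
    unfolding distr_norm_lborel[symmetric] by (subst integral_distr) auto
  also have "\<dots> = (LBINT a. (indicator {0..} a * (4 * pi * a\<^sup>2)) *\<^sub>R f a)"
    unfolding radial_measure_def by (subst integral_density) auto
  finally show "(LINT x::real^3|lborel. f (norm x)) =
      (LBINT a. (indicator {0..} a * (4 * pi * a\<^sup>2)) *\<^sub>R f a)" .
qed

lemma integrable_inverse_square_plus1: "integrable lborel (\<lambda>a::real. indicator {0..} a / (1 + a\<^sup>2))"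
  and integral_inverse_square_plus1: "(LBINT a. indicator {0..} a / (1 + a\<^sup>2)) = pi / 2"
proof -
  have ae: "AE a in lborel. indicator {0<..} a * (1 / (1 + a\<^sup>2)) = indicator {0..} a / (1 + a\<^sup>2 :: real)"
    using AE_lborel_singleton[of "0::real"] by eventually_elim (auto split: split_indicator)
  have "integrable lborel (\<lambda>a::real. indicator {0<..} a * (1 / (1 + a\<^sup>2)))"
    using integrable_I0i_1_div_plus_square
    unfolding interval_lebesgue_integrable_def set_integrable_def zero_ereal_def by simp
  moreover have "(LBINT a. indicator {0<..} a * (1 / (1 + a\<^sup>2))) = pi / 2"
    using LBINT_I0i_1_div_plus_square
    unfolding interval_lebesgue_integral_0_infty set_lebesgue_integral_def by simp
  ultimately show "integrable lborel (\<lambda>a::real. indicator {0..} a / (1 + a\<^sup>2))"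
    "(LBINT a. indicator {0..} a / (1 + a\<^sup>2)) = pi / 2"
    using ae integrable_cong_AE[OF _ _ ae] integral_cong_AE[OF _ _ ae] by auto
qed

text \<open>In dimension three a power of \<open>jbr\<close> is integrable when its exponent lies
  below -3. For -4 the radial density \<open>4 \<pi> a^2\<close> leaves a multiple of
  \<open>1 / (1 + a^2)\<close> as a bound.\<close>

lemma integrable_jbr4: "integrable lborel (\<lambda>x. 1 / jbr x ^ 4)"
proof -
  have "integrable lborel (\<lambda>a::real. (indicator {0..} a * (4 * pi * a\<^sup>2)) *\<^sub>R (1 / (1 + a\<^sup>2)\<^sup>2))"
  proof (rule Bochner_Integration.integrable_bound[OF integrable_mult_right[OF integrable_inverse_square_plus1, of "4 * pi"]], goal_cases)
    case 2
    have "4 * pi * a\<^sup>2 / (1 + a\<^sup>2)\<^sup>2 \<le> 4 * pi / (1 + a\<^sup>2)" for a :: real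
    proof -
      have "4 * pi * a\<^sup>2 / (1 + a\<^sup>2)\<^sup>2 \<le> 4 * pi * (1 + a\<^sup>2) / (1 + a\<^sup>2)\<^sup>2" by (intro divide_right_mono) auto
      also have "\<dots> = 4 * pi / (1 + a\<^sup>2)" by (simp add: power2_eq_square add_nonneg_eq_0_iff)
      finally show ?thesis .
    qed
    then show ?case by (auto split: split_indicator simp: abs_mult)
  qed auto
  then have "integrable lborel (\<lambda>x::real^3. 1 / (1 + (norm x)\<^sup>2)\<^sup>2)"
    by (subst integrable_radial_iff) auto
  moreover have "jbr x ^ 4 = (1 + (norm x)\<^sup>2)\<^sup>2" for x
    using jbr_square[of x] by (metis mult_2 numeral_Bit0 power_add power2_eq_square)
  ultimately show ?thesis by simp
qed

lemma integrable_jbr_bound: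
  fixes f :: "real^3 \<Rightarrow> 'b::{banach, second_countable_topology}"
  assumes "f \<in> borel_measurable borel" "\<And>x. jbr x ^ 4 * norm (f x) \<le> B"
  shows "integrable lborel f"
proof (rule Bochner_Integration.integrable_bound[OF integrable_mult_right[OF integrable_jbr4, of B]])
  show "f \<in> borel_measurable lborel" using assms by simp
  have B: "B \<ge> 0" using assms(2)[of 0] by (meson jbr_ge0 mult_nonneg_nonneg norm_ge_zero order_trans zero_le_power)
  show "AE x in lborel. norm (f x) \<le> norm (B * (1 / jbr x ^ 4))"
    using assms(2) B by (auto simp: field_simps)
qed

lemma decaying_integrable: "decaying f \<Longrightarrow> f \<in> borel_measurable borel \<Longrightarrow> integrable lborel f"
  using integrable_jbr_bound unfolding decaying_def by metis

lemma schwartz_integrable: "f \<in> schwartz \<Longrightarrow> integrable lborel f"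
  by (simp add: decaying_integrable schwartz_decaying schwartz_measurable)

lemma schwartz_bounded: "f \<in> schwartz \<Longrightarrow> \<exists>B\<ge>0. \<forall>x. norm (f x) \<le> B"
  using decayingD[OF schwartz_decaying, of f 0] by auto

subsection \<open>Affine substitutions and Fubini\<close>

lemma
  fixes f :: "'a::euclidean_space \<Rightarrow> 'b::{banach, second_countable_topology}"
  assumes c: "c \<noteq> 0"
  shows lborel_integral_affine: "f \<in> borel_measurable borel \<Longrightarrow>
      (LBINT x. f x) = (\<bar>c\<bar> ^ DIM('a)) *\<^sub>R (LBINT x. f (t + c *\<^sub>R x))"
    and lborel_integrable_affine: "integrable lborel f \<Longrightarrow> integrable lborel (\<lambda>x. f (t + c *\<^sub>R x))"
proof -
  have eq: "(lborel :: 'a measure) = density (distr lborel borel (\<lambda>x::'a. t + c *\<^sub>R x)) (\<lambda>_. ennreal (\<bar>c\<bar> ^ DIM('a)))"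
    using lborel_affine[OF c, of t] by (simp add: ennreal_power)
  show "(LBINT x. f x) = (\<bar>c\<bar> ^ DIM('a)) *\<^sub>R (LBINT x. f (t + c *\<^sub>R x))" if [measurable]: "f \<in> borel_measurable borel"
    by (subst eq, subst integral_density) (auto simp: integral_distr)
  assume f: "integrable lborel f"
  then have [measurable]: "f \<in> borel_measurable borel" by simp
  from f have "integrable (distr lborel borel (\<lambda>x::'a. t + c *\<^sub>R x)) (\<lambda>x. (\<bar>c\<bar> ^ DIM('a)) *\<^sub>R f x)"
    by (subst (asm) eq, subst (asm) integrable_density) auto
  then have "integrable (distr lborel borel (\<lambda>x::'a. t + c *\<^sub>R x)) f"
    using c integrable_scaleR_right[of "1 / \<bar>c\<bar> ^ DIM('a)" "distr lborel borel (\<lambda>x::'a. t + c *\<^sub>R x)" "\<lambda>x. (\<bar>c\<bar> ^ DIM('a)) *\<^sub>R f x"]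
    by simp
  then show "integrable lborel (\<lambda>x. f (t + c *\<^sub>R x))"
    by (subst (asm) integrable_distr_eq) auto
qed

lemma
  fixes f :: "'a::euclidean_space \<Rightarrow> 'b::{banach, second_countable_topology}"
  assumes f: "integrable lborel f"
  shows integrable_translate: "integrable lborel (\<lambda>x. f (x + t))"
    and integrable_translate_diff: "integrable lborel (\<lambda>x. f (x - t))"
    and integrable_reflect: "integrable lborel (\<lambda>x. f (- x))"
    and integrable_translate_reflect: "integrable lborel (\<lambda>x. f (t - x))"
  using lborel_integrable_affine[of 1 f t] lborel_integrable_affine[of 1 f "-t"]
    lborel_integrable_affine[of "-1" f 0] lborel_integrable_affine[of "-1" f t] f
  by (auto simp: add.commute)

lemma
  fixes f :: "'a::euclidean_space \<Rightarrow> 'b::{banach, second_countable_topology}"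
  assumes f: "f \<in> borel_measurable borel"
  shows integral_translate: "(LBINT x. f (x + t)) = integral\<^sup>L lborel f"
    and integral_translate_diff: "(LBINT x. f (x - t)) = integral\<^sup>L lborel f"
    and integral_reflect: "(LBINT x. f (- x)) = integral\<^sup>L lborel f"
    and integral_translate_reflect: "(LBINT x. f (t - x)) = integral\<^sup>L lborel f"
  using lborel_integral_affine[of 1 f t] lborel_integral_affine[of 1 f "-t"]
    lborel_integral_affine[of "-1" f 0] lborel_integral_affine[of "-1" f t] f
  by (auto simp: add.commute)

lemma integrable_product:
  fixes f :: "'a::euclidean_space \<Rightarrow> complex" and g :: "'b::euclidean_space \<Rightarrow> complex"
  assumes f: "integrable lborel f" and g: "integrable lborel g"
  shows "integrable (lborel \<Otimes>\<^sub>M lborel) (\<lambda>(x, y). f x * g y)"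
proof -
  have [measurable]: "f \<in> borel_measurable borel" "g \<in> borel_measurable borel" using f g by auto
  show ?thesis
  proof (rule lborel_pair.Fubini_integrable)
    show "integrable lborel (\<lambda>x. LBINT y. norm (case (x, y) of (x, y) \<Rightarrow> f x * g y))"
      using f by (simp add: norm_mult)
    show "AE x in lborel. integrable lborel (\<lambda>y. case (x, y) of (x, y) \<Rightarrow> f x * g y)"
      using g by simp
  qed measurable
qed

lemma integrable_product_bound:
  fixes h :: "'a::euclidean_space \<times> 'b::euclidean_space \<Rightarrow> complex" and f :: "'a \<Rightarrow> complex" and g :: "'b \<Rightarrow> complex"
  assumes f: "integrable lborel f" and g: "integrable lborel g"
    and [measurable]: "h \<in> borel_measurable (lborel \<Otimes>\<^sub>M lborel)"
    and h: "\<And>x y. norm (h (x, y)) \<le> norm (f x) * norm (g y)"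
  shows "integrable (lborel \<Otimes>\<^sub>M lborel) h"
  by (rule Bochner_Integration.integrable_bound[OF integrable_product[OF f g]])
    (use h in \<open>auto simp: norm_mult split: prod.split\<close>)

text \<open>The inner integral runs over the variable that occurs in \<open>G\<close> alone, where
  translation invariance gives the constant norm of \<open>G\<close>. The second claim is therefore
  proved with the two factors of the product space exchanged.\<close>

lemma integrable_convolution:
  fixes G :: "'a::euclidean_space \<Rightarrow> complex"
  assumes G: "integrable lborel G" and f: "integrable lborel f"
  shows "integrable (lborel \<Otimes>\<^sub>M lborel) (\<lambda>(x, y). G (x - y) * f x)"
    "integrable (lborel \<Otimes>\<^sub>M lborel) (\<lambda>(x, y). G (x - y) * f y)"
proof -
  have [measurable]: "f \<in> borel_measurable borel" "G \<in> borel_measurable borel" using f G by auto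
  show 1: "integrable (lborel \<Otimes>\<^sub>M lborel) (\<lambda>(x, y). G (x - y) * f x)"
  proof (rule lborel_pair.Fubini_integrable)
    show "integrable lborel (\<lambda>x. LBINT y. norm (case (x, y) of (x, y) \<Rightarrow> G (x - y) * f x))"
      using f by (simp add: norm_mult integral_translate_reflect[of "\<lambda>x. norm (G x)"])
    show "AE x in lborel. integrable lborel (\<lambda>y. case (x, y) of (x, y) \<Rightarrow> G (x - y) * f x)"
      using integrable_translate_reflect[OF G] by (intro AE_I2) simp
  qed measurable
  have "integrable (lborel \<Otimes>\<^sub>M lborel) (\<lambda>(y, x). G (x - y) * f y)"
  proof (rule lborel_pair.Fubini_integrable)
    show "integrable lborel (\<lambda>y. LBINT x. norm (case (y, x) of (y, x) \<Rightarrow> G (x - y) * f y))"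
      using f by (simp add: norm_mult integral_translate_diff[of "\<lambda>x. norm (G x)"])
    show "AE y in lborel. integrable lborel (\<lambda>x. case (y, x) of (y, x) \<Rightarrow> G (x - y) * f y)"
      using integrable_translate_diff[OF G] by (intro AE_I2) simp
  qed measurable
  from lborel_pair.integrable_product_swap[OF this]
  show "integrable (lborel \<Otimes>\<^sub>M lborel) (\<lambda>(x, y). G (x - y) * f y)" by simp
qed

subsection \<open>Gaussian integrals\<close>

text \<open>A rescaling of the characteristic function of the normal distribution: \<open>k\<close>
  is chosen with \<open>k^2 = 2 c\<close>, so that \<open>c x^2 = (k x)^2 / 2\<close>.\<close>

lemma gaussian_fourier_1d:
  fixes c t :: real assumes c: "c > 0"
  shows "integrable lborel (\<lambda>x. iexp (t * x) * of_real (exp (- (c * x\<^sup>2))))"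
    and "(LBINT x. iexp (t * x) * of_real (exp (- (c * x\<^sup>2)))) = of_real (sqrt (pi / c) * exp (- (t\<^sup>2 / (4 * c))))"
proof -
  define k where "k = sqrt (2 * c)"
  have k: "k > 0" "k\<^sup>2 = 2 * c" unfolding k_def using c by auto
  define F where "F = (\<lambda>x. iexp (t / k * x) * of_real (exp (- x\<^sup>2 / 2)))"
  have [measurable]: "F \<in> borel_measurable borel" unfolding F_def by measurable
  have Fk: "F (k * x) = iexp (t * x) * of_real (exp (- (c * x\<^sup>2)))" for x
    unfolding F_def using k by (simp add: power_mult_distrib)
  have n: "F x = of_real (sqrt (2 * pi)) * (std_normal_density x *\<^sub>R iexp (t / k * x))" for x
    unfolding F_def std_normal_density_def by (simp add: scaleR_conv_of_real)
  have i1: "integrable lborel (\<lambda>x. std_normal_density x *\<^sub>R iexp (t / k * x))"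
    by (rule Bochner_Integration.integrable_bound[OF integrable_std_normal_moment[of 0]]) auto
  have "(LBINT x. std_normal_density x *\<^sub>R iexp (t / k * x)) = char std_normal_distribution (t / k)"
    unfolding char_def by (subst integral_density) (auto simp: mult.commute)
  also have "\<dots> = of_real (exp (- ((t / k)\<^sup>2) / 2))" unfolding char_std_normal_distribution by simp
  finally have i2: "(LBINT x. F x) = of_real (sqrt (2 * pi)) * of_real (exp (- ((t / k)\<^sup>2) / 2))"
    unfolding n integral_mult_right_zero by simp
  have iF: "integrable lborel F" unfolding n using i1 by (intro integrable_mult_right)
  from lborel_integrable_affine[OF _ iF, of k 0] k
  show "integrable lborel (\<lambda>x. iexp (t * x) * of_real (exp (- (c * x\<^sup>2))))" by (simp add: Fk)
  have "k *\<^sub>R (LBINT x. iexp (t * x) * of_real (exp (- (c * x\<^sup>2)))) = (LBINT x. F x)"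
    using lborel_integral_affine[of k F 0] k by (simp add: Fk)
  also have "\<dots> = of_real (sqrt (2 * pi)) * of_real (exp (- (t\<^sup>2 / (4 * c))))"
    unfolding i2 using k by (simp add: power_divide)
  finally have "(LBINT x. iexp (t * x) * of_real (exp (- (c * x\<^sup>2)))) = of_real (sqrt (2 * pi) / k) * of_real (exp (- (t\<^sup>2 / (4 * c))))"
    using k by (simp add: scaleR_conv_of_real field_simps)
  also have "sqrt (2 * pi) / k = sqrt (pi / c)" unfolding k_def by (simp add: real_sqrt_divide[symmetric])
  finally show "(LBINT x. iexp (t * x) * of_real (exp (- (c * x\<^sup>2)))) = of_real (sqrt (pi / c) * exp (- (t\<^sup>2 / (4 * c))))"
    by simp
qed

text \<open>Lebesgue measure is a product over the basis, and both the character and the Gaussian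
  factor over the coordinates.\<close>

lemma gaussian_fourier:
  fixes \<xi> :: "real^3" assumes c: "c > 0"
  shows "integrable lborel (\<lambda>x. iexp (x \<bullet> \<xi>) * of_real (exp (- (c * (norm x)\<^sup>2))))"
    and "(LBINT x. iexp (x \<bullet> \<xi>) * of_real (exp (- (c * (norm x)\<^sup>2))))
      = of_real (sqrt (pi / c) ^ 3 * exp (- ((norm \<xi>)\<^sup>2 / (4 * c))))"
proof -
  interpret product_sigma_finite "\<lambda>_::real^3. lborel :: real measure" ..
  define T where "T f = (\<Sum>b\<in>Basis. f b *\<^sub>R b)" for f :: "real^3 \<Rightarrow> real"
  have [measurable]: "T \<in> Pi\<^sub>M Basis (\<lambda>_. lborel) \<rightarrow>\<^sub>M borel" unfolding T_def by measurable
  have lb: "lborel = distr (Pi\<^sub>M Basis (\<lambda>_::real^3. lborel)) borel T"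
    unfolding T_def by (rule lborel_eq)
  let ?g = "\<lambda>x. iexp (x \<bullet> \<xi>) * of_real (exp (- (c * (norm x)\<^sup>2)))"
  let ?h = "\<lambda>(b::real^3) x. iexp ((\<xi> \<bullet> b) * x) * of_real (exp (- (c * x\<^sup>2)))"
  have n: "(norm v)\<^sup>2 = (\<Sum>b\<in>Basis. (v \<bullet> b)\<^sup>2)" for v :: "real^3"
    by (subst power2_norm_eq_inner, subst euclidean_inner) (simp add: power2_eq_square)
  have g: "?g (T f) = (\<Prod>b\<in>Basis. ?h b (f b))" for f
  proof -
    have Tb: "T f \<bullet> b = f b" if "b \<in> Basis" for b unfolding T_def using that by simp
    have "T f \<bullet> \<xi> = (\<Sum>b\<in>Basis. (\<xi> \<bullet> b) * f b)"
      by (subst euclidean_inner) (simp add: Tb mult.commute)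
    moreover have "(norm (T f))\<^sup>2 = (\<Sum>b\<in>Basis. (f b)\<^sup>2)" unfolding n by (simp add: Tb)
    ultimately have "?g (T f) = iexp (\<Sum>b\<in>Basis. (\<xi> \<bullet> b) * f b) * of_real (exp (\<Sum>b\<in>Basis. - (c * (f b)\<^sup>2)))"
      by (simp add: sum_distrib_left sum_negf)
    also have "\<dots> = (\<Prod>b\<in>Basis. ?h b (f b))"
      by (simp add: prod.distrib exp_sum sum_distrib_left del: exp_of_real)
    finally show ?thesis .
  qed
  have [measurable]: "?g \<in> borel_measurable borel" by measurable
  show "integrable lborel ?g"
    apply (subst lb, subst integrable_distr_eq)
      apply measurable
    unfolding g
    apply (rule product_integrable_prod)
     apply simp
    apply (rule gaussian_fourier_1d(1)[OF c])
    done
  have "(LBINT x. ?g x) = (LINT f|Pi\<^sub>M Basis (\<lambda>_. lborel). (\<Prod>b\<in>Basis. ?h b (f b)))"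
    by (subst lb, subst integral_distr) (measurable, simp only: g)
  also have "\<dots> = (\<Prod>b\<in>Basis. LBINT x. ?h b x)"
    by (rule product_integral_prod) (simp, rule gaussian_fourier_1d(1)[OF c])
  also have "\<dots> = (\<Prod>b\<in>(Basis::(real^3) set). of_real (sqrt (pi / c) * exp (- ((\<xi> \<bullet> b)\<^sup>2 / (4 * c)))))"
    by (intro prod.cong refl gaussian_fourier_1d(2)[OF c])
  also have "\<dots> = of_real (\<Prod>b\<in>(Basis::(real^3) set). sqrt (pi / c) * exp (- ((\<xi> \<bullet> b)\<^sup>2 / (4 * c))))"
    by simp
  also have "(\<Prod>b\<in>(Basis::(real^3) set). sqrt (pi / c) * exp (- ((\<xi> \<bullet> b)\<^sup>2 / (4 * c))))
    = sqrt (pi / c) ^ 3 * exp (- ((norm \<xi>)\<^sup>2 / (4 * c)))"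
    unfolding n prod.distrib by (simp add: exp_sum[symmetric] sum_negf sum_divide_distrib)
  finally show "(LBINT x. ?g x) = of_real (sqrt (pi / c) ^ 3 * exp (- ((norm \<xi>)\<^sup>2 / (4 * c))))" .
qed

section \<open>The Fourier transform of Schwartz functions\<close>

definition fconst :: real where "fconst = (2 * pi) powr (- 3 / 2)"

lemma fconst_pos: "fconst > 0" unfolding fconst_def by simp

lemma fconst_square: "fconst * fconst = 1 / (2 * pi) ^ 3"
proof -
  have "fconst * fconst = (2 * pi) powr (- real 3)" unfolding fconst_def by (simp add: powr_add[symmetric])
  also have "\<dots> = 1 / (2 * pi) ^ 3" by (subst powr_minus_divide, subst powr_realpow) auto
  finally show ?thesis .
qed

lemma fourier_alt: "fourier f \<xi> = of_real fconst * (LBINT x. iexp (- (x \<bullet> \<xi>)) * f x)"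
  unfolding fourier_def fconst_def by simp

lemma fourier_inv_alt: "fourier_inv f x = of_real fconst * (LBINT \<xi>. iexp (x \<bullet> \<xi>) * f \<xi>)"
  unfolding fourier_inv_def fconst_def by simp

lemma fourier_inv_eq: "fourier_inv f x = fourier f (- x)"
  unfolding fourier_alt fourier_inv_alt by (simp add: inner_commute)

lemma fourier_reflect: "f \<in> borel_measurable borel \<Longrightarrow> fourier (\<lambda>x. f (- x)) \<xi> = fourier f (- \<xi>)"
  unfolding fourier_alt
  by (subst integral_reflect[symmetric, of "\<lambda>x. iexp (- (x \<bullet> \<xi>)) * f (- x)"]) simp_all

lemma integrable_iexp_mult:
  "integrable M f \<Longrightarrow> g \<in> borel_measurable M \<Longrightarrow> integrable M (\<lambda>x. iexp (g x) * f x)"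
  by (rule Bochner_Integration.integrable_bound[of M f]) (auto simp: norm_mult)

lemma fourier_bound:
  assumes "integrable lborel f"
  shows "norm (fourier f \<xi>) \<le> fconst * (LBINT x. norm (f x))"
proof -
  have "norm (LBINT x. iexp (- (x \<bullet> \<xi>)) * f x) \<le> (LBINT x. norm (iexp (- (x \<bullet> \<xi>)) * f x))"
    by (rule integral_norm_bound)
  then show ?thesis unfolding fourier_alt using fconst_pos by (simp add: norm_mult mult_left_mono)
qed

lemma borel_measurable_fourier [measurable]:
  assumes [measurable]: "f \<in> borel_measurable borel" shows "fourier f \<in> borel_measurable borel"
  unfolding fourier_alt[abs_def] by measurable

lemma fourier_add:
  assumes "integrable lborel f" "integrable lborel g"
  shows "fourier (\<lambda>x. f x + g x) \<xi> = fourier f \<xi> + fourier g \<xi>"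
proof -
  have "(LBINT x. iexp (- (x \<bullet> \<xi>)) * (f x + g x)) =
      (LBINT x. iexp (- (x \<bullet> \<xi>)) * f x) + (LBINT x. iexp (- (x \<bullet> \<xi>)) * g x)"
    using assms unfolding distrib_left by (intro Bochner_Integration.integral_add integrable_iexp_mult) auto
  then show ?thesis unfolding fourier_alt by (simp add: distrib_left)
qed

lemma fourier_cmult: "fourier (\<lambda>x. c * f x) \<xi> = c * fourier f \<xi>"
  unfolding fourier_alt mult.left_commute[of _ c] integral_mult_right_zero by simp

lemma fourier_sum:
  assumes "finite I" "\<And>i. i \<in> I \<Longrightarrow> integrable lborel (f i)"
  shows "fourier (\<lambda>x. \<Sum>i\<in>I. f i x) \<xi> = (\<Sum>i\<in>I. fourier (f i) \<xi>)"
  using assms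
proof (induction I rule: finite_induct)
  case empty show ?case by (simp add: fourier_alt)
next
  case (insert a I) then show ?case by (simp add: fourier_add)
qed

text \<open>Fubini on a symmetric kernel. The same identity, with a Schwartz function as second
  factor, is what \<open>L2_fourier\<close> takes as the definition of the transform on L^2.\<close>

lemma fourier_multiplication:
  assumes f: "integrable lborel f" and g: "integrable lborel g"
  shows "(LBINT x. f x * fourier g x) = (LBINT x. fourier f x * g x)"
proof -
  have [measurable]: "f \<in> borel_measurable borel" "g \<in> borel_measurable borel" using f g by auto
  let ?F = "\<lambda>x y. f x * (iexp (- (y \<bullet> x)) * g y)"
  have i: "integrable (lborel \<Otimes>\<^sub>M lborel) (case_prod ?F)"
    by (rule integrable_product_bound[OF f g]) (auto simp: norm_mult)
  have "(LBINT x. f x * fourier g x) = of_real fconst * (LBINT x. LBINT y. ?F x y)"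
    unfolding fourier_alt integral_mult_right_zero[symmetric] by (simp add: mult_ac)
  also have "(LBINT x. LBINT y. ?F x y) = (LBINT y. LBINT x. ?F x y)"
    using lborel_pair.Fubini_integral[OF i] by simp
  also have "of_real fconst * \<dots> = (LBINT y. fourier f y * g y)"
    unfolding fourier_alt integral_mult_right_zero[symmetric] integral_mult_left_zero[symmetric]
    by (simp add: mult_ac inner_commute)
  finally show ?thesis .
qed

subsection \<open>Differentiation\<close>

text \<open>With a quadratic remainder estimate the Fourier transform can be differentiated by
  bounding one integral, without passing to a limit under the integral sign.\<close>

lemma has_derivative_quadratic:
  fixes f :: "'a::real_normed_vector \<Rightarrow> 'b::real_normed_vector"
  assumes D: "bounded_linear D" and q: "\<And>h. norm (f (x + h) - f x - D h) \<le> M * (norm h)\<^sup>2"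
  shows "(f has_derivative D) (at x)"
proof (unfold has_derivative_at, intro conjI D)
  show "(\<lambda>h. norm (f (x + h) - f x - D h) / norm h) \<midarrow>0\<rightarrow> 0"
  proof (rule tendsto_sandwich[OF _ _ tendsto_const])
    show "\<forall>\<^sub>F h in at 0. 0 \<le> norm (f (x + h) - f x - D h) / norm h" by simp
    show "\<forall>\<^sub>F h in at 0. norm (f (x + h) - f x - D h) / norm h \<le> M * norm h"
      using q by (auto simp: eventually_at_filter divide_le_eq power2_eq_square mult.assoc)
    show "((\<lambda>h. M * norm h) \<longlongrightarrow> 0) (at 0)" by (auto intro!: tendsto_eq_intros)
  qed
qed

lemma iexp_quadratic: "norm (iexp t - 1 - \<i> * of_real t) \<le> t\<^sup>2"
proof -
  have "norm (iexp t - 1 - \<i> * of_real t) \<le> \<bar>t\<bar>\<^sup>2 / 2"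
    using iexp_approx1[of t 1] by (simp add: algebra_simps numeral_2_eq_2)
  also have "\<dots> \<le> t\<^sup>2" by simp
  finally show ?thesis .
qed

text \<open>Powers of the norm are not symbols, the odd ones not being smooth at the origin, so
  decay is all that is claimed.\<close>

lemma decaying_norm_mult:
  assumes "decaying f" shows "decaying (\<lambda>x. of_real (norm x ^ k) * f x)"
  unfolding decaying_def
proof
  fix N
  obtain B where B: "\<And>x. jbr x ^ (k + N) * norm (f x) \<le> B" using assms unfolding decaying_def by metis
  have "jbr x ^ N * cmod (of_real (norm x ^ k) * f x) \<le> B" for x
  proof -
    have "jbr x ^ N * cmod (of_real (norm x ^ k) * f x) = norm x ^ k * (jbr x ^ N * norm (f x))"
      by (simp add: norm_mult norm_power)
    also have "\<dots> \<le> jbr x ^ k * (jbr x ^ N * norm (f x))"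
      by (intro mult_right_mono power_mono norm_le_jbr) auto
    also have "\<dots> \<le> B" using B[of x] by (simp add: power_add mult.assoc)
    finally show ?thesis .
  qed
  then show "\<exists>B. \<forall>x. jbr x ^ N * cmod (of_real (norm x ^ k) * f x) \<le> B" by blast
qed

lemma schwartz_integrable_norm_mult:
  assumes "f \<in> schwartz" shows "integrable lborel (\<lambda>x. norm x ^ k * norm (f x))"
proof -
  have [measurable]: "f \<in> borel_measurable borel" using assms by measurable
  have "integrable lborel (\<lambda>x. of_real (norm x ^ k) * f x)"
    by (intro decaying_integrable decaying_norm_mult schwartz_decaying assms) measurable
  from integrable_norm[OF this] show ?thesis by (simp add: norm_mult norm_power)
qed

lemma has_derivative_fourier:
  assumes f: "f \<in> schwartz"
  shows "(fourier f has_derivative (\<lambda>h. fourier (\<lambda>x. - \<i> * of_real (x \<bullet> h) * f x) \<xi>)) (at \<xi>)"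
proof -
  have [measurable]: "f \<in> borel_measurable borel" using f by measurable
  have i0: "integrable lborel f" using f by (rule schwartz_integrable)
  have i1: "integrable lborel (\<lambda>x. - \<i> * of_real (x \<bullet> h) * f x)" for h
  proof (rule Bochner_Integration.integrable_bound[OF integrable_mult_right[OF schwartz_integrable_norm_mult[OF f, of 1], of "norm h"]])
    have "norm (- \<i> * of_real (x \<bullet> h) * f x) \<le> norm (norm h * (norm x ^ 1 * norm (f x)))" for x
      using mult_right_mono[OF Cauchy_Schwarz_ineq2[of x h], of "norm (f x)"] by (simp add: norm_mult abs_mult mult_ac)
    then show "AE x in lborel. norm (- \<i> * of_real (x \<bullet> h) * f x) \<le> norm (norm h * (norm x ^ 1 * norm (f x)))"
      by (intro AE_I2)
  qed measurable
  define M1 where "M1 = fconst * (LBINT x. norm x * norm (f x))"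
  define M2 where "M2 = fconst * (LBINT x. (norm x)\<^sup>2 * norm (f x))"
  show ?thesis
  proof (rule has_derivative_quadratic[where M = M2])
    show "bounded_linear (\<lambda>h. fourier (\<lambda>x. - \<i> * of_real (x \<bullet> h) * f x) \<xi>)"
    proof (rule bounded_linear_intro[where K = M1])
      show "fourier (\<lambda>x. - \<i> * of_real (x \<bullet> (h + k)) * f x) \<xi> =
        fourier (\<lambda>x. - \<i> * of_real (x \<bullet> h) * f x) \<xi> + fourier (\<lambda>x. - \<i> * of_real (x \<bullet> k) * f x) \<xi>" for h k
        using fourier_add[OF i1[of h] i1[of k]] by (simp add: inner_add_right algebra_simps)
      show "fourier (\<lambda>x. - \<i> * of_real (x \<bullet> (r *\<^sub>R h)) * f x) \<xi> =
        r *\<^sub>R fourier (\<lambda>x. - \<i> * of_real (x \<bullet> h) * f x) \<xi>" for h r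
        using fourier_cmult[of "of_real r" "\<lambda>x. - \<i> * of_real (x \<bullet> h) * f x"]
        unfolding inner_scaleR_right by (simp add: scaleR_conv_of_real mult_ac)
      show "norm (fourier (\<lambda>x. - \<i> * of_real (x \<bullet> h) * f x) \<xi>) \<le> norm h * M1" for h
      proof -
        have "norm (fourier (\<lambda>x. - \<i> * of_real (x \<bullet> h) * f x) \<xi>)
          \<le> fconst * (LBINT x. norm (- \<i> * of_real (x \<bullet> h) * f x))" by (rule fourier_bound[OF i1])
        also have "(LBINT x. norm (- \<i> * of_real (x \<bullet> h) * f x)) \<le> (LBINT x. norm h * (norm x * norm (f x)))"
        proof (intro integral_mono integrable_norm i1 integrable_mult_right)
          show "integrable lborel (\<lambda>x. norm x * norm (f x))" using schwartz_integrable_norm_mult[OF f, of 1] by simp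
          show "norm (- \<i> * of_real (x \<bullet> h) * f x) \<le> norm h * (norm x * norm (f x))" for x
            using mult_right_mono[OF Cauchy_Schwarz_ineq2[of x h], of "norm (f x)"] by (simp add: norm_mult mult_ac)
        qed
        finally show ?thesis unfolding M1_def integral_mult_right_zero using fconst_pos by (simp add: mult_ac)
      qed
    qed
    fix h
    \<comment> \<open>The Taylor remainder of the character beyond its linear term, times
      \<open>f\<close>. It is at most \<open>|h|^2 |x|^2 |f x|\<close>, which explains the second
      moment in \<open>M2\<close>; the first moment in \<open>M1\<close> bounds the
      derivative.\<close>
    let ?R = "\<lambda>x. (iexp (- (x \<bullet> h)) - 1 - \<i> * of_real (- (x \<bullet> h))) * f x"
    have bR: "norm (?R x) \<le> (norm h)\<^sup>2 * ((norm x)\<^sup>2 * norm (f x))" for x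
    proof -
      have "norm (?R x) \<le> (x \<bullet> h)\<^sup>2 * norm (f x)"
        unfolding norm_mult using iexp_quadratic[of "- (x \<bullet> h)"] by (intro mult_right_mono) (simp_all only: power2_minus norm_ge_zero)
      also have "(x \<bullet> h)\<^sup>2 \<le> (norm x * norm h)\<^sup>2"
        using Cauchy_Schwarz_ineq2[of x h] by (metis abs_ge_zero power2_abs power_mono)
      finally show ?thesis by (simp add: power_mult_distrib mult_ac mult_right_mono)
    qed
    have iR: "integrable lborel ?R"
      by (rule Bochner_Integration.integrable_bound[OF integrable_mult_right[OF schwartz_integrable_norm_mult[OF f, of 2], of "(norm h)\<^sup>2"]])
        (use bR in \<open>auto simp: abs_mult\<close>)
    have e: "iexp (- (x \<bullet> (\<xi> + h))) = iexp (- (x \<bullet> \<xi>)) * iexp (- (x \<bullet> h))" for x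
      by (simp add: inner_add_right exp_add[symmetric] algebra_simps)
    have "fourier f (\<xi> + h) = fourier (\<lambda>x. iexp (- (x \<bullet> h)) * f x) \<xi>"
      unfolding fourier_alt e by (simp add: mult.assoc)
    also have "(\<lambda>x. iexp (- (x \<bullet> h)) * f x) = (\<lambda>x. ?R x + (f x + (- \<i> * of_real (x \<bullet> h) * f x)))"
      by (simp add: fun_eq_iff algebra_simps)
    also have "fourier \<dots> \<xi> = fourier ?R \<xi> + (fourier f \<xi> + fourier (\<lambda>x. - \<i> * of_real (x \<bullet> h) * f x) \<xi>)"
      by (subst fourier_add[OF iR], intro Bochner_Integration.integrable_add i0 i1, subst fourier_add[OF i0 i1]) rule
    finally have "fourier f (\<xi> + h) - fourier f \<xi> - fourier (\<lambda>x. - \<i> * of_real (x \<bullet> h) * f x) \<xi> = fourier ?R \<xi>"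
      by simp
    then have "norm (fourier f (\<xi> + h) - fourier f \<xi> - fourier (\<lambda>x. - \<i> * of_real (x \<bullet> h) * f x) \<xi>)
       \<le> fconst * (LBINT x. norm (?R x))" using fourier_bound[OF iR] by simp
    also have "(LBINT x. norm (?R x)) \<le> (LBINT x. (norm h)\<^sup>2 * ((norm x)\<^sup>2 * norm (f x)))"
      by (intro integral_mono integrable_norm iR integrable_mult_right schwartz_integrable_norm_mult[OF f] bR)
    finally show "norm (fourier f (\<xi> + h) - fourier f \<xi> - fourier (\<lambda>x. - \<i> * of_real (x \<bullet> h) * f x) \<xi>)
      \<le> M2 * (norm h)\<^sup>2" unfolding M2_def integral_mult_right_zero using fconst_pos by (simp add: mult_ac)
  qed
qed

lemma partial_fourier:
  assumes "f \<in> schwartz"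
  shows "partial i (fourier f) = fourier (\<lambda>x. - \<i> * (of_real (x $ i) * f x))"
proof
  fix \<xi>
  show "partial i (fourier f) \<xi> = fourier (\<lambda>x. - \<i> * (of_real (x $ i) * f x)) \<xi>"
    unfolding partialI[OF has_derivative_fourier[OF assms]] by (simp add: inner_axis mult.assoc)
qed

subsection \<open>Integration by parts\<close>

text \<open>The weight varies by a bounded factor over distance one, which lets difference quotients
  with steps at most 1 share one integrable bound. The factor 9 is the square of the 3 in
  \<open>(jbr x)^2 \<le> 3 (jbr y)^2\<close>.\<close>

lemma jbr_near:
  assumes "norm (y - x) \<le> 1" shows "jbr x ^ 4 \<le> 9 * jbr y ^ 4"
proof -
  have "norm x \<le> norm y + 1" using assms by norm
  then have "(norm x)\<^sup>2 \<le> (norm y + 1)\<^sup>2" by (intro power_mono) auto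
  also have "\<dots> \<le> 2 * (norm y)\<^sup>2 + 2" using sum_squares_bound[of "norm y" 1] by (simp add: power2_eq_square algebra_simps)
  finally have "(jbr x)\<^sup>2 \<le> 3 * (jbr y)\<^sup>2" unfolding jbr_square by (smt (verit) zero_le_power2)
  then have "((jbr x)\<^sup>2)\<^sup>2 \<le> (3 * (jbr y)\<^sup>2)\<^sup>2" by (intro power_mono) auto
  then show ?thesis by (simp add: power_mult_distrib flip: power_mult)
qed

text \<open>A difference quotient integrates to zero by translation invariance, and the quotients
  converge to the derivative. The decay of \<open>partial i \<psi>\<close> and the mean value
  inequality dominate them by a multiple of \<open>1 / jbr x ^ 4\<close>.\<close>

lemma integral_partial_zero:
  assumes diff: "\<And>x. \<psi> differentiable (at x)" and \<psi>: "integrable lborel \<psi>"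
    and B: "\<And>x. jbr x ^ 4 * norm (partial i \<psi> x) \<le> B"
  shows "(LBINT x. partial i \<psi> x) = 0"
proof -
  have [measurable]: "\<psi> \<in> borel_measurable borel" using \<psi> by simp
  define e :: "real^3" where "e = axis i 1"
  have e: "norm e = 1" unfolding e_def by simp
  define h where "h n = 1 / real (Suc n)" for n
  have h: "h n > 0" "h n \<le> 1" for n unfolding h_def by auto
  define q where "q n x = (\<psi> (x + h n *\<^sub>R e) - \<psi> x) /\<^sub>R h n" for n x
  have B0: "B \<ge> 0" using B[of 0] by (meson jbr_ge0 mult_nonneg_nonneg norm_ge_zero order_trans zero_le_power)
  have vd: "((\<lambda>s. \<psi> (x + s *\<^sub>R e)) has_derivative (\<lambda>t. t *\<^sub>R partial i \<psi> (x + s *\<^sub>R e))) (at s within S)" for x s S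
  proof -
    have "(\<psi> has_derivative frechet_derivative \<psi> (at (x + s *\<^sub>R e))) (at (x + s *\<^sub>R e))"
      using diff frechet_derivative_works by blast
    moreover have "((\<lambda>s. x + s *\<^sub>R e) has_derivative (\<lambda>t. t *\<^sub>R e)) (at s within S)"
      by (auto intro!: derivative_eq_intros)
    ultimately have "((\<lambda>s. \<psi> (x + s *\<^sub>R e)) has_derivative (\<lambda>t. frechet_derivative \<psi> (at (x + s *\<^sub>R e)) (t *\<^sub>R e))) (at s within S)"
      using has_derivative_compose by blast
    moreover have "linear (frechet_derivative \<psi> (at (x + s *\<^sub>R e)))"
      by (rule linear_frechet_derivative[OF diff])
    ultimately show ?thesis by (simp add: partial_def e_def linear_scale)
  qed
  have lim: "(\<lambda>n. q n x) \<longlonglongrightarrow> partial i \<psi> x" for x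
  proof -
    have "((\<lambda>s. (\<psi> (x + s *\<^sub>R e) - \<psi> x) /\<^sub>R s - partial i \<psi> x) \<longlongrightarrow> 0) (at 0)"
    proof (rule tendsto_norm_zero_cancel, rule Lim_transform_eventually)
      show "((\<lambda>s. norm (\<psi> (x + (0 + s) *\<^sub>R e) - \<psi> (x + 0 *\<^sub>R e) - s *\<^sub>R partial i \<psi> (x + 0 *\<^sub>R e)) / norm s) \<longlongrightarrow> 0) (at 0)"
        using vd[of x 0 UNIV] unfolding has_derivative_at by blast
      have "norm (a - s *\<^sub>R v) / norm s = norm (a /\<^sub>R s - v)" if "s \<noteq> 0" for a v :: complex and s :: real
      proof -
        have "a /\<^sub>R s - v = (a - s *\<^sub>R v) /\<^sub>R s" using that by (simp add: scaleR_diff_right)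
        then show ?thesis by (simp add: divide_inverse mult.commute)
      qed
      then show "\<forall>\<^sub>F s in at 0. norm (\<psi> (x + (0 + s) *\<^sub>R e) - \<psi> (x + 0 *\<^sub>R e) - s *\<^sub>R partial i \<psi> (x + 0 *\<^sub>R e)) / norm s
        = norm ((\<psi> (x + s *\<^sub>R e) - \<psi> x) /\<^sub>R s - partial i \<psi> x)"
        by (auto simp: eventually_at_filter)
    qed
    then have "((\<lambda>s. (\<psi> (x + s *\<^sub>R e) - \<psi> x) /\<^sub>R s) \<longlongrightarrow> partial i \<psi> x) (at 0)"
      by (rule LIM_zero_cancel)
    moreover have "filterlim h (at 0) sequentially"
      unfolding filterlim_at h_def using LIMSEQ_Suc[OF lim_1_over_n[where 'a = real]] by simp
    ultimately show ?thesis unfolding q_def by (rule filterlim_compose)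
  qed
  have bound: "norm (q n x) \<le> 9 * B * (1 / jbr x ^ 4)" for n x
  proof -
    have "norm (\<psi> (x + h n *\<^sub>R e) - \<psi> (x + 0 *\<^sub>R e)) \<le> (9 * B * (1 / jbr x ^ 4)) * norm (h n - 0)"
    proof (rule differentiable_bound[where S = "{0..h n}", OF convex_real_interval(5) vd])
      fix s assume s: "s \<in> {0..h n}"
      have "norm (x + s *\<^sub>R e - x) \<le> 1" using s h(2)[of n] e by simp
      then have *: "jbr x ^ 4 \<le> 9 * jbr (x + s *\<^sub>R e) ^ 4" by (rule jbr_near)
      have "jbr x ^ 4 * norm (partial i \<psi> (x + s *\<^sub>R e)) \<le> 9 * (jbr (x + s *\<^sub>R e) ^ 4 * norm (partial i \<psi> (x + s *\<^sub>R e)))"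
        using mult_right_mono[OF *] by (simp add: mult.assoc)
      also have "\<dots> \<le> 9 * B" using B[of "x + s *\<^sub>R e"] by linarith
      finally have "norm (partial i \<psi> (x + s *\<^sub>R e)) \<le> 9 * B * (1 / jbr x ^ 4)"
        by (simp add: pos_le_divide_eq mult.commute)
      from mult_right_mono[OF this abs_ge_zero]
      show "onorm (\<lambda>t. t *\<^sub>R partial i \<psi> (x + s *\<^sub>R e)) \<le> 9 * B * (1 / jbr x ^ 4)"
        by (intro onorm_le) (simp only: norm_scaleR real_norm_def mult.commute)
    qed (use h in \<open>auto simp: less_imp_le\<close>)
    then show ?thesis unfolding q_def using h(1)[of n] by (simp add: divide_simps mult.commute)
  qed
  have "(\<lambda>n. LBINT x. q n x) \<longlonglongrightarrow> (LBINT x. partial i \<psi> x)"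
  proof (rule integral_dominated_convergence[where w = "\<lambda>x. 9 * B * (1 / jbr x ^ 4)"])
    show q: "q n \<in> borel_measurable lborel" for n unfolding q_def by measurable
    show "partial i \<psi> \<in> borel_measurable lborel" by (rule borel_measurable_LIMSEQ_metric[of q]) (use q lim in auto)
    show "integrable lborel (\<lambda>x. 9 * B * (1 / jbr x ^ 4))" by (intro integrable_mult_right integrable_jbr4)
  qed (use lim bound in auto)
  moreover have "(LBINT x. q n x) = 0" for n
  proof -
    have "(LBINT x. q n x) = (1 / h n) *\<^sub>R ((LBINT x. \<psi> (x + h n *\<^sub>R e)) - (LBINT x. \<psi> x))"
      unfolding q_def
      by (subst Bochner_Integration.integral_diff[symmetric]) (use \<psi> integrable_translate[OF \<psi>] in \<open>auto simp: inverse_eq_divide\<close>)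
    then show ?thesis by (simp add: integral_translate)
  qed
  ultimately have "(\<lambda>n::nat. 0) \<longlonglongrightarrow> (LBINT x. partial i \<psi> x)" by simp
  then show ?thesis by (simp add: LIMSEQ_const_iff)
qed

text \<open>Integration by parts, in the form that the derivative of the character times
  \<open>f\<close> has integral zero.\<close>

lemma fourier_partial:
  assumes f: "f \<in> schwartz"
  shows "fourier (partial i f) \<xi> = \<i> * of_real (\<xi> $ i) * fourier f \<xi>"
proof -
  define E where "E x = iexp (- (x \<bullet> \<xi>))" for x
  have E: "(E has_derivative (\<lambda>h. - \<i> * of_real (h \<bullet> \<xi>) * E x)) (at x)" for x
  proof -
    have "((\<lambda>x. \<i> * complex_of_real (- (x \<bullet> \<xi>))) has_derivative (\<lambda>h. \<i> * of_real (- (h \<bullet> \<xi>)))) (at x)"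
      by (intro has_derivative_mult_right has_derivative_cof_real) (auto intro!: derivative_eq_intros)
    from has_derivative_compose[OF this DERIV_exp[unfolded has_field_derivative_def]]
    show ?thesis unfolding E_def by (rule has_derivative_eq_rhs) (simp add: fun_eq_iff)
  qed
  have Ed: "E differentiable (at x)" for x using E differentiableI by blast
  define \<psi> where "\<psi> x = E x * f x" for x
  have p: "partial i \<psi> x = (- \<i> * of_real (\<xi> $ i)) * (E x * f x) + E x * partial i f x" for x
    unfolding \<psi>_def partial_mult[OF Ed schwartz_differentiable[OF f]] partialI[OF E]
    by (simp add: inner_axis' )
  have nE: "norm (E x) = 1" for x unfolding E_def by simp
  have [measurable]: "f \<in> borel_measurable borel" "E \<in> borel_measurable borel" "partial i f \<in> borel_measurable borel"
    using f schwartz_partial[OF f] unfolding E_def by measurable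
  have i: "integrable lborel (\<lambda>x. E x * f x)" "integrable lborel (\<lambda>x. E x * partial i f x)"
    unfolding E_def by (rule integrable_iexp_mult, intro schwartz_integrable schwartz_partial f, measurable)+
  obtain B1 where B1: "\<And>x. jbr x ^ 4 * norm (f x) \<le> B1" using schwartz_decaying[OF f] unfolding decaying_def by metis
  obtain B2 where B2: "\<And>x. jbr x ^ 4 * norm (partial i f x) \<le> B2"
    using schwartz_decaying[OF schwartz_partial[OF f]] unfolding decaying_def by metis
  have "(LBINT x. partial i \<psi> x) = 0"
  proof (rule integral_partial_zero[where B = "\<bar>\<xi> $ i\<bar> * B1 + B2"])
    show "\<psi> differentiable at x" for x unfolding \<psi>_def using Ed schwartz_differentiable[OF f] by (intro differentiable_mult)
    show "integrable lborel \<psi>" unfolding \<psi>_def by (rule i)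
    fix x
    have "norm (partial i \<psi> x) \<le> \<bar>\<xi> $ i\<bar> * norm (f x) + norm (partial i f x)"
      unfolding p by (rule order_trans[OF norm_triangle_ineq]) (simp add: norm_mult nE)
    then have "jbr x ^ 4 * norm (partial i \<psi> x) \<le> jbr x ^ 4 * (\<bar>\<xi> $ i\<bar> * norm (f x) + norm (partial i f x))"
      by (intro mult_left_mono) auto
    also have "\<dots> = \<bar>\<xi> $ i\<bar> * (jbr x ^ 4 * norm (f x)) + jbr x ^ 4 * norm (partial i f x)" by (simp add: algebra_simps)
    also have "\<dots> \<le> \<bar>\<xi> $ i\<bar> * B1 + B2" by (intro add_mono mult_left_mono B1 B2) auto
    finally show "jbr x ^ 4 * norm (partial i \<psi> x) \<le> \<bar>\<xi> $ i\<bar> * B1 + B2" .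
  qed
  also have "(LBINT x. partial i \<psi> x) = (- \<i> * of_real (\<xi> $ i)) * (LBINT x. E x * f x) + (LBINT x. E x * partial i f x)"
    unfolding p using i by (subst Bochner_Integration.integral_add) (auto simp only: integrable_mult_right integral_mult_right_zero)
  finally have "(LBINT x. E x * partial i f x) = \<i> * of_real (\<xi> $ i) * (LBINT x. E x * f x)"
    by simp
  then show ?thesis unfolding fourier_alt E_def by simp
qed

section \<open>Invariance of the Schwartz space under the Fourier transform\<close>

lemma schwartz_sum:
  assumes "finite I" "\<And>i. i \<in> I \<Longrightarrow> f i \<in> schwartz" shows "(\<lambda>x. \<Sum>i\<in>I. f i x) \<in> schwartz"
  using assms
proof (induction I rule: finite_induct)
  case empty
  have "(\<lambda>x. 0 * of_real (gaussian 1 0 x)) \<in> schwartz" by (intro schwartz_const_mult schwartz_gaussian) simp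
  then show ?case by simp
next
  case (insert a I) then show ?case using schwartz_add[of "f a" "\<lambda>x. \<Sum>i\<in>I. f i x"] by simp
qed

lemma norm_square_cart: "(norm (x :: real^3))\<^sup>2 = (\<Sum>i\<in>UNIV. (x $ i)\<^sup>2)"
  unfolding power2_norm_eq_inner inner_vec_def by (simp add: power2_eq_square)

lemma decaying_fourier: assumes "f \<in> schwartz" shows "decaying (fourier f)"
proof -
  \<comment> \<open>\<open>L\<close> is \<open>1 - \<Delta>\<close>, which the transform turns into
    multiplication by \<open>jbr^2\<close>. The crude bound of a transform by the L^1 norm, applied
    to the \<open>N\<close>-th iterate, therefore yields decay of order \<open>2 N\<close>.\<close>
  define L where "L f = (\<lambda>x. f x + (\<Sum>i\<in>UNIV. (-1) * partial i (partial i f) x))" for f :: cfun3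
  have LS: "L f \<in> schwartz" if "f \<in> schwartz" for f
    unfolding L_def by (intro schwartz_add schwartz_sum schwartz_const_mult schwartz_partial that) simp
  have L: "fourier (L f) \<xi> = of_real ((jbr \<xi>)\<^sup>2) * fourier f \<xi>" if f: "f \<in> schwartz" for f \<xi>
  proof -
    have "fourier (L f) \<xi> = fourier f \<xi> + (\<Sum>i\<in>UNIV. (-1) * fourier (partial i (partial i f)) \<xi>)"
      unfolding L_def
      by (subst fourier_add, rule schwartz_integrable[OF f],
          rule schwartz_integrable[OF schwartz_sum], simp,
          intro schwartz_const_mult schwartz_partial f,
          subst fourier_sum, simp, rule schwartz_integrable,
          intro schwartz_const_mult schwartz_partial f, simp only: fourier_cmult)
    also have "\<dots> = fourier f \<xi> + (\<Sum>i\<in>UNIV. of_real ((\<xi> $ i)\<^sup>2) * fourier f \<xi>)"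
      by (simp add: fourier_partial f schwartz_partial power2_eq_square mult_ac complex_i_mult_minus sum_negf)
    also have "\<dots> = of_real ((jbr \<xi>)\<^sup>2) * fourier f \<xi>"
      unfolding jbr_square norm_square_cart by (simp add: sum_distrib_left algebra_simps)
    finally show ?thesis .
  qed
  have *: "(L ^^ N) f \<in> schwartz \<and> (\<forall>\<xi>. fourier ((L ^^ N) f) \<xi> = of_real (jbr \<xi> ^ (2 * N)) * fourier f \<xi>)" for N
  proof (induction N)
    case 0 then show ?case using assms by simp
  next
    case (Suc N)
    then show ?case using LS[of "(L ^^ N) f"] L[of "(L ^^ N) f"] by (simp add: power2_eq_square)
  qed
  show ?thesis unfolding decaying_def
  proof
    fix N
    have "jbr \<xi> ^ N * norm (fourier f \<xi>) \<le> fconst * (LBINT x. norm ((L ^^ N) f x))" for \<xi>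
    proof -
      have "jbr \<xi> ^ N * norm (fourier f \<xi>) \<le> jbr \<xi> ^ (2 * N) * norm (fourier f \<xi>)"
        by (intro mult_right_mono power_increasing jbr_ge1) auto
      also have "\<dots> = norm (fourier ((L ^^ N) f) \<xi>)" using * by (simp add: norm_mult norm_power)
      also have "\<dots> \<le> fconst * (LBINT x. norm ((L ^^ N) f x))"
        by (intro fourier_bound schwartz_integrable) (use * in blast)
      finally show ?thesis .
    qed
    then show "\<exists>B. \<forall>x. jbr x ^ N * cmod (fourier f x) \<le> B" by blast
  qed
qed

lemma schwartz_fourier: assumes "f \<in> schwartz" shows "fourier f \<in> schwartz"
proof (rule schwartz_coinduct[where C = "fourier ` schwartz"])
  show "fourier f \<in> fourier ` schwartz" using assms by blast
  fix g assume "g \<in> fourier ` schwartz"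
  then obtain f where f: "f \<in> schwartz" "g = fourier f" by blast
  show "g differentiable (at x)" for x using has_derivative_fourier f differentiableI by blast
  show "partial i g \<in> fourier ` schwartz" for i
    unfolding f(2) partial_fourier[OF f(1)]
    by (rule imageI, intro schwartz_const_mult schwartz_coord_mult f(1))
  show "decaying g" unfolding f(2) using f(1) by (rule decaying_fourier)
qed

lemma schwartz_fourier_inv: assumes "f \<in> schwartz" shows "fourier_inv f \<in> schwartz"
  using schwartz_uminus_arg[OF schwartz_fourier[OF assms]] by (simp add: fourier_inv_eq[abs_def])

section \<open>Gaussian regularisation\<close>

text \<open>The heat kernel at time \<open>h^2 / 4\<close>: a Gaussian of unit mass and width
  \<open>h\<close>.\<close>

definition heat :: "real \<Rightarrow> real^3 \<Rightarrow> real^3 \<Rightarrow> real" where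
  "heat h x y = gaussian (1 / h\<^sup>2) x y / (sqrt pi * h) ^ 3"

lemma heat_commute: "heat h x y = heat h y x"
  unfolding heat_def gaussian_def by (simp add: norm_minus_commute)

lemma heat_diff: "heat h x y = heat h 0 (x - y)"
  unfolding heat_def gaussian_def by (simp add: norm_minus_commute)

lemma heat_nonneg: "h > 0 \<Longrightarrow> 0 \<le> heat h x y"
  unfolding heat_def gaussian_def by simp

lemma borel_measurable_heat [measurable]:
  assumes [measurable]: "f \<in> borel_measurable M" "g \<in> borel_measurable M"
  shows "(\<lambda>x. heat h (f x) (g x)) \<in> borel_measurable M"
  unfolding heat_def gaussian_def by measurable

lemma heat_scale: "h > 0 \<Longrightarrow> h ^ 3 * heat h x (x + h *\<^sub>R w) = heat 1 0 w"
  unfolding heat_def gaussian_def by (simp add: power_mult_distrib)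

lemma
  shows integrable_heat_1: "integrable lborel (heat 1 0)"
    and integral_heat_1: "(LBINT w. heat 1 0 w) = 1"
proof -
  have i: "integrable lborel (\<lambda>x::real^3. complex_of_real (exp (- (norm x)\<^sup>2)))"
    and e: "(LINT x::real^3|lborel. complex_of_real (exp (- (norm x)\<^sup>2))) = of_real (sqrt pi ^ 3)"
    using gaussian_fourier[of 1 0] by simp_all
  have i': "integrable lborel (\<lambda>x::real^3. exp (- (norm x)\<^sup>2))"
    using integrable_Re[OF i] by simp
  have "complex_of_real (LINT x::real^3|lborel. exp (- (norm x)\<^sup>2)) = of_real (sqrt pi ^ 3)"
    using e by (simp add: integral_complex_of_real del: of_real_power)
  then have e': "(LINT x::real^3|lborel. exp (- (norm x)\<^sup>2)) = sqrt pi ^ 3" using of_real_eq_iff by blast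
  show "integrable lborel (heat 1 0)" "(LBINT w. heat 1 0 w) = 1"
    unfolding heat_def[abs_def] gaussian_def using i' e' by simp_all
qed

lemma
  assumes h: "h > 0"
  shows integrable_heat: "integrable lborel (heat h x)" "integrable lborel (\<lambda>y. heat h y x)"
    and integral_heat: "(LBINT y. heat h x y) = 1" "(LBINT y. heat h y x) = 1"
proof -
  have [simp]: "heat h x (x + h *\<^sub>R w) = heat 1 0 w / h ^ 3" for w using heat_scale[OF h, of x w] h by (simp add: field_simps)
  have *: "heat 1 0 ((y - x) /\<^sub>R h) / h ^ 3 = heat h x y" for y
    using heat_scale[OF h, of x "(y - x) /\<^sub>R h"] h by (simp add: field_simps)
  show i: "integrable lborel (heat h x)"
    using integrable_divide[OF lborel_integrable_affine[of "1/h" "heat 1 0" "- x /\<^sub>R h", OF _ integrable_heat_1], of "h^3"] h *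
    by (simp add: inverse_eq_divide scaleR_diff_right algebra_simps)
  show e: "(LBINT y. heat h x y) = 1"
    using h by (subst lborel_integral_affine[of h _ x]) (auto simp: integral_heat_1)
  show "integrable lborel (\<lambda>y. heat h y x)" "(LBINT y. heat h y x) = 1"
    using i e by (simp_all add: heat_commute[of _ _ x])
qed

text \<open>The substitution \<open>y = x + h w\<close> moves the small parameter from the kernel to
  the argument of \<open>\<phi>\<close>, where continuity at \<open>x\<close> applies under a fixed
  Gaussian density.\<close>

lemma heat_approx_identity:
  fixes \<phi> :: cfun3
  assumes [measurable]: "\<phi> \<in> borel_measurable borel" and B: "\<And>x. norm (\<phi> x) \<le> B" and c: "isCont \<phi> x"
  shows "(\<lambda>n. LBINT y. of_real (heat (1 / Suc n) x y) * \<phi> y) \<longlonglongrightarrow> \<phi> x"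
proof -
  define h where "h n = 1 / real (Suc n)" for n
  have h: "h n > 0" for n unfolding h_def by simp
  have e: "(LBINT y. of_real (heat (h n) x y) * \<phi> y) = (LBINT w. of_real (heat 1 0 w) * \<phi> (x + h n *\<^sub>R w))" for n
  proof -
    have "complex_of_real (heat (h n) x (x + h n *\<^sub>R w)) = of_real (heat 1 0 w) / of_real (h n ^ 3)" for w
      using heat_scale[OF h, of n x w] h[of n] by (simp flip: of_real_divide of_real_power add: field_simps)
    then have "(LBINT w. of_real (heat (h n) x (x + h n *\<^sub>R w)) * \<phi> (x + h n *\<^sub>R w)) =
      (LBINT w. (of_real (heat 1 0 w) * \<phi> (x + h n *\<^sub>R w)) / of_real (h n ^ 3))" by simp
    also have "\<dots> = (LBINT w. of_real (heat 1 0 w) * \<phi> (x + h n *\<^sub>R w)) / of_real (h n ^ 3)"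
      by (rule integral_divide_zero)
    finally show ?thesis using h[of n]
      by (subst lborel_integral_affine[of "h n" _ x]) (auto simp: scaleR_conv_of_real)
  qed
  have "(\<lambda>n. LBINT w. of_real (heat 1 0 w) * \<phi> (x + h n *\<^sub>R w)) \<longlonglongrightarrow> (LBINT w. of_real (heat 1 0 w) * \<phi> x)"
  proof (rule integral_dominated_convergence[where w = "\<lambda>w. heat 1 0 w * B"])
    show "integrable lborel (\<lambda>w. heat 1 0 w * B)" by (intro integrable_mult_left integrable_heat_1)
    have "(\<lambda>n. \<phi> (x + h n *\<^sub>R w)) \<longlonglongrightarrow> \<phi> x" for w
    proof (rule isCont_tendsto_compose[OF c])
      have "(\<lambda>n. x + h n *\<^sub>R w) \<longlonglongrightarrow> x + 0 *\<^sub>R w"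
        unfolding h_def by (intro tendsto_intros LIMSEQ_Suc[OF lim_1_over_n])
      then show "(\<lambda>n. x + h n *\<^sub>R w) \<longlonglongrightarrow> x" by simp
    qed
    then show "AE w in lborel. (\<lambda>n. of_real (heat 1 0 w) * \<phi> (x + h n *\<^sub>R w)) \<longlonglongrightarrow> of_real (heat 1 0 w) * \<phi> x"
      by (intro AE_I2 tendsto_intros)
    show "AE w in lborel. norm (of_real (heat 1 0 w) * \<phi> (x + h n *\<^sub>R w)) \<le> heat 1 0 w * B" for n
      using B heat_nonneg[of 1] by (intro AE_I2) (simp add: norm_mult mult_left_mono)
  qed measurable
  also have "(LBINT w. of_real (heat 1 0 w) * \<phi> x) = (LBINT w. of_real (heat 1 0 w)) * \<phi> x"
    by (rule integral_mult_left_zero)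
  also have "(LBINT w. complex_of_real (heat 1 0 w)) = 1"
    by (simp add: integral_complex_of_real integral_heat_1)
  finally show ?thesis unfolding e[symmetric] mult_1 unfolding h_def .
qed

lemma heat_bound:
  fixes \<phi> :: cfun3
  assumes h: "h > 0" and [measurable]: "\<phi> \<in> borel_measurable borel" and B: "\<And>x. norm (\<phi> x) \<le> B"
  shows "norm (LBINT y. of_real (heat h x y) * \<phi> y) \<le> B"
proof -
  have i: "integrable lborel (\<lambda>y. B * heat h x y)" by (intro integrable_mult_right integrable_heat h)
  have b: "norm (of_real (heat h x y) * \<phi> y) \<le> B * heat h x y" for y
    using B[of y] heat_nonneg[OF h, of x y] by (simp add: norm_mult mult.commute[of B] mult_left_mono)
  have "norm (LBINT y. of_real (heat h x y) * \<phi> y) \<le> (LBINT y. norm (of_real (heat h x y) * \<phi> y))"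
    by (rule integral_norm_bound)
  also have "\<dots> \<le> (LBINT y. B * heat h x y)"
    by (intro integral_mono i b integrable_norm Bochner_Integration.integrable_bound[OF i])
      (use b in \<open>auto intro!: order_trans[OF b]\<close>)
  also have "\<dots> = B" by (simp add: integral_heat h)
  finally show ?thesis .
qed

text \<open>Averaging \<open>g\<close> with the heat kernel equals the inversion integral damped by
  a Gaussian. The damping makes Fubini applicable even when \<open>fourier g\<close> is not
  integrable; inversion and the L^2 bound both arise as \<open>h\<close> tends to 0.\<close>

lemma heat_fourier:
  assumes h: "h > 0" and g: "integrable lborel g"
  shows "(LBINT y. of_real (heat h x y) * g y) =
    of_real fconst * (LBINT \<xi>. of_real (exp (- (h\<^sup>2 / 4 * (norm \<xi>)\<^sup>2))) * iexp (x \<bullet> \<xi>) * fourier g \<xi>)"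
proof -
  have [measurable]: "g \<in> borel_measurable borel" using g by simp
  let ?E = "\<lambda>\<xi>::real^3. complex_of_real (exp (- (h\<^sup>2 / 4 * (norm \<xi>)\<^sup>2)))"
  have c: "h\<^sup>2 / 4 > 0" using h by simp
  \<comment> \<open>The factor \<open>(2 \<pi>)^3\<close> produced here cancels the square of
    \<open>fconst\<close>.\<close>
  have K: "(LBINT \<xi>. ?E \<xi> * iexp (x \<bullet> \<xi>) * iexp (- (y \<bullet> \<xi>))) = of_real ((2 * pi) ^ 3 * heat h x y)" for y
  proof -
    have "iexp (x \<bullet> \<xi>) * iexp (- (y \<bullet> \<xi>)) = iexp (\<xi> \<bullet> (x - y))" for \<xi>
      unfolding exp_add[symmetric] by (simp add: inner_diff_right inner_commute algebra_simps)
    then have "(LBINT \<xi>. ?E \<xi> * iexp (x \<bullet> \<xi>) * iexp (- (y \<bullet> \<xi>))) =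
      (LBINT \<xi>. iexp (\<xi> \<bullet> (x - y)) * ?E \<xi>)"
      by (simp only: mult.assoc) (simp only: mult.commute)
    also have "\<dots> = of_real (sqrt (pi / (h\<^sup>2 / 4)) ^ 3 * exp (- ((norm (x - y))\<^sup>2 / (4 * (h\<^sup>2 / 4)))))"
      by (rule gaussian_fourier(2)[OF c])
    also have "sqrt (pi / (h\<^sup>2 / 4)) = 2 * sqrt pi / h" using h by (simp add: real_sqrt_divide real_sqrt_mult)
    also have "(2 * sqrt pi / h) ^ 3 * exp (- ((norm (x - y))\<^sup>2 / (4 * (h\<^sup>2 / 4)))) = (2 * pi) ^ 3 * heat h x y"
    proof -
      have "(2 * sqrt pi / h) ^ 3 = (2 * pi) ^ 3 / (sqrt pi * h) ^ 3"
      proof -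
        have "2 * sqrt pi / h = (sqrt pi * (2 * sqrt pi)) / (sqrt pi * h)"
          by (rule mult_divide_mult_cancel_left[symmetric]) simp
        also have "sqrt pi * (2 * sqrt pi) = 2 * pi" by simp
        finally have "2 * sqrt pi / h = 2 * pi / (sqrt pi * h)" .
        then show ?thesis by (simp only: power_divide)
      qed
      then show ?thesis unfolding heat_def gaussian_def by (simp add: norm_minus_commute)
    qed
    finally show ?thesis .
  qed
  have iE: "integrable lborel ?E" using gaussian_fourier(1)[OF c, of 0] by simp
  let ?F = "\<lambda>\<xi> y. ?E \<xi> * iexp (x \<bullet> \<xi>) * (iexp (- (y \<bullet> \<xi>)) * g y)"
  have i: "integrable (lborel \<Otimes>\<^sub>M lborel) (case_prod ?F)"
    by (rule integrable_product_bound[OF iE g]) (auto simp: norm_mult)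
  have "of_real fconst * (LBINT \<xi>. ?E \<xi> * iexp (x \<bullet> \<xi>) * fourier g \<xi>) =
    of_real (fconst * fconst) * (LBINT \<xi>. LBINT y. ?F \<xi> y)"
    unfolding fourier_alt integral_mult_right_zero[symmetric] by (simp add: mult_ac)
  also have "(LBINT \<xi>. LBINT y. ?F \<xi> y) = (LBINT y. LBINT \<xi>. ?F \<xi> y)"
    using lborel_pair.Fubini_integral[OF i] by simp
  also have "\<dots> = (LBINT y. of_real ((2 * pi) ^ 3) * (of_real (heat h x y) * g y))"
    unfolding mult.assoc[symmetric] integral_mult_left_zero K by simp
  also have "of_real (fconst * fconst) * \<dots> = (LBINT y. of_real (heat h x y) * g y)"
    unfolding fconst_square integral_mult_right_zero by simp
  finally show ?thesis by simp
qed

text \<open>The two sides of \<open>heat_fourier\<close> are followed as the width tends to 0: the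
  average tends to \<open>f x\<close>, the damped integral to the inversion integral.\<close>

theorem fourier_inversion:
  assumes f: "f \<in> schwartz" shows "fourier_inv (fourier f) = f"
proof
  fix x
  have [measurable]: "f \<in> borel_measurable borel" using f by measurable
  define h where "h n = 1 / real (Suc n)" for n
  have h: "h n > 0" for n unfolding h_def by simp
  obtain B where B: "\<And>x. norm (f x) \<le> B" using schwartz_bounded[OF f] by blast
  have iF: "integrable lborel (fourier f)" using f by (intro schwartz_integrable schwartz_fourier)
  have "(\<lambda>n. LBINT y. of_real (heat (h n) x y) * f y) \<longlonglongrightarrow> f x"
    unfolding h_def
    by (rule heat_approx_identity[OF _ B])
      (use f schwartz_continuous_on[of f UNIV] in \<open>auto simp: continuous_on_eq_continuous_at\<close>)
  moreover have "(\<lambda>n. LBINT \<xi>. of_real (exp (- ((h n)\<^sup>2 / 4 * (norm \<xi>)\<^sup>2))) * iexp (x \<bullet> \<xi>) * fourier f \<xi>)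
      \<longlonglongrightarrow> (LBINT \<xi>. iexp (x \<bullet> \<xi>) * fourier f \<xi>)"
  proof (rule integral_dominated_convergence[where w = "\<lambda>\<xi>. norm (fourier f \<xi>)"])
    have "(\<lambda>n. of_real (exp (- ((h n)\<^sup>2 / 4 * (norm \<xi>)\<^sup>2))) * iexp (x \<bullet> \<xi>) * fourier f \<xi>)
      \<longlonglongrightarrow> of_real (exp (- (0\<^sup>2 / 4 * (norm \<xi>)\<^sup>2))) * iexp (x \<bullet> \<xi>) * fourier f \<xi>" for \<xi>
      unfolding h_def by (intro tendsto_intros LIMSEQ_Suc[OF lim_1_over_n]) auto
    then show "AE \<xi> in lborel. (\<lambda>n. of_real (exp (- ((h n)\<^sup>2 / 4 * (norm \<xi>)\<^sup>2))) * iexp (x \<bullet> \<xi>) * fourier f \<xi>)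
      \<longlonglongrightarrow> iexp (x \<bullet> \<xi>) * fourier f \<xi>" by simp
    show "AE \<xi> in lborel. norm (of_real (exp (- ((h n)\<^sup>2 / 4 * (norm \<xi>)\<^sup>2))) * iexp (x \<bullet> \<xi>) * fourier f \<xi>)
      \<le> norm (fourier f \<xi>)" for n
      by (intro AE_I2) (auto simp: norm_mult intro!: mult_left_le_one_le)
    show "integrable lborel (\<lambda>\<xi>. norm (fourier f \<xi>))" using iF by (rule integrable_norm)
  qed measurable
  then have "(\<lambda>n. LBINT y. of_real (heat (h n) x y) * f y) \<longlonglongrightarrow> fourier_inv (fourier f) x"
    unfolding heat_fourier[OF h schwartz_integrable[OF f]] fourier_inv_alt by (intro tendsto_intros)
  ultimately show "fourier_inv (fourier f) x = f x" using LIMSEQ_unique by blast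
qed

lemma fourier_inversion': assumes f: "f \<in> schwartz" shows "fourier (fourier_inv f) = f"
proof
  fix x
  have "fourier (fourier_inv f) x = fourier (\<lambda>\<xi>. fourier f (- \<xi>)) x"
    by (simp add: fourier_inv_eq[abs_def])
  also have "\<dots> = fourier (fourier f) (- x)"
    using schwartz_measurable[OF schwartz_fourier[OF f]] by (rule fourier_reflect)
  also have "\<dots> = fourier_inv (fourier f) x" by (simp add: fourier_inv_eq)
  finally show "fourier (fourier_inv f) x = f x" using fourier_inversion[OF f] by simp
qed

section \<open>The Bessel operator on Schwartz functions\<close>

lemma symb_jbr_power: "symb (\<lambda>x. of_real (jbr x ^ n))" "symb (\<lambda>x. of_real (inverse (jbr x) ^ n))"
  using symb_power[OF symb.jbr, of n] symb_power[OF symb.inverse_jbr, of n] by simp_all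

lemma schwartz_bessel: assumes "f \<in> schwartz" shows "bessel_schwartz f \<in> schwartz"
  unfolding bessel_schwartz_def
  by (intro schwartz_fourier_inv schwartz_symb_mult symb.jbr schwartz_fourier assms)

text \<open>The transform is divided by \<open>jbr\<close>, whose inverse is again a symbol. Testing
  against the range of \<open>bessel_schwartz\<close> is thus the same as testing against all
  Schwartz functions.\<close>

lemma bessel_surj: assumes f: "f \<in> schwartz" shows "\<exists>\<phi>\<in>schwartz. bessel_schwartz \<phi> = f"
proof
  let ?g = "\<lambda>\<xi>. of_real (inverse (jbr \<xi>)) * fourier f \<xi>"
  have g: "?g \<in> schwartz" by (intro schwartz_symb_mult symb.inverse_jbr schwartz_fourier f)
  show "fourier_inv ?g \<in> schwartz" using g by (rule schwartz_fourier_inv)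
  have "(\<lambda>\<xi>. of_real (jbr \<xi>) * ?g \<xi>) = fourier f" by (simp add: fun_eq_iff mult.assoc[symmetric])
  then show "bessel_schwartz (fourier_inv ?g) = f"
    unfolding bessel_schwartz_def fourier_inversion'[OF g] using fourier_inversion[OF f] by simp
qed

section \<open>Tempered functions are determined by Schwartz functions\<close>

lemma tempered_measurable [measurable_dest]: "tempered f \<Longrightarrow> f \<in> borel_measurable borel"
  unfolding tempered_def by blast

lemma tempered_mult_integrable:
  assumes f: "tempered f" and \<phi>: "decaying \<phi>" and [measurable]: "\<phi> \<in> borel_measurable borel"
  shows "integrable lborel (\<lambda>x. f x * \<phi> x)"
proof -
  have [measurable]: "f \<in> borel_measurable borel" using f by measurable
  obtain N where N: "integrable lborel (\<lambda>x. f x / of_real (jbr x ^ N))" using f unfolding tempered_def by blast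
  obtain B where B: "\<And>x. jbr x ^ N * norm (\<phi> x) \<le> B" using \<phi> unfolding decaying_def by metis
  show ?thesis
  proof (rule Bochner_Integration.integrable_bound[OF integrable_mult_left[OF integrable_norm[OF N], of B]])
    have "norm (f x * \<phi> x) \<le> norm (f x / of_real (jbr x ^ N)) * B" for x
    proof -
      have "norm (f x * \<phi> x) = norm (f x / of_real (jbr x ^ N)) * (jbr x ^ N * norm (\<phi> x))"
        by (simp add: norm_mult norm_divide norm_power)
      also have "\<dots> \<le> norm (f x / of_real (jbr x ^ N)) * B" using B by (intro mult_left_mono) auto
      finally show ?thesis .
    qed
    then show "AE x in lborel. norm (f x * \<phi> x) \<le> norm (norm (f x / of_real (jbr x ^ N)) * B)"
      by (intro AE_I2) (simp, meson abs_ge_self order_trans)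
  qed measurable
qed

lemma tempered_schwartz_integrable:
  "tempered f \<Longrightarrow> \<phi> \<in> schwartz \<Longrightarrow> integrable lborel (\<lambda>x. f x * \<phi> x)"
  using tempered_mult_integrable schwartz_decaying schwartz_measurable by blast

lemma AE_zero_if_set_integrals_zero:
  fixes G :: "'a \<Rightarrow> complex"
  assumes G: "integrable M G" and z: "\<And>A. A \<in> sets M \<Longrightarrow> (LINT x:A|M. G x) = 0"
  shows "AE x in M. G x = 0"
proof -
  have iA: "integrable M (\<lambda>x. indicator A x *\<^sub>R G x)" if "A \<in> sets M" for A
    using integrable_mult_indicator[OF that G] .
  have "AE x in M. Re (G x) = 0"
  proof (rule density_unique_real)
    show "(LINT x:A|M. Re (G x)) = (LINT x:A|M. 0)" if "A \<in> sets M" for A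
      using z[OF that] integral_Re[OF iA[OF that]] unfolding set_lebesgue_integral_def by simp
  qed (use G in auto)
  moreover have "AE x in M. Im (G x) = 0"
  proof (rule density_unique_real)
    show "(LINT x:A|M. Im (G x)) = (LINT x:A|M. 0)" if "A \<in> sets M" for A
      using z[OF that] integral_Im[OF iA[OF that]] unfolding set_lebesgue_integral_def by simp
  qed (use G in auto)
  ultimately show ?thesis by eventually_elim (simp add: complex_eq_iff)
qed

text \<open>Closed sets are stable under intersection and generate the Borel sets, so the vanishing
  of the set integrals extends from them by Dynkin induction.\<close>

lemma AE_zero_if_closed_integrals_zero:
  fixes G :: "'a::euclidean_space \<Rightarrow> complex"
  assumes G: "integrable lborel G" and z: "\<And>A. closed A \<Longrightarrow> (LINT x:A|lborel. G x) = 0"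
  shows "AE x in lborel. G x = 0"
proof (rule AE_zero_if_set_integrals_zero[OF G])
  fix A :: "'a set" assume "A \<in> sets lborel"
  then have A: "A \<in> sigma_sets UNIV (Collect closed)" by (simp add: borel_eq_closed)
  have si: "set_integrable lborel A G" if "A \<in> sets borel" for A
    unfolding set_integrable_def using integrable_mult_indicator[OF _ G] that by simp
  have sb: "A \<in> sets borel" if "A \<in> sigma_sets UNIV (Collect closed)" for A :: "'a set"
    using that by (simp add: borel_eq_closed)
  show "(LINT x:A|lborel. G x) = 0"
  proof (rule sigma_sets_induct_disjoint[OF _ _ A])
    show "Int_stable (Collect closed :: 'a set set)" by (auto simp: Int_stable_def closed_Int)
    show "(LINT x:{}|lborel. G x) = 0" by (simp add: set_lebesgue_integral_def)
    fix A :: "'a set" assume A: "A \<in> sigma_sets UNIV (Collect closed)" "(LINT x:A|lborel. G x) = 0"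
    have "(LINT x:UNIV|lborel. G x) = (LINT x:A|lborel. G x) + (LINT x:(UNIV - A)|lborel. G x)"
      using A(1) sb si by (subst set_integral_Un[symmetric]) auto
    then show "(LINT x:(UNIV - A)|lborel. G x) = 0" using A(2) z[of UNIV] by simp
  next
    fix A :: "nat \<Rightarrow> 'a set"
    assume A: "disjoint_family A" "range A \<subseteq> sigma_sets UNIV (Collect closed)"
      "\<And>i. (LINT x:A i|lborel. G x) = 0"
    have Ab: "A i \<in> sets borel" for i using A(2) sb by blast
    have "(LINT x:(\<Union>i. A i)|lborel. G x) = (\<Sum>i. (LINT x:A i|lborel. G x))"
      using A(1) Ab by (intro lebesgue_integral_countable_add si) (auto simp: disjoint_family_on_def)
    then show "(LINT x:(\<Union>i. A i)|lborel. G x) = 0" using A(3) by simp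
  qed (use z in auto)
qed

text \<open>Fubini moves the Gaussian average from \<open>G\<close> to a bounded continuous test
  function. As the width shrinks, the integral of \<open>G\<close> against every such function
  vanishes, and such functions approximate the indicator of a closed set.\<close>

lemma AE_zero_if_heat_zero:
  fixes G :: cfun3
  assumes G: "integrable lborel G"
    and z: "\<And>h x. h > 0 \<Longrightarrow> (LBINT y. of_real (heat h x y) * G y) = 0"
  shows "AE x in lborel. G x = 0"
proof (rule AE_zero_if_closed_integrals_zero[OF G])
  have [measurable]: "G \<in> borel_measurable borel" using G by simp
  have C: "(LBINT x. \<psi> x * G x) = 0" if c: "continuous_on UNIV \<psi>" and B: "\<And>x. norm (\<psi> x) \<le> B" for \<psi> :: cfun3 and B
  proof -
    have [measurable]: "\<psi> \<in> borel_measurable borel" using c by (rule borel_measurable_continuous_onI)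
    have "(LBINT y. (LBINT x. of_real (heat h y x) * \<psi> x) * G y) = 0" if h: "h > 0" for h
    proof -
      have ih: "integrable lborel (\<lambda>x. complex_of_real (heat h 0 x))" using integrable_heat[OF h] by simp
      have i: "integrable (lborel \<Otimes>\<^sub>M lborel) (\<lambda>(x, y). \<psi> x * (of_real (heat h x y) * G y))"
      proof (rule Bochner_Integration.integrable_bound[OF integrable_mult_right[OF integrable_convolution(2)[OF ih G], of "of_real B"]])
        have "norm (\<psi> x * (of_real (heat h x y) * G y)) \<le> norm (of_real B * (of_real (heat h 0 (x - y)) * G y))" for x y
        proof -
          have "norm (\<psi> x * (of_real (heat h x y) * G y)) \<le> \<bar>B\<bar> * norm (of_real (heat h x y) * G y)"
            unfolding norm_mult[of "\<psi> x"] using B[of x] by (intro mult_right_mono) auto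
          also have "\<dots> = norm (of_real B * (of_real (heat h 0 (x - y)) * G y))"
            by (simp only: norm_mult norm_of_real heat_diff[of h x y])
          finally show ?thesis .
        qed
        then show "AE p in lborel \<Otimes>\<^sub>M lborel. norm (case p of (x, y) \<Rightarrow> \<psi> x * (of_real (heat h x y) * G y))
          \<le> norm (of_real B * (case p of (x, y) \<Rightarrow> of_real (heat h 0 (x - y)) * G y))"
          by (intro AE_I2) (simp split: prod.split)
      qed measurable
      have "(LBINT x. LBINT y. \<psi> x * (of_real (heat h x y) * G y)) =
        (LBINT y. LBINT x. \<psi> x * (of_real (heat h x y) * G y))"
        using lborel_pair.Fubini_integral[OF i] by simp
      moreover have "(LBINT x. LBINT y. \<psi> x * (of_real (heat h x y) * G y)) = 0"
        unfolding integral_mult_right_zero z[OF h] by simp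
      ultimately show ?thesis
        by (simp add: heat_commute[of h] mult_ac flip: integral_mult_left_zero)
    qed
    then have "(\<lambda>n. LBINT y. (LBINT x. of_real (heat (1 / Suc n) y x) * \<psi> x) * G y) \<longlonglongrightarrow> 0" by simp
    moreover have "(\<lambda>n. LBINT y. (LBINT x. of_real (heat (1 / Suc n) y x) * \<psi> x) * G y) \<longlonglongrightarrow> (LBINT y. \<psi> y * G y)"
    proof (rule integral_dominated_convergence[where w = "\<lambda>y. B * norm (G y)"])
      have "(\<lambda>n. LBINT x. of_real (heat (1 / Suc n) y x) * \<psi> x) \<longlonglongrightarrow> \<psi> y" for y
        by (rule heat_approx_identity[OF _ B]) (use c in \<open>auto simp: continuous_on_eq_continuous_at\<close>)
      then show "AE y in lborel. (\<lambda>n. (LBINT x. of_real (heat (1 / Suc n) y x) * \<psi> x) * G y) \<longlonglongrightarrow> \<psi> y * G y"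
        by (intro AE_I2 tendsto_intros)
      show "AE y in lborel. norm ((LBINT x. of_real (heat (1 / Suc n) y x) * \<psi> x) * G y) \<le> B * norm (G y)" for n
        by (intro AE_I2) (unfold norm_mult, intro mult_right_mono heat_bound B, auto)
    qed (use G in auto)
    ultimately show ?thesis using LIMSEQ_unique by blast
  qed
  fix A :: "(real^3) set" assume A: "closed A"
  show "(LINT x:A|lborel. G x) = 0"
  proof (cases "A = {}")
    case True then show ?thesis by (simp add: set_lebesgue_integral_def)
  next
    case False
    \<comment> \<open>Equal to 1 on \<open>A\<close> and, for positive \<open>n\<close>, to 0 at
      distance at least \<open>1 / n\<close> from it. Closedness of \<open>A\<close> makes the
      distance positive at every point outside.\<close>
    define \<psi> where "\<psi> n x = max 0 (1 - real n * infdist x A)" for n :: nat and x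
    have b: "0 \<le> \<psi> n x" "\<psi> n x \<le> 1" for n x unfolding \<psi>_def by (auto simp: infdist_nonneg)
    have c: "continuous_on UNIV (\<psi> n)" for n unfolding \<psi>_def by (intro continuous_intros)
    have [measurable]: "\<psi> n \<in> borel_measurable borel" for n using c by (rule borel_measurable_continuous_onI)
    have "(LBINT x. of_real (\<psi> n x) * G x) = 0" for n
      by (rule C[where B = 1]) (use b c in \<open>auto intro!: continuous_intros\<close>)
    moreover have "(\<lambda>n. LBINT x. of_real (\<psi> n x) * G x) \<longlonglongrightarrow> (LBINT x. indicator A x *\<^sub>R G x)"
    proof (rule integral_dominated_convergence[where w = "\<lambda>x. norm (G x)"])
      have "(\<lambda>n. \<psi> n x) \<longlonglongrightarrow> indicator A x" for x
      proof (cases "x \<in> A")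
        case True then show ?thesis unfolding \<psi>_def by simp
      next
        case notA: False
        then have d: "infdist x A > 0" using A False
          by (metis in_closed_iff_infdist_zero infdist_nonneg less_eq_real_def)
        obtain N where N: "1 / infdist x A < real N" using reals_Archimedean2 by blast
        have "\<psi> n x = 0" if "n \<ge> N" for n
        proof -
          have "1 / infdist x A < real n" using N that by simp
          then show ?thesis using d unfolding \<psi>_def by (simp add: field_simps)
        qed
        then have "\<forall>\<^sub>F n in sequentially. \<psi> n x = indicator A x"
          using notA by (auto simp: eventually_sequentially)
        then show ?thesis by (rule tendsto_eventually)
      qed
      then show "AE x in lborel. (\<lambda>n. of_real (\<psi> n x) * G x) \<longlonglongrightarrow> indicator A x *\<^sub>R G x"
        unfolding scaleR_conv_of_real by (intro AE_I2 tendsto_intros)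
      show "AE x in lborel. norm (of_real (\<psi> n x) * G x) \<le> norm (G x)" for n
        using b by (intro AE_I2) (auto simp: norm_mult intro!: mult_left_le_one_le)
    qed (use G A in auto)
    ultimately show ?thesis unfolding set_lebesgue_integral_def by (simp add: LIMSEQ_const_iff)
  qed
qed

text \<open>A Gaussian divided by a power of \<open>jbr\<close> is a Schwartz function. Testing
  \<open>g\<close> with it amounts to testing the integrable quotient \<open>g / jbr^N\<close> with
  the Gaussian.\<close>

theorem tempered_AE_zero:
  assumes g: "tempered g" and z: "\<And>\<phi>. \<phi> \<in> schwartz \<Longrightarrow> (LBINT x. g x * \<phi> x) = 0"
  shows "AE x in lborel. g x = 0"
proof -
  obtain N where N: "integrable lborel (\<lambda>x. g x / of_real (jbr x ^ N))" using g unfolding tempered_def by blast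
  have "AE x in lborel. g x / of_real (jbr x ^ N) = 0"
  proof (rule AE_zero_if_heat_zero[OF N])
    fix h :: real and x assume h: "h > 0"
    let ?\<phi> = "\<lambda>y. of_real (inverse (jbr y) ^ N) * (of_real (1 / (sqrt pi * h) ^ 3) * of_real (gaussian (1 / h\<^sup>2) x y)) :: complex"
    have "?\<phi> \<in> schwartz"
      using h by (intro schwartz_symb_mult symb_jbr_power schwartz_const_mult schwartz_gaussian) auto
    from z[OF this] show "(LBINT y. of_real (heat h x y) * (g y / of_real (jbr y ^ N))) = 0"
      unfolding heat_def by (simp add: divide_inverse mult_ac power_inverse)
  qed
  then show ?thesis by eventually_elim simp
qed

lemma tempered_diff:
  assumes "tempered f" "tempered g" shows "tempered (\<lambda>x. f x - g x)"
proof -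
  have [measurable]: "f \<in> borel_measurable borel" "g \<in> borel_measurable borel" using assms by measurable
  obtain N M where N: "integrable lborel (\<lambda>x. f x / of_real (jbr x ^ N))"
    and M: "integrable lborel (\<lambda>x. g x / of_real (jbr x ^ M))" using assms unfolding tempered_def by blast
  have le: "norm (f x / of_real (jbr x ^ (K + L))) \<le> norm (f x / of_real (jbr x ^ K))" for f :: cfun3 and x K L
    using jbr_ge1[of x] unfolding norm_divide
    by (intro divide_left_mono) (auto simp: norm_power intro!: power_increasing)
  have "integrable lborel (\<lambda>x. f x / of_real (jbr x ^ (N + M)) - g x / of_real (jbr x ^ (M + N)))"
    by (intro Bochner_Integration.integrable_diff Bochner_Integration.integrable_bound[OF N]
        Bochner_Integration.integrable_bound[OF M] AE_I2 le) measurable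
  then have "integrable lborel (\<lambda>x. (f x - g x) / of_real (jbr x ^ (N + M)))"
    by (simp add: diff_divide_distrib add.commute)
  then show ?thesis unfolding tempered_def by (auto intro!: exI[of _ "N + M"])
qed

lemma tempered_AE_eq:
  assumes f: "tempered f" and g: "tempered g"
    and e: "\<And>\<phi>. \<phi> \<in> schwartz \<Longrightarrow> (LBINT x. f x * \<phi> x) = (LBINT x. g x * \<phi> x)"
  shows "AE x in lborel. f x = g x"
proof -
  have "AE x in lborel. f x - g x = 0"
  proof (rule tempered_AE_zero[OF tempered_diff[OF f g]])
    fix \<phi> assume \<phi>: "\<phi> \<in> schwartz"
    show "(LBINT x. (f x - g x) * \<phi> x) = 0"
      unfolding left_diff_distrib using e[OF \<phi>] \<phi> f g
      by (subst Bochner_Integration.integral_diff) (auto intro: tempered_schwartz_integrable)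
  qed
  then show ?thesis by eventually_elim simp
qed

section \<open>The Plancherel transform\<close>

lemma Cauchy_Schwarz_integral:
  fixes a b :: "'a \<Rightarrow> real"
  assumes [measurable]: "a \<in> borel_measurable M" "b \<in> borel_measurable M"
    and a: "integrable M (\<lambda>x. (a x)\<^sup>2)" and b: "integrable M (\<lambda>x. (b x)\<^sup>2)"
    and nn: "\<And>x. 0 \<le> a x" "\<And>x. 0 \<le> b x"
  shows "(LINT x|M. a x * b x) \<le> sqrt (LINT x|M. (a x)\<^sup>2) * sqrt (LINT x|M. (b x)\<^sup>2)"
proof -
  have le: "norm (a x * b x) \<le> norm ((a x)\<^sup>2 + (b x)\<^sup>2)" for x
  proof -
    have "0 \<le> a x * b x" "2 * (a x * b x) \<le> (a x)\<^sup>2 + (b x)\<^sup>2"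
      using sum_squares_bound[of "a x" "b x"] nn by simp_all
    then show ?thesis by (auto simp del: abs_mult)
  qed
  have i: "integrable M (\<lambda>x. a x * b x)"
    by (rule Bochner_Integration.integrable_bound[OF Bochner_Integration.integrable_add[OF a b]]) (use le in auto)
  have "(\<integral>\<^sup>+x. ennreal (a x) * ennreal (b x) \<partial>M)\<^sup>2 \<le> (\<integral>\<^sup>+x. ennreal (a x) ^ 2 \<partial>M) * (\<integral>\<^sup>+x. ennreal (b x) ^ 2 \<partial>M)"
    by (rule Cauchy_Schwarz_nn_integral) measurable
  also have "(\<integral>\<^sup>+x. ennreal (a x) * ennreal (b x) \<partial>M) = ennreal (LINT x|M. a x * b x)"
    using i nn by (subst nn_integral_eq_integral[symmetric]) (auto simp: ennreal_mult)
  also have "(\<integral>\<^sup>+x. ennreal (a x) ^ 2 \<partial>M) = ennreal (LINT x|M. (a x)\<^sup>2)"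
    using a nn by (subst nn_integral_eq_integral[symmetric]) (auto simp: ennreal_power)
  also have "(\<integral>\<^sup>+x. ennreal (b x) ^ 2 \<partial>M) = ennreal (LINT x|M. (b x)\<^sup>2)"
    using b nn by (subst nn_integral_eq_integral[symmetric]) (auto simp: ennreal_power)
  finally have "(LINT x|M. a x * b x)\<^sup>2 \<le> (LINT x|M. (a x)\<^sup>2) * (LINT x|M. (b x)\<^sup>2)"
    using nn by (simp add: ennreal_power integral_nonneg_AE ennreal_mult[symmetric])
  then show "(LINT x|M. a x * b x) \<le> sqrt (LINT x|M. (a x)\<^sup>2) * sqrt (LINT x|M. (b x)\<^sup>2)"
    by (simp add: real_le_rsqrt flip: real_sqrt_mult)
qed

text \<open>For limits without a dominating function: the removal of the Gaussian weight in the L^2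
  bound, and the L^2 estimate for a limit that is known only almost everywhere.\<close>

lemma Fatou_bound:
  fixes q :: "nat \<Rightarrow> 'a \<Rightarrow> real"
  assumes q: "\<And>n. integrable M (q n)" "\<And>n x. 0 \<le> q n x" and [measurable]: "Q \<in> borel_measurable M"
    and Q: "\<And>x. 0 \<le> Q x" "AE x in M. (\<lambda>n. q n x) \<longlonglongrightarrow> Q x" and C: "\<And>n. (LINT x|M. q n x) \<le> C"
  shows "integrable M Q" "(LINT x|M. Q x) \<le> C"
proof -
  have [measurable]: "q n \<in> borel_measurable M" for n using q(1) by simp
  have "0 \<le> (LINT x|M. q 0 x)" by (rule integral_nonneg_AE) (use q(2) in auto)
  with C[of 0] have C0: "C \<ge> 0" by linarith
  have "(\<integral>\<^sup>+x. ennreal (Q x) \<partial>M) = (\<integral>\<^sup>+x. liminf (\<lambda>n. ennreal (q n x)) \<partial>M)"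
  proof (rule nn_integral_cong_AE, use Q(2) in eventually_elim)
    fix x assume "(\<lambda>n. q n x) \<longlonglongrightarrow> Q x"
    then have "(\<lambda>n. ennreal (q n x)) \<longlonglongrightarrow> ennreal (Q x)" by (rule tendsto_ennrealI)
    then show "ennreal (Q x) = liminf (\<lambda>n. ennreal (q n x))"
      by (intro lim_imp_Liminf[symmetric]) auto
  qed
  also have "\<dots> \<le> liminf (\<lambda>n. \<integral>\<^sup>+x. ennreal (q n x) \<partial>M)" by (rule nn_integral_liminf) measurable
  also have "\<dots> \<le> liminf (\<lambda>n::nat. ennreal C)"
    using C q by (intro Liminf_mono always_eventually allI) (simp add: nn_integral_eq_integral ennreal_leI)
  also have "\<dots> = ennreal C" by (simp add: Liminf_const)
  finally have le: "(\<integral>\<^sup>+x. ennreal (Q x) \<partial>M) \<le> ennreal C" .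
  show i: "integrable M Q"
    by (rule integrableI_nonneg) (use Q(1) le in \<open>auto intro: le_less_trans\<close>)
  show "(LINT x|M. Q x) \<le> C"
    using le Q(1) i C0 by (simp add: nn_integral_eq_integral)
qed

section \<open>Square integrable functions and the weighted pairing\<close>

lemma L2_iff: "f \<in> L2 \<longleftrightarrow> f \<in> borel_measurable borel \<and> integrable lborel (\<lambda>x. (norm (f x))\<^sup>2)"
  unfolding L2w_def by (simp add: powr_zero_eq_one less_imp_neq[OF jbr_pos, symmetric])

lemma L2_measurable [measurable_dest]: "f \<in> L2 \<Longrightarrow> f \<in> borel_measurable borel"
  by (simp add: L2_iff)

lemma L2_integrable: "f \<in> L2 \<Longrightarrow> integrable lborel (\<lambda>x. (norm (f x))\<^sup>2)"
  by (simp add: L2_iff)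

lemma L2_bound:
  assumes "g \<in> L2" "f \<in> borel_measurable borel" "\<And>x. norm (f x) \<le> c * norm (g x)" shows "f \<in> L2"
  unfolding L2_iff
proof
  show "integrable lborel (\<lambda>x. (norm (f x))\<^sup>2)"
  proof (rule Bochner_Integration.integrable_bound[OF integrable_mult_right[OF L2_integrable[OF assms(1)], of "c\<^sup>2"]])
    have "(norm (f x))\<^sup>2 \<le> c\<^sup>2 * (norm (g x))\<^sup>2" for x
      using power_mono[OF assms(3)[of x], of 2] by (simp add: power_mult_distrib)
    then show "AE x in lborel. norm ((norm (f x))\<^sup>2) \<le> norm (c\<^sup>2 * (norm (g x))\<^sup>2)" by simp
  qed (use assms(2) in measurable)
qed (rule assms)

lemma L2_add:
  assumes f: "f \<in> L2" and g: "g \<in> L2" shows "(\<lambda>x. f x + g x) \<in> L2"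
  unfolding L2_iff
proof
  show m: "(\<lambda>x. f x + g x) \<in> borel_measurable borel" using f g by measurable
  show "integrable lborel (\<lambda>x. (norm (f x + g x))\<^sup>2)"
  proof (rule Bochner_Integration.integrable_bound[OF integrable_mult_right[OF
        Bochner_Integration.integrable_add[OF L2_integrable[OF f] L2_integrable[OF g]], of 2]])
    have "(norm (f x + g x))\<^sup>2 \<le> 2 * ((norm (f x))\<^sup>2 + (norm (g x))\<^sup>2)" for x
      using power_mono[OF norm_triangle_ineq[of "f x" "g x"], of 2] sum_squares_bound[of "norm (f x)" "norm (g x)"]
      by (simp add: power2_sum)
    then show "AE x in lborel. norm ((norm (f x + g x))\<^sup>2) \<le> norm (2 * ((norm (f x))\<^sup>2 + (norm (g x))\<^sup>2))" by simp
  qed (use m in measurable)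
qed

lemma L2_cmult: "f \<in> L2 \<Longrightarrow> (\<lambda>x. c * f x) \<in> L2"
  by (rule L2_bound[where c = "norm c"]) (auto simp: norm_mult dest: L2_measurable)

lemma L2_diff: "f \<in> L2 \<Longrightarrow> g \<in> L2 \<Longrightarrow> (\<lambda>x. f x - g x) \<in> L2"
  using L2_add[OF _ L2_cmult[of g "-1"]] by simp

text \<open>The weight \<open>jbr^2\<close> suffices, since \<open>1 / jbr^4\<close> is integrable
  and \<open>a b \<le> a^2 + b^2\<close> for nonnegative \<open>a\<close> and
  \<open>b\<close>.\<close>

lemma L2_tempered: assumes f: "f \<in> L2" shows "tempered f"
  unfolding tempered_def
proof (intro conjI exI)
  show m: "f \<in> borel_measurable borel" using f by measurable
  show "integrable lborel (\<lambda>x. f x / of_real (jbr x ^ 2))"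
  proof (rule Bochner_Integration.integrable_bound[OF Bochner_Integration.integrable_add[OF L2_integrable[OF f] integrable_jbr4]])
    have "norm (f x / of_real (jbr x ^ 2)) \<le> norm ((norm (f x))\<^sup>2 + 1 / jbr x ^ 4)" for x
    proof -
      have "2 * (norm (f x) * (1 / jbr x ^ 2)) \<le> (norm (f x))\<^sup>2 + (1 / jbr x ^ 2)\<^sup>2"
        using sum_squares_bound[of "norm (f x)" "1 / jbr x ^ 2"] by simp
      moreover have "0 \<le> norm (f x) * (1 / jbr x ^ 2)" by simp
      ultimately have "norm (f x) * (1 / jbr x ^ 2) \<le> (norm (f x))\<^sup>2 + (1 / jbr x ^ 2)\<^sup>2" by linarith
      also have "(1 / jbr x ^ 2)\<^sup>2 = 1 / jbr x ^ 4" by (simp add: power_divide flip: power_mult)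
      finally show ?thesis by (simp add: norm_divide norm_power)
    qed
    then show "AE x in lborel. norm (f x / of_real (jbr x ^ 2)) \<le> norm ((norm (f x))\<^sup>2 + 1 / jbr x ^ 4)" by simp
  qed (use m in measurable)
qed

lemma schwartz_L2w: assumes f: "f \<in> schwartz" shows "f \<in> L2w s"
  unfolding L2w_def
proof (intro CollectI conjI)
  show [measurable]: "f \<in> borel_measurable borel" using f by measurable
  define N where "N = nat \<lceil>\<bar>s\<bar>\<rceil>"
  \<comment> \<open>The bound is squared below: \<open>N\<close> powers absorb the weight
    \<open>jbr x powr s\<close>, and the other two become the \<open>jbr^4\<close> that gives
    integrability.\<close>
  obtain B where B: "\<And>x. jbr x ^ (2 + N) * norm (f x) \<le> B" using schwartz_decaying[OF f] unfolding decaying_def by metis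
  show "integrable lborel (\<lambda>x. (jbr x powr s * norm (f x))\<^sup>2)"
  proof (rule integrable_jbr_bound[where B = "B\<^sup>2"])
    show "jbr x ^ 4 * norm ((jbr x powr s * norm (f x))\<^sup>2) \<le> B\<^sup>2" for x
    proof -
      have "s \<le> real N" unfolding N_def by linarith
      then have "jbr x powr s \<le> jbr x powr real N" using jbr_ge1[of x] by (intro powr_mono) auto
      then have p: "jbr x powr s \<le> jbr x ^ N" by (simp add: powr_realpow)
      have "jbr x ^ 4 * norm ((jbr x powr s * norm (f x))\<^sup>2) = (jbr x ^ 2 * (jbr x powr s * norm (f x)))\<^sup>2"
        by (simp add: power_mult_distrib flip: power_mult)
      also have "\<dots> \<le> (jbr x ^ 2 * (jbr x ^ N * norm (f x)))\<^sup>2"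
        using p by (intro power_mono mult_left_mono mult_right_mono) auto
      also have "\<dots> \<le> B\<^sup>2" using B[of x, unfolded power_add mult.assoc] by (intro power_mono) auto
      finally show ?thesis .
    qed
  qed measurable
qed

lemma L2w_pairing:
  assumes h: "h \<in> L2w (- s)" and \<phi>: "\<phi> \<in> L2w s"
  shows "norm (LBINT x. h x * \<phi> x) \<le> L2w_norm (- s) h * L2w_norm s \<phi>"
proof -
  have [measurable]: "h \<in> borel_measurable borel" "\<phi> \<in> borel_measurable borel"
    using h \<phi> unfolding L2w_def by auto
  have "norm (LBINT x. h x * \<phi> x) \<le> (LBINT x. norm (h x * \<phi> x))" by (rule integral_norm_bound)
  also have "\<dots> = (LBINT x. (jbr x powr (- s) * norm (h x)) * (jbr x powr s * norm (\<phi> x)))"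
    by (intro Bochner_Integration.integral_cong refl) (simp add: norm_mult powr_minus field_simps)
  also have "\<dots> \<le> L2w_norm (- s) h * L2w_norm s \<phi>"
    unfolding L2w_norm_def by (rule Cauchy_Schwarz_integral) (use h \<phi> in \<open>auto simp: L2w_def\<close>)
  finally show ?thesis .
qed

lemma L2_pairing_tendsto:
  assumes a: "\<And>n. a n \<in> L2" and l: "(\<lambda>n. LBINT x. (norm (a n x))\<^sup>2) \<longlonglongrightarrow> 0" and \<phi>: "\<phi> \<in> L2"
  shows "(\<lambda>n. LBINT x. a n x * \<phi> x) \<longlonglongrightarrow> 0"
proof (rule tendsto_norm_zero_cancel, rule tendsto_sandwich[OF _ _ tendsto_const])
  show "\<forall>\<^sub>F n in sequentially. 0 \<le> norm (LBINT x. a n x * \<phi> x)" by simp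
  show "\<forall>\<^sub>F n in sequentially. norm (LBINT x. a n x * \<phi> x) \<le> sqrt (LBINT x. (norm (a n x))\<^sup>2) * L2w_norm 0 \<phi>"
    using L2w_pairing[of _ 0] a \<phi> by (intro always_eventually allI) (simp add: L2w_norm_def)
  have "(\<lambda>n. sqrt (LBINT x. (norm (a n x))\<^sup>2) * L2w_norm 0 \<phi>) \<longlonglongrightarrow> sqrt 0 * L2w_norm 0 \<phi>"
    by (intro tendsto_intros l)
  then show "(\<lambda>n. sqrt (LBINT x. (norm (a n x))\<^sup>2) * L2w_norm 0 \<phi>) \<longlonglongrightarrow> 0" by simp
qed

lemma borel_measurable_cnj [measurable (raw)]:
  "f \<in> borel_measurable M \<Longrightarrow> (\<lambda>x. cnj (f x)) \<in> borel_measurable M"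
  by (rule measurable_compose[OF _ borel_measurable_continuous_onI]) (auto intro!: continuous_intros)

text \<open>With a Gaussian weight the left side becomes, by \<open>heat_fourier\<close>, the
  pairing of \<open>g\<close> with its own heat average. Averaging with a kernel of mass one does
  not increase the L^2 norm, and Fatou removes the weight. This inequality is what carries the
  transform over to L^2 by approximation.\<close>

theorem fourier_Bessel_inequality:
  assumes g: "integrable lborel g" and gL: "g \<in> L2"
  shows "fourier g \<in> L2" "(LBINT \<xi>. (norm (fourier g \<xi>))\<^sup>2) \<le> (LBINT x. (norm (g x))\<^sup>2)"
proof -
  have [measurable]: "g \<in> borel_measurable borel" using g by simp
  let ?E = "\<lambda>h \<xi>. exp (- (h\<^sup>2 / 4 * (norm (\<xi> :: real^3))\<^sup>2))"
  define C where "C = (LBINT x. (norm (g x))\<^sup>2)"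
  have main: "integrable lborel (\<lambda>\<xi>. ?E h \<xi> * (norm (fourier g \<xi>))\<^sup>2) \<and> (LBINT \<xi>. ?E h \<xi> * (norm (fourier g \<xi>))\<^sup>2) \<le> C"
    if h: "h > 0" for h
  proof -
    have c: "h\<^sup>2 / 4 > 0" using h by simp
    have iE: "integrable lborel (\<lambda>\<xi>. complex_of_real (?E h \<xi>))" using gaussian_fourier(1)[OF c, of 0] by simp
    define M where "M = fconst * (LBINT x. norm (g x))"
    have M: "norm (fourier g \<xi>) \<le> M" for \<xi> unfolding M_def by (rule fourier_bound[OF g])
    have iEF: "integrable lborel (\<lambda>\<xi>. of_real (?E h \<xi>) * fourier g \<xi>)"
    proof (rule Bochner_Integration.integrable_bound[OF integrable_mult_left[OF iE, of "of_real M"]])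
      show "AE \<xi> in lborel. norm (of_real (?E h \<xi>) * fourier g \<xi>) \<le> norm (of_real (?E h \<xi>) * complex_of_real M)"
        using M by (intro AE_I2) (simp add: norm_mult, meson abs_ge_self order_trans)
    qed measurable
    let ?F = "\<lambda>x \<xi>. cnj (g x) * (of_real (?E h \<xi>) * iexp (x \<bullet> \<xi>) * fourier g \<xi>)"
    have i: "integrable (lborel \<Otimes>\<^sub>M lborel) (case_prod ?F)"
      by (rule integrable_product_bound[OF integrable_cnj[OF g] iEF]) (auto simp: norm_mult)
    have cnjF: "(LBINT x. iexp (x \<bullet> \<xi>) * cnj (g x)) = cnj (fourier g \<xi>) / of_real fconst" for \<xi>
    proof -
      have "cnj (LBINT x. iexp (- (x \<bullet> \<xi>)) * g x) = (LBINT x. cnj (iexp (- (x \<bullet> \<xi>)) * g x))"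
        by (rule Bochner_Integration.integral_cnj[symmetric])
      then have "cnj (fourier g \<xi>) = of_real fconst * (LBINT x. cnj (iexp (- (x \<bullet> \<xi>)) * g x))"
        unfolding fourier_alt complex_cnj_mult[of "of_real fconst"] complex_cnj_complex_of_real by (rule arg_cong)
      also have "\<dots> = of_real fconst * (LBINT x. iexp (x \<bullet> \<xi>) * cnj (g x))"
        by (simp add: exp_cnj)
      finally show ?thesis using fconst_pos by simp
    qed
    have "(LBINT x. cnj (g x) * (LBINT y. of_real (heat h x y) * g y)) =
      of_real fconst * (LBINT x. LBINT \<xi>. ?F x \<xi>)"
      unfolding heat_fourier[OF h g] integral_mult_right_zero[symmetric] by (simp add: mult_ac)
    also have "(LBINT x. LBINT \<xi>. ?F x \<xi>) = (LBINT \<xi>. LBINT x. ?F x \<xi>)"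
      using lborel_pair.Fubini_integral[OF i] by simp
    also have "\<dots> = (LBINT \<xi>. of_real (?E h \<xi>) * fourier g \<xi> * (LBINT x. iexp (x \<bullet> \<xi>) * cnj (g x)))"
      unfolding integral_mult_right_zero[symmetric] by (simp add: mult_ac)
    also have "of_real fconst * \<dots> = (LBINT \<xi>. complex_of_real (?E h \<xi> * (norm (fourier g \<xi>))\<^sup>2))"
      unfolding cnjF integral_mult_right_zero[symmetric] using fconst_pos
      by (intro Bochner_Integration.integral_cong refl) (simp add: complex_norm_square[symmetric] mult.assoc)
    finally have e: "(LBINT x. cnj (g x) * (LBINT y. of_real (heat h x y) * g y)) =
      complex_of_real (LBINT \<xi>. ?E h \<xi> * (norm (fourier g \<xi>))\<^sup>2)"
      unfolding integral_complex_of_real .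
    have i2: "integrable lborel (\<lambda>\<xi>. ?E h \<xi> * (norm (fourier g \<xi>))\<^sup>2)"
    proof (rule Bochner_Integration.integrable_bound[OF integrable_mult_left[OF iEF, of "of_real M"]])
      show "AE \<xi> in lborel. norm (?E h \<xi> * (norm (fourier g \<xi>))\<^sup>2) \<le> norm (of_real (?E h \<xi>) * fourier g \<xi> * of_real M)"
        using M by (intro AE_I2) (auto simp: norm_mult power2_eq_square abs_mult mult.assoc
            intro!: mult_left_mono order_trans[OF M abs_ge_self])
    qed measurable
    let ?k = "\<lambda>x y. heat h x y"
    have ih: "integrable lborel (\<lambda>x. complex_of_real (heat h 0 x))" using integrable_heat[OF h] by simp
    have ig: "integrable lborel (\<lambda>x. complex_of_real ((norm (g x))\<^sup>2))" 
      by (rule integrable_of_real[OF L2_integrable[OF gL]])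
    have j1: "integrable (lborel \<Otimes>\<^sub>M lborel) (\<lambda>(x, y). complex_of_real (?k x y * (norm (g x))\<^sup>2))"
      using integrable_convolution(1)[OF ih ig] by (simp only: of_real_mult heat_diff[of h, symmetric])
    have j2: "integrable (lborel \<Otimes>\<^sub>M lborel) (\<lambda>(x, y). complex_of_real (?k x y * (norm (g y))\<^sup>2))"
      using integrable_convolution(2)[OF ih ig] by (simp only: of_real_mult heat_diff[of h, symmetric])
    have j1': "integrable (lborel \<Otimes>\<^sub>M lborel) (\<lambda>(x, y). ?k x y * (norm (g x))\<^sup>2)"
      using integrable_Re[OF j1] by (simp add: case_prod_unfold)
    have j2': "integrable (lborel \<Otimes>\<^sub>M lborel) (\<lambda>(x, y). ?k x y * (norm (g y))\<^sup>2)"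
      using integrable_Re[OF j2] by (simp add: case_prod_unfold)
    have v1: "(LINT p|(lborel \<Otimes>\<^sub>M lborel). (case p of (x, y) \<Rightarrow> ?k x y * (norm (g x))\<^sup>2)) = C"
      unfolding lborel_pair.integral_fst'[OF j1', symmetric] by (simp add: integral_heat[OF h] C_def)
    have v2: "(LINT p|(lborel \<Otimes>\<^sub>M lborel). (case p of (x, y) \<Rightarrow> ?k x y * (norm (g y))\<^sup>2)) = C"
      using lborel_pair.integral_snd[of "\<lambda>x y. ?k x y * (norm (g y))\<^sup>2", OF j2'] by (simp add: integral_heat[OF h] C_def)
    \<comment> \<open>The Schur estimate: \<open>2 |g x| |g y| \<le> |g x|^2 + |g y|^2\<close>, and
      each of the two terms integrates to \<open>C\<close> because the kernel has mass one in either
      variable.\<close>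
    have le: "norm (cnj (g x) * (of_real (?k x y) * g y)) \<le> (?k x y * (norm (g x))\<^sup>2 + ?k x y * (norm (g y))\<^sup>2) / 2" for x y
    proof -
      have "norm (cnj (g x) * (of_real (?k x y) * g y)) = ?k x y * (2 * norm (g x) * norm (g y)) / 2"
        using heat_nonneg[OF h, of x y] by (simp add: norm_mult)
      also have "\<dots> \<le> ?k x y * ((norm (g x))\<^sup>2 + (norm (g y))\<^sup>2) / 2"
        using heat_nonneg[OF h, of x y] by (intro divide_right_mono mult_left_mono sum_squares_bound) auto
      finally show ?thesis by (simp add: distrib_left)
    qed
    let ?G = "\<lambda>(x, y). cnj (g x) * (of_real (?k x y) * g y)"
    let ?D = "\<lambda>p. ((case p of (x, y) \<Rightarrow> ?k x y * (norm (g x))\<^sup>2) + (case p of (x, y) \<Rightarrow> ?k x y * (norm (g y))\<^sup>2)) / 2"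
    have iD: "integrable (lborel \<Otimes>\<^sub>M lborel) ?D" by (intro integrable_divide Bochner_Integration.integrable_add j1' j2')
    have leD: "norm (?G p) \<le> ?D p" for p using le by (cases p) simp
    have iG: "integrable (lborel \<Otimes>\<^sub>M lborel) ?G"
    proof (rule Bochner_Integration.integrable_bound[OF iD])
      show "AE p in lborel \<Otimes>\<^sub>M lborel. norm (?G p) \<le> norm (?D p)"
        by (intro AE_I2 order_trans[OF leD]) (simp only: real_norm_def abs_ge_self)
    qed measurable
    have "(LBINT \<xi>. ?E h \<xi> * (norm (fourier g \<xi>))\<^sup>2) \<le> norm (complex_of_real (LBINT \<xi>. ?E h \<xi> * (norm (fourier g \<xi>))\<^sup>2))"
      by simp
    also have "\<dots> = norm (LINT p|(lborel \<Otimes>\<^sub>M lborel). ?G p)"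
      unfolding e[symmetric] lborel_pair.integral_fst'[OF iG, symmetric] by (simp add: integral_mult_right_zero)
    also have "\<dots> \<le> (LINT p|(lborel \<Otimes>\<^sub>M lborel). norm (?G p))" by (rule integral_norm_bound)
    also have "\<dots> \<le> (LINT p|(lborel \<Otimes>\<^sub>M lborel). ?D p)"
      by (intro integral_mono integrable_norm iG iD leD)
    also have "\<dots> = C" using j1' j2' by (simp add: v1 v2)
    finally show ?thesis using i2 by blast
  qed
  define h where "h n = 1 / real (Suc n)" for n
  have h: "h n > 0" for n unfolding h_def by simp
  have lim: "(\<lambda>n. ?E (h n) \<xi> * (norm (fourier g \<xi>))\<^sup>2) \<longlonglongrightarrow> (norm (fourier g \<xi>))\<^sup>2" for \<xi>
  proof -
    have "(\<lambda>n. ?E (h n) \<xi> * (norm (fourier g \<xi>))\<^sup>2) \<longlonglongrightarrow> ?E 0 \<xi> * (norm (fourier g \<xi>))\<^sup>2"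
      unfolding h_def by (intro tendsto_intros LIMSEQ_Suc[OF lim_1_over_n]) auto
    then show ?thesis by simp
  qed
  have *: "integrable lborel (\<lambda>\<xi>. (norm (fourier g \<xi>))\<^sup>2)" "(LBINT \<xi>. (norm (fourier g \<xi>))\<^sup>2) \<le> C"
    by (rule Fatou_bound[where q = "\<lambda>n \<xi>. ?E (h n) \<xi> * (norm (fourier g \<xi>))\<^sup>2" and C = C];
        use main[OF h] lim in auto)+
  show "fourier g \<in> L2" unfolding L2_iff using *(1) by simp
  show "(LBINT \<xi>. (norm (fourier g \<xi>))\<^sup>2) \<le> (LBINT x. (norm (g x))\<^sup>2)" using *(2) unfolding C_def .
qed

text \<open>The transform of \<open>h\<close> is the almost everywhere limit of the transforms of truncations of \<open>h\<close> to balls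
  whose radii are chosen so that the tails decay geometrically.\<close>

theorem L2_fourier_exists:
  assumes h: "h \<in> L2" shows "\<exists>H. L2_fourier h H"
proof -
  have [measurable]: "h \<in> borel_measurable borel" using h by measurable
  define tail where "tail r = (LBINT x. indicator (- cball 0 r) x * (norm (h x))\<^sup>2)" for r :: real
  have tail0: "(\<lambda>n. tail (real n)) \<longlonglongrightarrow> (LINT x|(lborel :: (real^3) measure). 0)"
    unfolding tail_def
  proof (rule integral_dominated_convergence[where w = "\<lambda>x. (norm (h x))\<^sup>2"])
    show "AE x in lborel. (\<lambda>n. indicator (- cball 0 (real n)) x * (norm (h x))\<^sup>2) \<longlonglongrightarrow> 0"
    proof (intro AE_I2 tendsto_eventually)
      fix x :: "real^3"
      obtain N where N: "norm x \<le> real N" using real_arch_simple by blast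
      show "\<forall>\<^sub>F n in sequentially. indicator (- cball 0 (real n)) x * (norm (h x))\<^sup>2 = 0"
        unfolding eventually_sequentially by (rule exI[of _ N]) (use N in \<open>auto simp: indicator_def\<close>)
    qed
  qed (use L2_integrable[OF h] in \<open>auto simp: indicator_def\<close>)
  \<comment> \<open>The ratio 1/4 leaves room for the weights \<open>2^n\<close> that are put on the
    increments below.\<close>
  have "\<exists>r. tail r \<le> (1/4) ^ n \<and> r \<ge> 0" for n :: nat
  proof -
    have "\<forall>\<^sub>F k in sequentially. tail (real k) < (1/4) ^ n"
      using tail0 by (intro order_tendstoD(2)) (auto)
    then obtain k where "tail (real k) < (1/4) ^ n" using eventually_sequentially by auto
    then show ?thesis by (intro exI[of _ "real k"]) auto
  qed
  then obtain r where r: "\<And>n. tail (r n) \<le> (1/4) ^ n" by metis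
  define cut where "cut n x = indicator (cball 0 (r n)) x *\<^sub>R h x" for n and x :: "real^3"
  have [measurable]: "cut n \<in> borel_measurable borel" for n
    unfolding cut_def by (intro borel_measurable_scaleR borel_measurable_indicator borel_closed closed_cball) measurable
  have cutL: "cut n \<in> L2" for n
    by (rule L2_bound[OF h, where c = 1]) (auto simp: cut_def indicator_def)
  have cuti: "integrable lborel (cut n)" for n
  proof (rule Bochner_Integration.integrable_bound)
    show "integrable lborel (\<lambda>x. indicator (cball 0 (r n)) x + (norm (h x))\<^sup>2)"
      by (intro Bochner_Integration.integrable_add L2_integrable[OF h] integrable_real_indicator)
        (use emeasure_lborel_cball_finite[of "0 :: real^3" "r n"] in auto)
    have "a \<le> 1 + a\<^sup>2" for a :: real using zero_le_power2[of "a - 1"] zero_le_power2[of a] unfolding power2_diff power_one mult_1_right by linarith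
    then show "AE x in lborel. norm (cut n x) \<le> norm (indicator (cball 0 (r n)) x + (norm (h x))\<^sup>2)"
      unfolding cut_def by (auto simp: indicator_def)
  qed measurable
  define F where "F n = fourier (cut n)" for n
  have FL: "F n \<in> L2" for n unfolding F_def by (rule fourier_Bessel_inequality[OF cuti cutL])
  have [measurable]: "F n \<in> borel_measurable borel" for n using FL by measurable
  have it: "integrable lborel (\<lambda>x. indicator (- cball 0 (r n)) x * (norm (h x))\<^sup>2)" for n
    using integrable_real_mult_indicator[OF _ L2_integrable[OF h], of "- cball 0 (r n)"] by (simp add: mult.commute)
  have FF: "(LBINT \<xi>. (norm (F m \<xi> - F n \<xi>))\<^sup>2) \<le> (1/4) ^ m + (1/4) ^ n" for m n
  proof -
    have "F m \<xi> - F n \<xi> = fourier (\<lambda>x. cut m x - cut n x) \<xi>" for \<xi>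
      using fourier_add[OF cuti[of m] integrable_mult_right[OF cuti[of n], of "-1"]] fourier_cmult[of "-1" "cut n"]
      unfolding F_def by simp
    then have "(LBINT \<xi>. (norm (F m \<xi> - F n \<xi>))\<^sup>2) \<le> (LBINT x. (norm (cut m x - cut n x))\<^sup>2)"
      using fourier_Bessel_inequality(2)[of "\<lambda>x. cut m x - cut n x"] cuti cutL by (simp add: L2_diff)
    also have "\<dots> \<le> (LBINT x. indicator (- cball 0 (r m)) x * (norm (h x))\<^sup>2 + indicator (- cball 0 (r n)) x * (norm (h x))\<^sup>2)"
      by (intro integral_mono L2_integrable[OF L2_diff[OF cutL cutL]] Bochner_Integration.integrable_add it)
        (auto simp: cut_def indicator_def)
    also have "\<dots> = tail (r m) + tail (r n)" unfolding tail_def using it by simp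
    finally show ?thesis using r[of m] r[of n] by linarith
  qed
  \<comment> \<open>The squared norm of \<open>d n\<close> is at most \<open>2 / 4^n\<close>, so the
    squares weighted by \<open>2^n\<close> still have a finite integral in total. Their sum is then
    finite almost everywhere, and \<open>a \<le> 2^-n + 2^n a^2\<close> gives absolute convergence
    of the increments.\<close>
  define d where "d n \<xi> = F (Suc n) \<xi> - F n \<xi>" for n \<xi>
  have [measurable]: "d n \<in> borel_measurable borel" for n unfolding d_def by measurable
  have "(\<integral>\<^sup>+\<xi>. (\<Sum>n. ennreal (2 ^ n * (norm (d n \<xi>))\<^sup>2)) \<partial>lborel) = (\<Sum>n. \<integral>\<^sup>+\<xi>. ennreal (2 ^ n * (norm (d n \<xi>))\<^sup>2) \<partial>lborel)"
    by (rule nn_integral_suminf) measurable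
  also have "\<dots> \<le> (\<Sum>n. ennreal (2 * (1/2) ^ n))"
  proof (rule suminf_le)
    fix n
    have i: "integrable lborel (\<lambda>\<xi>. 2 ^ n * (norm (d n \<xi>))\<^sup>2)" unfolding d_def
      by (intro integrable_mult_right L2_integrable L2_diff FL)
    have "(LBINT \<xi>. 2 ^ n * (norm (d n \<xi>))\<^sup>2) \<le> 2 ^ n * ((1/4) ^ Suc n + (1/4) ^ n)"
      unfolding integral_mult_right_zero d_def using FF[of "Suc n" n] by (intro mult_left_mono) auto
    also have "\<dots> \<le> 2 ^ n * (2 * (1/4) ^ n)" by (intro mult_left_mono) auto
    also have "\<dots> = 2 * (1/2) ^ n" by (simp add: power_divide field_simps flip: power_mult_distrib)
    finally show "(\<integral>\<^sup>+\<xi>. ennreal (2 ^ n * (norm (d n \<xi>))\<^sup>2) \<partial>lborel) \<le> ennreal (2 * (1/2) ^ n)"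
      using i by (simp add: nn_integral_eq_integral ennreal_leI)
  qed auto
  also have "\<dots> = ennreal (\<Sum>n. 2 * (1/2) ^ n)"
    by (rule suminf_ennreal2) (auto intro!: summable_mult summable_geometric)
  also have "\<dots> < \<infinity>" by simp
  finally have "AE \<xi> in lborel. (\<Sum>n. ennreal (2 ^ n * (norm (d n \<xi>))\<^sup>2)) \<noteq> \<infinity>"
    by (intro nn_integral_PInf_AE) auto
  then have conv: "AE \<xi> in lborel. (\<lambda>n. F n \<xi>) \<longlonglongrightarrow> lim (\<lambda>n. F n \<xi>)"
  proof eventually_elim
    fix \<xi> assume "(\<Sum>n. ennreal (2 ^ n * (norm (d n \<xi>))\<^sup>2)) \<noteq> \<infinity>"
    then have s: "summable (\<lambda>n. 2 ^ n * (norm (d n \<xi>))\<^sup>2)" by (intro summable_suminf_not_top) auto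
    have "summable (\<lambda>n. norm (d n \<xi>))"
    proof (rule summable_comparison_test')
      show "summable (\<lambda>n. (1/2) ^ n + 2 ^ n * (norm (d n \<xi>))\<^sup>2)" by (intro summable_add s summable_geometric) simp
      show "norm (norm (d n \<xi>)) \<le> (1/2) ^ n + 2 ^ n * (norm (d n \<xi>))\<^sup>2" for n
      proof -
        define a where "a = norm (d n \<xi>)"
        have "2 ^ n * a \<le> 1 + (2 ^ n * a)\<^sup>2"
          using zero_le_power2[of "2 ^ n * a - 1"] zero_le_power2[of "2 ^ n * a"] unfolding power2_diff power_one mult_1_right by linarith
        then have "(1/2) ^ n * (2 ^ n * a) \<le> (1/2) ^ n * (1 + (2 ^ n * a)\<^sup>2)" by (intro mult_left_mono) auto
        then show ?thesis unfolding a_def[symmetric]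
          by (simp add: a_def power2_eq_square power_one_over field_simps)
      qed
    qed
    then have "summable (\<lambda>n. d n \<xi>)" by (rule summable_norm_cancel)
    then have "convergent (\<lambda>n. \<Sum>k<n. d k \<xi>)" by (simp add: summable_iff_convergent)
    moreover have "(\<Sum>k<n. d k \<xi>) = F n \<xi> - F 0 \<xi>" for n unfolding d_def by (rule sum_lessThan_telescope)
    ultimately have "convergent (\<lambda>n. F n \<xi> - F 0 \<xi> + F 0 \<xi>)" by (intro convergent_add convergent_const) simp
    then show "(\<lambda>n. F n \<xi>) \<longlonglongrightarrow> lim (\<lambda>n. F n \<xi>)" by (simp add: convergent_LIMSEQ_iff)
  qed
  define H where "H \<xi> = lim (\<lambda>n. F n \<xi>)" for \<xi>
  have [measurable]: "H \<in> borel_measurable borel" unfolding H_def by measurable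
  \<comment> \<open>Fatou in the index \<open>m\<close>, with \<open>n\<close> held fixed, transfers
    the Cauchy estimate to the pointwise limit.\<close>
  have HF: "integrable lborel (\<lambda>\<xi>. (norm (H \<xi> - F n \<xi>))\<^sup>2) \<and> (LBINT \<xi>. (norm (H \<xi> - F n \<xi>))\<^sup>2) \<le> 2 * (1/4) ^ n" for n
  proof -
    have "AE \<xi> in lborel. (\<lambda>m. (norm (F (m + n) \<xi> - F n \<xi>))\<^sup>2) \<longlonglongrightarrow> (norm (H \<xi> - F n \<xi>))\<^sup>2"
      using conv unfolding H_def by eventually_elim (intro tendsto_intros LIMSEQ_ignore_initial_segment)
    moreover have "(LBINT \<xi>. (norm (F (m + n) \<xi> - F n \<xi>))\<^sup>2) \<le> 2 * (1/4) ^ n" for m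
    proof -
      have "(1/4::real) ^ (m + n) \<le> (1/4) ^ n" by (intro power_decreasing) auto
      then show ?thesis using FF[of "m + n" n] by linarith
    qed
    ultimately show ?thesis
      using Fatou_bound[of lborel "\<lambda>m \<xi>. (norm (F (m + n) \<xi> - F n \<xi>))\<^sup>2" "\<lambda>\<xi>. (norm (H \<xi> - F n \<xi>))\<^sup>2" "2 * (1/4) ^ n"]
        L2_integrable[OF L2_diff[OF FL FL]] by simp
  qed
  have HFL: "(\<lambda>\<xi>. H \<xi> - F n \<xi>) \<in> L2" for n unfolding L2_iff using HF[of n] by simp
  have HL: "H \<in> L2" using L2_add[OF HFL[of 0] FL[of 0]] by simp
  \<comment> \<open>For the integrable truncations the identity is the multiplication formula. Both
    sides are continuous in L^2, so it survives the limit.\<close>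
  have "(LBINT x. h x * fourier \<phi> x) = (LBINT \<xi>. H \<xi> * \<phi> \<xi>)" if \<phi>: "\<phi> \<in> schwartz" for \<phi>
  proof -
    have \<phi>L: "\<phi> \<in> L2" "fourier \<phi> \<in> L2" using \<phi> by (auto intro: schwartz_L2w schwartz_fourier)
    note int = tempered_schwartz_integrable[OF L2_tempered]
    have "(\<lambda>n. LBINT \<xi>. (H \<xi> - F n \<xi>) * \<phi> \<xi>) \<longlonglongrightarrow> 0"
    proof (rule L2_pairing_tendsto[OF HFL _ \<phi>L(1)], rule tendsto_sandwich[OF _ _ tendsto_const])
      show "\<forall>\<^sub>F n in sequentially. (LBINT \<xi>. (norm (H \<xi> - F n \<xi>))\<^sup>2) \<le> 2 * (1/4) ^ n" using HF by simp
      show "(\<lambda>n. 2 * (1/4::real) ^ n) \<longlonglongrightarrow> 0" by (auto intro!: tendsto_eq_intros LIMSEQ_power_zero)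
    qed simp
    moreover have "(LBINT \<xi>. (H \<xi> - F n \<xi>) * \<phi> \<xi>) = (LBINT \<xi>. H \<xi> * \<phi> \<xi>) - (LBINT \<xi>. F n \<xi> * \<phi> \<xi>)" for n
      unfolding left_diff_distrib by (intro Bochner_Integration.integral_diff int HL FL \<phi>)
    ultimately have l1: "(\<lambda>n. (LBINT \<xi>. H \<xi> * \<phi> \<xi>) - (LBINT \<xi>. F n \<xi> * \<phi> \<xi>)) \<longlonglongrightarrow> 0" by simp
    have hcut: "(norm (h x - cut n x))\<^sup>2 = indicator (- cball 0 (r n)) x * (norm (h x))\<^sup>2" for n x
      by (auto simp: cut_def indicator_def)
    have "(\<lambda>n. LBINT x. (h x - cut n x) * fourier \<phi> x) \<longlonglongrightarrow> 0"
    proof (rule L2_pairing_tendsto[OF L2_diff[OF h cutL] _ \<phi>L(2)], rule tendsto_sandwich[OF _ _ tendsto_const])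
      show "\<forall>\<^sub>F n in sequentially. (LBINT x. (norm (h x - cut n x))\<^sup>2) \<le> (1/4) ^ n"
        unfolding hcut tail_def[symmetric] using r by simp
      show "(\<lambda>n. (1/4::real) ^ n) \<longlonglongrightarrow> 0" by (auto intro!: LIMSEQ_power_zero)
    qed simp
    moreover have "(LBINT x. (h x - cut n x) * fourier \<phi> x) = (LBINT x. h x * fourier \<phi> x) - (LBINT x. cut n x * fourier \<phi> x)" for n
      unfolding left_diff_distrib by (intro Bochner_Integration.integral_diff int h cutL schwartz_fourier \<phi>)
    moreover have "(LBINT x. cut n x * fourier \<phi> x) = (LBINT \<xi>. F n \<xi> * \<phi> \<xi>)" for n
      unfolding F_def by (rule fourier_multiplication[OF cuti schwartz_integrable[OF \<phi>]])
    ultimately have l2: "(\<lambda>n. (LBINT x. h x * fourier \<phi> x) - (LBINT \<xi>. F n \<xi> * \<phi> \<xi>)) \<longlonglongrightarrow> 0" by simp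
    from tendsto_diff[OF l2 l1] show ?thesis by (simp add: LIMSEQ_const_iff)
  qed
  then show ?thesis using h HL unfolding L2_fourier_def by blast
qed

lemma L2_fourierD:
  assumes "L2_fourier f F"
  shows "f \<in> L2" "F \<in> L2" "\<phi> \<in> schwartz \<Longrightarrow> (LBINT x. f x * fourier \<phi> x) = (LBINT \<xi>. F \<xi> * \<phi> \<xi>)"
  using assms unfolding L2_fourier_def by auto

lemma L2_fourier_unique:
  assumes "L2_fourier f F" "L2_fourier f G" shows "AE \<xi> in lborel. F \<xi> = G \<xi>"
  using assms by (intro tempered_AE_eq L2_tempered L2_fourierD(2)) (simp_all add: L2_fourierD(3)[symmetric])

text \<open>By inversion every Schwartz function is the transform of one, so transforms are enough
  as test functions.\<close>

lemma tempered_AE_eq_fourier: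
  assumes f: "tempered f" and g: "tempered g"
    and e: "\<And>\<phi>. \<phi> \<in> schwartz \<Longrightarrow> (LBINT x. f x * fourier \<phi> x) = (LBINT x. g x * fourier \<phi> x)"
  shows "AE x in lborel. f x = g x"
proof (rule tempered_AE_eq[OF f g])
  fix \<phi> assume "\<phi> \<in> schwartz"
  then show "(LBINT x. f x * \<phi> x) = (LBINT x. g x * \<phi> x)"
    using e[OF schwartz_fourier_inv] fourier_inversion' by metis
qed

lemma L2_reflect: assumes f: "f \<in> L2" shows "(\<lambda>x. f (- x)) \<in> L2"
proof -
  have [measurable]: "f \<in> borel_measurable borel" using f by measurable
  show ?thesis unfolding L2_iff using integrable_reflect[OF L2_integrable[OF f]] by simp
qed

text \<open>The transform applied twice is reflection, so the transform of the reflected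
  \<open>F\<close> is a preimage of \<open>F\<close>.\<close>

lemma L2_fourier_inverse_exists:
  assumes F: "F \<in> L2" shows "\<exists>f. L2_fourier f F"
proof -
  have [measurable]: "F \<in> borel_measurable borel" using F by measurable
  obtain f where f: "L2_fourier (\<lambda>x. F (- x)) f" using L2_fourier_exists[OF L2_reflect[OF F]] by blast
  have "(LBINT x. f x * fourier \<phi> x) = (LBINT \<xi>. F \<xi> * \<phi> \<xi>)" if \<phi>: "\<phi> \<in> schwartz" for \<phi>
  proof -
    have [measurable]: "\<phi> \<in> borel_measurable borel" using \<phi> by measurable
    have "(LBINT x. f x * fourier \<phi> x) = (LBINT x. F (- x) * fourier (fourier \<phi>) x)"
      using L2_fourierD(3)[OF f schwartz_fourier[OF \<phi>]] by simp
    also have "\<dots> = (LBINT x. F (- x) * \<phi> (- x))"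
    proof -
      have "fourier (fourier \<phi>) x = fourier_inv (fourier \<phi>) (- x)" for x by (simp add: fourier_inv_eq)
      then show ?thesis by (simp add: fourier_inversion[OF \<phi>])
    qed
    also have "\<dots> = (LBINT \<xi>. F \<xi> * \<phi> \<xi>)" by (rule integral_reflect) measurable
    finally show ?thesis .
  qed
  then show ?thesis using F L2_fourierD(2)[OF f] unfolding L2_fourier_def by blast
qed

lemma L2_fourier_cong_AE:
  assumes f: "L2_fourier f F" and [measurable]: "g \<in> borel_measurable borel" and e: "AE x in lborel. f x = g x"
  shows "L2_fourier g F"
  unfolding L2_fourier_def
proof (intro conjI ballI)
  have [measurable]: "f \<in> borel_measurable borel" using L2_fourierD(1)[OF f] by measurable
  have "integrable lborel (\<lambda>x. (norm (f x))\<^sup>2) \<longleftrightarrow> integrable lborel (\<lambda>x. (norm (g x))\<^sup>2)"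
    by (intro integrable_cong_AE) (use e in auto)
  then show "g \<in> L2" using L2_fourierD(1)[OF f] by (simp add: L2_iff)
  show "F \<in> L2" using f by (rule L2_fourierD)
  fix \<phi> assume \<phi>: "\<phi> \<in> schwartz"
  have [measurable]: "\<phi> \<in> borel_measurable borel" using \<phi> by measurable
  have "(LBINT x. g x * fourier \<phi> x) = (LBINT x. f x * fourier \<phi> x)"
    by (intro integral_cong_AE) (use e in auto)
  then show "(LBINT x. g x * fourier \<phi> x) = (LBINT x. F x * \<phi> x)"
    using L2_fourierD(3)[OF f \<phi>] by simp
qed

section \<open>The resolvent of \<open>H\<^sub>0\<close>\<close>

lemma fourier_inv_bessel:
  assumes \<phi>: "\<phi> \<in> schwartz"
  shows "fourier_inv (bessel_schwartz \<phi>) \<xi> = of_real (jbr \<xi>) * fourier_inv \<phi> \<xi>"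
proof -
  let ?g = "\<lambda>\<xi>. of_real (jbr \<xi>) * fourier \<phi> \<xi>"
  have g: "?g \<in> schwartz" by (intro schwartz_symb_mult symb.jbr schwartz_fourier \<phi>)
  have "fourier_inv (bessel_schwartz \<phi>) \<xi> = fourier (fourier_inv ?g) (- \<xi>)"
    unfolding bessel_schwartz_def by (simp add: fourier_inv_eq)
  also have "\<dots> = ?g (- \<xi>)" unfolding fourier_inversion'[OF g] ..
  finally show ?thesis by (simp add: fourier_inv_eq)
qed

text \<open>Membership in \<open>H1w 0\<close> only says that \<open>f\<close> is tempered and that
  \<open>(1 - \<Delta>)^(1/2) f\<close> is some \<open>h\<close> in L^2. Dividing the transform of
  \<open>h\<close> by \<open>jbr\<close> yields an L^2 function \<open>f'\<close>, which agrees with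
  \<open>f\<close> when tested against \<open>bessel_schwartz \<phi>\<close>, hence against every
  Schwartz function.\<close>

lemma H1w_0_fourier:
  assumes f: "f \<in> H1w 0"
  shows "\<exists>F. L2_fourier f F \<and> (\<lambda>\<xi>. of_real (norm \<xi>) * F \<xi>) \<in> L2"
proof -
  obtain h where t: "tempered f" and h: "h \<in> L2" "bessel_eq f h" using f unfolding H1w_def by auto
  obtain H where H: "L2_fourier h H" using L2_fourier_exists[OF h(1)] by blast
  have HL: "H \<in> L2" using H by (rule L2_fourierD)
  then have [measurable]: "H \<in> borel_measurable borel" by measurable
  define F where "F \<xi> = H \<xi> / of_real (jbr \<xi>)" for \<xi>
  have FL: "F \<in> L2"
  proof (rule L2_bound[OF HL, where c = 1])
    show "norm (F \<xi>) \<le> 1 * norm (H \<xi>)" for \<xi>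
      using mult_left_mono[OF jbr_ge1[of \<xi>] norm_ge_zero[of "H \<xi>"]] unfolding F_def by (simp add: norm_divide divide_le_eq)
  qed (unfold F_def, measurable)
  have nFL: "(\<lambda>\<xi>. of_real (norm \<xi>) * F \<xi>) \<in> L2"
  proof (rule L2_bound[OF HL, where c = 1])
    show "norm (of_real (norm \<xi>) * F \<xi>) \<le> 1 * norm (H \<xi>)" for \<xi>
    proof -
      have "norm \<xi> * norm (H \<xi>) \<le> jbr \<xi> * norm (H \<xi>)" by (intro mult_right_mono norm_le_jbr) simp
      then show ?thesis unfolding F_def by (simp add: norm_mult norm_divide divide_le_eq mult.commute)
    qed
  qed (unfold F_def, measurable)
  obtain f' where f': "L2_fourier f' F" using L2_fourier_inverse_exists[OF FL] by blast
  have "AE x in lborel. f' x = f x"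
  proof (rule tempered_AE_eq[OF L2_tempered[OF L2_fourierD(1)[OF f']] t])
    fix \<psi> assume \<psi>: "\<psi> \<in> schwartz"
    obtain \<phi> where \<phi>: "\<phi> \<in> schwartz" "bessel_schwartz \<phi> = \<psi>" using bessel_surj[OF \<psi>] by blast
    have "(LBINT x. f' x * \<psi> x) = (LBINT \<xi>. F \<xi> * fourier_inv \<psi> \<xi>)"
      using L2_fourierD(3)[OF f' schwartz_fourier_inv[OF \<psi>]] fourier_inversion'[OF \<psi>] by simp
    also have "\<dots> = (LBINT \<xi>. H \<xi> * fourier_inv \<phi> \<xi>)"
      unfolding \<phi>(2)[symmetric] fourier_inv_bessel[OF \<phi>(1)] F_def by simp
    also have "\<dots> = (LBINT x. h x * \<phi> x)"
      using L2_fourierD(3)[OF H schwartz_fourier_inv[OF \<phi>(1)]] fourier_inversion'[OF \<phi>(1)] by simp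
    also have "\<dots> = (LBINT x. f x * \<psi> x)"
      using h(2) \<phi> unfolding bessel_eq_def by metis
    finally show "(LBINT x. f' x * \<psi> x) = (LBINT x. f x * \<psi> x)" .
  qed
  from L2_fourier_cong_AE[OF f' _ this] t have "L2_fourier f F" by measurable
  with nFL show ?thesis by blast
qed

text \<open>The point is that one and the same \<open>F\<close> serves for \<open>f\<close> and for
  \<open>H0 f\<close>.\<close>

lemma H0_spec:
  assumes "f \<in> H1w 0"
  shows "\<exists>F. L2_fourier f F \<and> L2_fourier (H0 f) (\<lambda>\<xi>. of_real (norm \<xi>) * F \<xi>)"
proof -
  obtain F where F: "L2_fourier f F" "(\<lambda>\<xi>. of_real (norm \<xi>) * F \<xi>) \<in> L2" using H1w_0_fourier[OF assms] by blast
  then have "\<exists>w F. L2_fourier f F \<and> L2_fourier w (\<lambda>\<xi>. of_real (norm \<xi>) * F \<xi>)"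
    using L2_fourier_inverse_exists[OF F(2)] by blast
  from someI_ex[OF this] show ?thesis unfolding H0_def .
qed

text \<open>Off the real axis the denominator has absolute value at least \<open>|Im z|\<close>. The
  factor \<open>jbr\<close> is what puts the solution of the resolvent equation into
  \<open>H1w 0\<close>.\<close>

lemma L2_jbr_resolvent:
  assumes u: "u \<in> schwartz" and z: "Im z \<noteq> 0"
  shows "(\<lambda>\<xi>. of_real (jbr \<xi>) * (fourier u \<xi> / (of_real (norm \<xi>) - z))) \<in> L2"
proof (rule L2_bound[where g = "\<lambda>\<xi>. of_real (jbr \<xi>) * fourier u \<xi>" and c = "1 / \<bar>Im z\<bar>"])
  show "(\<lambda>\<xi>. of_real (jbr \<xi>) * fourier u \<xi>) \<in> L2"
    by (intro schwartz_L2w schwartz_symb_mult symb.jbr schwartz_fourier u)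
  have [measurable]: "u \<in> borel_measurable borel" using u by measurable
  show "(\<lambda>\<xi>. of_real (jbr \<xi>) * (fourier u \<xi> / (of_real (norm \<xi>) - z))) \<in> borel_measurable borel" by measurable
  have "\<bar>Im z\<bar> \<le> norm (of_real r - z)" for r using abs_Im_le_cmod[of "of_real r - z"] by simp
  then have "norm (of_real (jbr \<xi>) * fourier u \<xi>) / norm (of_real (norm \<xi>) - z) \<le> norm (of_real (jbr \<xi>) * fourier u \<xi>) / \<bar>Im z\<bar>" for \<xi>
    using z by (intro divide_left_mono mult_pos_pos) (auto intro: less_le_trans[of 0 "\<bar>Im z\<bar>"])
  then show "norm (of_real (jbr \<xi>) * (fourier u \<xi> / (of_real (norm \<xi>) - z))) \<le> 1 / \<bar>Im z\<bar> * norm (of_real (jbr \<xi>) * fourier u \<xi>)" for \<xi>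
    by (simp add: norm_mult norm_divide)
qed

text \<open>\<open>R0\<close> picks some solution, so a solution has to be produced to justify the
  choice. For the chosen one the equation reads \<open>(|\<xi>| - z) G = fourier u\<close> in
  frequency, which fixes its transform \<open>G\<close> almost everywhere.\<close>

theorem R0_fourier:
  assumes u: "u \<in> schwartz" and z: "Im z \<noteq> 0"
  shows "L2_fourier (R0 z u) (\<lambda>\<xi>. fourier u \<xi> / (of_real (norm \<xi>) - z))"
proof -
  have nz: "of_real r \<noteq> z" for r using z by auto
  have [measurable]: "u \<in> borel_measurable borel" using u by measurable
  have uL: "u \<in> L2" using u by (rule schwartz_L2w)
  have \<phi>m: "\<phi> \<in> borel_measurable borel" if "\<phi> \<in> schwartz" for \<phi> using that by measurable
  note int = tempered_schwartz_integrable[OF L2_tempered]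
  let ?F = "\<lambda>\<xi>. fourier u \<xi> / (of_real (norm \<xi>) - z)"
  have JL: "(\<lambda>\<xi>. of_real (jbr \<xi>) * ?F \<xi>) \<in> L2" by (rule L2_jbr_resolvent[OF u z])
  have FL: "?F \<in> L2"
  proof (rule L2_bound[OF JL, where c = 1])
    show "norm (?F \<xi>) \<le> 1 * norm (of_real (jbr \<xi>) * ?F \<xi>)" for \<xi>
      using mult_right_mono[OF jbr_ge1[of \<xi>] norm_ge_zero[of "?F \<xi>"]]
      by (simp only: mult_1 norm_mult norm_of_real abs_of_nonneg jbr_ge0)
  qed measurable
  \<comment> \<open>The solution is built in frequency. \<open>JL\<close> supplies the function
    \<open>h\<close> required by \<open>H1w 0\<close>, and
    \<open>|\<xi>| ?F = z ?F + fourier u\<close> is the resolvent equation.\<close>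
  have ex: "\<exists>f. f \<in> H1w 0 \<and> (AE x in lborel. H0 f x - z * f x = u x)"
  proof -
    obtain f where f: "L2_fourier f ?F" using L2_fourier_inverse_exists[OF FL] by blast
    obtain h where h: "L2_fourier h (\<lambda>\<xi>. of_real (jbr \<xi>) * ?F \<xi>)" using L2_fourier_inverse_exists[OF JL] by blast
    have "bessel_eq f h" unfolding bessel_eq_def
    proof
      fix \<phi> assume \<phi>: "\<phi> \<in> schwartz"
      have "(LBINT x. f x * bessel_schwartz \<phi> x) = (LBINT \<xi>. ?F \<xi> * fourier_inv (bessel_schwartz \<phi>) \<xi>)"
        using L2_fourierD(3)[OF f schwartz_fourier_inv[OF schwartz_bessel[OF \<phi>]]] fourier_inversion'[OF schwartz_bessel[OF \<phi>]] by simp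
      also have "\<dots> = (LBINT \<xi>. of_real (jbr \<xi>) * ?F \<xi> * fourier_inv \<phi> \<xi>)"
        unfolding fourier_inv_bessel[OF \<phi>] by (simp add: mult_ac)
      also have "\<dots> = (LBINT x. h x * \<phi> x)"
        using L2_fourierD(3)[OF h schwartz_fourier_inv[OF \<phi>]] fourier_inversion'[OF \<phi>] by simp
      finally show "(LBINT x. f x * bessel_schwartz \<phi> x) = (LBINT x. h x * \<phi> x)" .
    qed
    then have fH: "f \<in> H1w 0" unfolding H1w_def using L2_tempered[OF L2_fourierD(1)[OF f]] L2_fourierD(1)[OF h] by auto
    obtain G where G: "L2_fourier f G" "L2_fourier (H0 f) (\<lambda>\<xi>. of_real (norm \<xi>) * G \<xi>)" using H0_spec[OF fH] by blast
    \<comment> \<open>\<open>H0 f\<close> refers to a transform of \<open>f\<close> that was itself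
      chosen; it agrees with \<open>?F\<close> only almost everywhere.\<close>
    have GF: "AE \<xi> in lborel. G \<xi> = ?F \<xi>" by (rule L2_fourier_unique[OF G(1) f])
    have [measurable]: "G \<in> borel_measurable borel" using L2_fourierD(2)[OF G(1)] by measurable
    have fL: "f \<in> L2" using f by (rule L2_fourierD)
    have "AE x in lborel. H0 f x = z * f x + u x"
    proof (rule tempered_AE_eq_fourier)
      show "tempered (H0 f)" by (intro L2_tempered L2_fourierD(1)[OF G(2)])
      show "tempered (\<lambda>x. z * f x + u x)" by (intro L2_tempered L2_add L2_cmult fL uL)
      fix \<phi> assume \<phi>: "\<phi> \<in> schwartz"
      note [measurable] = \<phi>m[OF \<phi>]
      have "(LBINT x. H0 f x * fourier \<phi> x) = (LBINT \<xi>. of_real (norm \<xi>) * G \<xi> * \<phi> \<xi>)"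
        by (rule L2_fourierD(3)[OF G(2) \<phi>])
      also have "\<dots> = (LBINT \<xi>. z * (?F \<xi> * \<phi> \<xi>) + fourier u \<xi> * \<phi> \<xi>)"
      proof (rule integral_cong_AE)
        show "AE \<xi> in lborel. of_real (norm \<xi>) * G \<xi> * \<phi> \<xi> = z * (?F \<xi> * \<phi> \<xi>) + fourier u \<xi> * \<phi> \<xi>"
          using GF
        proof eventually_elim
          fix \<xi> assume g: "G \<xi> = ?F \<xi>"
          then have "of_real (norm \<xi>) * G \<xi> = z * G \<xi> + fourier u \<xi>"
            using nz[of "norm \<xi>"] by (simp add: field_simps)
          then show "of_real (norm \<xi>) * G \<xi> * \<phi> \<xi> = z * (?F \<xi> * \<phi> \<xi>) + fourier u \<xi> * \<phi> \<xi>"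
            unfolding g[symmetric] by (simp add: distrib_right mult.assoc)
        qed
      qed measurable
      also have "\<dots> = z * (LBINT \<xi>. ?F \<xi> * \<phi> \<xi>) + (LBINT \<xi>. fourier u \<xi> * \<phi> \<xi>)"
        using int[OF FL \<phi>] int[OF schwartz_L2w[OF schwartz_fourier[OF u]] \<phi>]
        by (subst Bochner_Integration.integral_add) (auto simp only: integrable_mult_right integral_mult_right_zero)
      also have "(LBINT \<xi>. ?F \<xi> * \<phi> \<xi>) = (LBINT x. f x * fourier \<phi> x)"
        by (rule L2_fourierD(3)[OF f \<phi>, symmetric])
      also have "(LBINT \<xi>. fourier u \<xi> * \<phi> \<xi>) = (LBINT x. u x * fourier \<phi> x)"
        by (rule fourier_multiplication[OF schwartz_integrable[OF u] schwartz_integrable[OF \<phi>], symmetric])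
      also have "z * (LBINT x. f x * fourier \<phi> x) + (LBINT x. u x * fourier \<phi> x) =
          (LBINT x. z * (f x * fourier \<phi> x) + u x * fourier \<phi> x)"
        using int[OF fL schwartz_fourier[OF \<phi>]] int[OF uL schwartz_fourier[OF \<phi>]]
        by (subst Bochner_Integration.integral_add) (auto simp only: integrable_mult_right integral_mult_right_zero)
      finally show "(LBINT x. H0 f x * fourier \<phi> x) = (LBINT x. (z * f x + u x) * fourier \<phi> x)"
        by (simp add: distrib_right mult.assoc)
    qed
    then have "AE x in lborel. H0 f x - z * f x = u x" by eventually_elim simp
    with fH show ?thesis by blast
  qed
  define f where "f = R0 z u"
  have f: "f \<in> H1w 0" "AE x in lborel. H0 f x - z * f x = u x"
    using someI_ex[OF ex] unfolding f_def R0_def by auto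
  obtain G where G: "L2_fourier f G" "L2_fourier (H0 f) (\<lambda>\<xi>. of_real (norm \<xi>) * G \<xi>)" using H0_spec[OF f(1)] by blast
  have fL: "f \<in> L2" and GL: "G \<in> L2" using G(1) by (auto dest: L2_fourierD)
  have H0L: "H0 f \<in> L2" by (rule L2_fourierD(1)[OF G(2)])
  have [measurable]: "f \<in> borel_measurable borel" "H0 f \<in> borel_measurable borel" using fL H0L by measurable
  have "AE \<xi> in lborel. of_real (norm \<xi>) * G \<xi> = z * G \<xi> + fourier u \<xi>"
  proof (rule tempered_AE_eq)
    show "tempered (\<lambda>\<xi>. of_real (norm \<xi>) * G \<xi>)" by (intro L2_tempered L2_fourierD(2)[OF G(2)])
    show "tempered (\<lambda>\<xi>. z * G \<xi> + fourier u \<xi>)"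
      by (intro L2_tempered L2_add L2_cmult GL schwartz_L2w schwartz_fourier u)
    fix \<phi> assume \<phi>: "\<phi> \<in> schwartz"
    note [measurable] = \<phi>m[OF \<phi>]
    have "(LBINT \<xi>. of_real (norm \<xi>) * G \<xi> * \<phi> \<xi>) = (LBINT x. H0 f x * fourier \<phi> x)"
      by (rule L2_fourierD(3)[OF G(2) \<phi>, symmetric])
    also have "\<dots> = (LBINT x. z * (f x * fourier \<phi> x) + u x * fourier \<phi> x)"
    proof (rule integral_cong_AE)
      show "AE x in lborel. H0 f x * fourier \<phi> x = z * (f x * fourier \<phi> x) + u x * fourier \<phi> x"
        using f(2)
      proof eventually_elim
        fix x assume "H0 f x - z * f x = u x"
        then have "H0 f x = z * f x + u x" by (simp add: diff_eq_eq add.commute)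
        then show "H0 f x * fourier \<phi> x = z * (f x * fourier \<phi> x) + u x * fourier \<phi> x" by (simp add: algebra_simps)
      qed
    qed measurable
    also have "\<dots> = z * (LBINT x. f x * fourier \<phi> x) + (LBINT x. u x * fourier \<phi> x)"
      using int[OF fL schwartz_fourier[OF \<phi>]] int[OF uL schwartz_fourier[OF \<phi>]]
      by (subst Bochner_Integration.integral_add) (auto simp only: integrable_mult_right integral_mult_right_zero)
    also have "(LBINT x. f x * fourier \<phi> x) = (LBINT \<xi>. G \<xi> * \<phi> \<xi>)" by (rule L2_fourierD(3)[OF G(1) \<phi>])
    also have "(LBINT x. u x * fourier \<phi> x) = (LBINT \<xi>. fourier u \<xi> * \<phi> \<xi>)"
      by (rule fourier_multiplication[OF schwartz_integrable[OF u] schwartz_integrable[OF \<phi>]])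
    also have "z * (LBINT \<xi>. G \<xi> * \<phi> \<xi>) + (LBINT \<xi>. fourier u \<xi> * \<phi> \<xi>) =
        (LBINT \<xi>. z * (G \<xi> * \<phi> \<xi>) + fourier u \<xi> * \<phi> \<xi>)"
      using int[OF GL \<phi>] int[OF schwartz_L2w[OF schwartz_fourier[OF u]] \<phi>]
      by (subst Bochner_Integration.integral_add) (auto simp only: integrable_mult_right integral_mult_right_zero)
    finally show "(LBINT \<xi>. of_real (norm \<xi>) * G \<xi> * \<phi> \<xi>) = (LBINT \<xi>. (z * G \<xi> + fourier u \<xi>) * \<phi> \<xi>)"
      by (simp add: distrib_right mult.assoc)
  qed
  then have e: "AE \<xi> in lborel. G \<xi> = ?F \<xi>"
  proof eventually_elim
    fix \<xi> assume "of_real (norm \<xi>) * G \<xi> = z * G \<xi> + fourier u \<xi>"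
    then have "(of_real (norm \<xi>) - z) * G \<xi> = fourier u \<xi>" by (simp add: left_diff_distrib)
    then show "G \<xi> = ?F \<xi>" using nz[of "norm \<xi>"] by (simp add: nonzero_eq_divide_eq mult.commute)
  qed
  have [measurable]: "G \<in> borel_measurable borel" using GL by measurable
  show "L2_fourier (R0 z u) ?F"
    unfolding L2_fourier_def
  proof (intro conjI ballI FL)
    show "R0 z u \<in> L2" using fL unfolding f_def .
    fix \<phi> assume \<phi>: "\<phi> \<in> schwartz"
    note [measurable] = \<phi>m[OF \<phi>]
    have "(LBINT x. R0 z u x * fourier \<phi> x) = (LBINT \<xi>. G \<xi> * \<phi> \<xi>)"
      using L2_fourierD(3)[OF G(1) \<phi>] unfolding f_def .
    also have "\<dots> = (LBINT \<xi>. ?F \<xi> * \<phi> \<xi>)"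
      by (intro integral_cong_AE) (use e in auto)
    finally show "(LBINT x. R0 z u x * fourier \<phi> x) = (LBINT \<xi>. ?F \<xi> * \<phi> \<xi>)" .
  qed
qed

section \<open>The paired resolvent and its boundary value\<close>

lemma pairing_R0:
  assumes u: "u \<in> schwartz" and v: "v \<in> schwartz" and z: "Im z \<noteq> 0"
  shows "pairing (R0 z u) v =
    (LBINT \<xi>. fourier u \<xi> * fourier_inv (\<lambda>x. cnj (v x)) \<xi> / (of_real (norm \<xi>) - z))"
proof -
  note v' = schwartz_cnj[OF v]
  have "pairing (R0 z u) v = (LBINT x. R0 z u x * fourier (fourier_inv (\<lambda>x. cnj (v x))) x)"
    unfolding pairing_def fourier_inversion'[OF v'] ..
  also have "\<dots> = (LBINT \<xi>. fourier u \<xi> / (of_real (norm \<xi>) - z) * fourier_inv (\<lambda>x. cnj (v x)) \<xi>)"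
    by (rule L2_fourierD(3)[OF R0_fourier[OF u z] schwartz_fourier_inv[OF v']])
  finally show ?thesis by simp
qed

text \<open>Test functions are dual to \<open>H\<^bsup>1,-s\<^esup>\<close> because they lie in the range of \<open>(1 - \<Delta>)\<^bsup>1/2\<^esup>\<close> on Schwartz functions.\<close>

theorem pairing_R0_tendsto:
  assumes T: "R0_boundary_value \<sigma> s l T" and \<sigma>: "\<sigma> \<noteq> 0"
    and u: "u \<in> schwartz" and v: "v \<in> schwartz"
  shows "((\<lambda>\<mu>. pairing (R0 (Complex l (\<sigma> * \<mu>)) u) v) \<longlongrightarrow> pairing (T u) v) (at_right 0)"
proof (rule tendstoI)
  fix \<epsilon> :: real assume \<epsilon>: "\<epsilon> > 0"
  note v' = schwartz_cnj[OF v]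
  obtain \<phi> where \<phi>: "\<phi> \<in> schwartz" "bessel_schwartz \<phi> = (\<lambda>x. cnj (v x))" using bessel_surj[OF v'] by blast
  have us: "u \<in> L2w s" and \<phi>s: "\<phi> \<in> L2w s" using u \<phi> by (auto intro: schwartz_L2w)
  define M where "M = L2w_norm s u * L2w_norm s \<phi>"
  have nn: "0 \<le> L2w_norm s f" for s f unfolding L2w_norm_def by (intro real_sqrt_ge_zero integral_nonneg_AE) auto
  have M: "M \<ge> 0" unfolding M_def using nn by simp
  \<comment> \<open>The added 1 keeps the quotient meaningful when \<open>M = 0\<close> and makes
    \<open>e * M\<close> strictly smaller than \<open>\<epsilon>\<close>.\<close>
  define e where "e = \<epsilon> / (M + 1)"
  have e: "e > 0" "e * M < \<epsilon>" using \<epsilon> M unfolding e_def by (auto simp: field_simps add_pos_nonneg)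
  have Tu: "tempered (T u)" using T us unfolding R0_boundary_value_def bounded_op_def H1w_def by blast
  let ?d = "\<lambda>\<mu> u x. R0 (Complex l (\<sigma> * \<mu>)) u x - T u x"
  have "\<forall>\<^sub>F \<mu> in at_right 0. op_norm s (?d \<mu>) < ennreal e"
    using T e(1) unfolding R0_boundary_value_def by (intro order_tendstoD(2)) auto
  moreover have "\<forall>\<^sub>F \<mu> in at_right (0::real). \<mu> > 0" by (rule eventually_at_right_less)
  ultimately show "\<forall>\<^sub>F \<mu> in at_right 0. dist (pairing (R0 (Complex l (\<sigma> * \<mu>)) u) v) (pairing (T u) v) < \<epsilon>"
  proof eventually_elim
    case (elim \<mu>)
    obtain C where C: "0 \<le> C" "ennreal C < ennreal e"
      and dC: "\<And>u. u \<in> L2w s \<Longrightarrow> ?d \<mu> u \<in> H1w (- s) \<and> H1w_norm (- s) (?d \<mu> u) \<le> C * L2w_norm s u"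
      using elim(1) unfolding op_norm_def Inf_less_iff by auto
    have Ce: "C < e" using C by (simp add: ennreal_less_iff)
    define d where "d = ?d \<mu> u"
    have d: "d \<in> H1w (- s)" "H1w_norm (- s) d \<le> C * L2w_norm s u" using dC[OF us] unfolding d_def by auto
    \<comment> \<open>This is literally the function whose norm \<open>H1w_norm\<close> measures, so
      the norm bound on \<open>d\<close> applies to it directly.\<close>
    define h where "h = (SOME h. h \<in> L2w (- s) \<and> bessel_eq d h)"
    have h: "h \<in> L2w (- s)" "bessel_eq d h"
      using someI_ex[of "\<lambda>h. h \<in> L2w (- s) \<and> bessel_eq d h"] d(1) unfolding h_def H1w_def by auto
    have z: "Im (Complex l (\<sigma> * \<mu>)) \<noteq> 0" using \<sigma> elim(2) by simp
    have R: "tempered (R0 (Complex l (\<sigma> * \<mu>)) u)" by (intro L2_tempered L2_fourierD(1)[OF R0_fourier[OF u z]])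
    have "pairing (R0 (Complex l (\<sigma> * \<mu>)) u) v - pairing (T u) v = (LBINT x. d x * cnj (v x))"
      unfolding pairing_def d_def left_diff_distrib
      by (rule Bochner_Integration.integral_diff[symmetric]; rule tempered_schwartz_integrable[OF _ v'], fact)
    also have "\<dots> = (LBINT x. h x * \<phi> x)" using h(2) \<phi> unfolding bessel_eq_def by metis
    finally have "dist (pairing (R0 (Complex l (\<sigma> * \<mu>)) u) v) (pairing (T u) v) \<le> L2w_norm (- s) h * L2w_norm s \<phi>"
      unfolding dist_norm using L2w_pairing[OF h(1) \<phi>s] by simp
    also have "L2w_norm (- s) h \<le> C * L2w_norm s u" using d(2) unfolding H1w_norm_def h_def .
    then have "L2w_norm (- s) h * L2w_norm s \<phi> \<le> C * M" unfolding M_def using nn by (simp add: mult_right_mono mult.assoc[symmetric])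
    also have "C * M \<le> e * M" using Ce M by (intro mult_right_mono) auto
    also note e(2)
    finally show ?case .
  qed
qed

section \<open>Radial Fourier transforms and the Yukawa kernel\<close>

lemma
  fixes \<mu> :: real assumes \<mu>: "\<mu> > 0"
  shows integrable_exp_Ici: "integrable lborel (\<lambda>a. indicator {0..} a * exp (- (\<mu> * a)))"
    and integral_exp_Ici: "(LBINT a. indicator {0..} a * exp (- (\<mu> * a))) = 1 / \<mu>"
    and integrable_mult_exp_Ici: "integrable lborel (\<lambda>a. indicator {0..} a * (a * exp (- (\<mu> * a))))"
    and integral_mult_exp_Ici: "(LBINT a. indicator {0..} a * (a * exp (- (\<mu> * a)))) = 1 / \<mu>\<^sup>2"
proof -
  have *: "indicator {0..} (\<mu> * a) = (indicator {0..} a :: real)" for a :: real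
    using \<mu> by (auto simp: indicator_def zero_le_mult_iff)
  have 0: "has_bochner_integral lborel (\<lambda>x. indicator {0..} x * exp (- x)) (1::real)"
    using has_bochner_integral_I0i_power_exp_m'[of 0] by (simp add: mult.commute)
  have 1: "has_bochner_integral lborel (\<lambda>x. indicator {0..} x * (x * exp (- x))) (1::real)"
    using has_bochner_integral_I0i_power_exp_m'[of 1] by (simp add: mult_ac)
  have \<mu>0: "\<mu> \<noteq> 0" using \<mu> by simp
  note i0 = has_bochner_integral_iff[THEN iffD1, OF 0] and i1 = has_bochner_integral_iff[THEN iffD1, OF 1]
  show "integrable lborel (\<lambda>a. indicator {0..} a * exp (- (\<mu> * a)))"
    using lborel_integrable_affine[OF \<mu>0 conjunct1[OF i0], of 0] by (simp add: *)
  show "(LBINT a. indicator {0..} a * exp (- (\<mu> * a))) = 1 / \<mu>"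
    using lborel_integral_affine[of \<mu> "\<lambda>x::real. indicator {0..} x * exp (- x) :: real" 0] \<mu> i0
    by (simp add: *) (simp add: field_simps)
  have e: "indicator {0..} a * (\<mu> * a * exp (- (\<mu> * a))) = \<mu> * (indicator {0..} a * (a * exp (- (\<mu> * a))))" for a :: real by simp
  show "integrable lborel (\<lambda>a. indicator {0..} a * (a * exp (- (\<mu> * a))))"
    using integrable_mult_right[OF lborel_integrable_affine[OF \<mu>0 conjunct1[OF i1], of 0], of "1 / \<mu>"] \<mu> by (simp add: * e)
  have "\<bar>\<mu>\<bar> * (LBINT a. \<mu> * (indicator {0..} a * (a * exp (- (\<mu> * a))))) = 1"
    using lborel_integral_affine[of \<mu> "\<lambda>x::real. indicator {0..} x * (x * exp (- x)) :: real" 0] \<mu> i1 by (simp add: * e)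
  then show "(LBINT a. indicator {0..} a * (a * exp (- (\<mu> * a)))) = 1 / \<mu>\<^sup>2"
    unfolding integral_mult_right_zero using \<mu> by (simp add: field_simps power2_eq_square)
qed

lemma
  assumes w: "Re w > 0"
  shows integrable_cexp_Ici: "integrable lborel (\<lambda>a. indicator {0..} a *\<^sub>R exp (- (w * of_real a)))"
    and integral_cexp_Ici: "(LBINT a. indicator {0..} a *\<^sub>R exp (- (w * of_real a))) = 1 / w"
proof -
  have w0: "w \<noteq> 0" using w by auto
  show i: "integrable lborel (\<lambda>a. indicator {0..} a *\<^sub>R exp (- (w * of_real a)))"
    by (rule Bochner_Integration.integrable_bound[OF integrable_exp_Ici[OF w]]) (auto simp: indicator_def)
  have ae: "AE a in lborel. indicator {0..} a *\<^sub>R exp (- (w * of_real a)) = indicator {0<..} a *\<^sub>R exp (- (w * complex_of_real a))"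
    using AE_lborel_singleton[of "0::real"] by eventually_elim (auto simp: indicator_def)
  let ?F = "\<lambda>a. - exp (- (w * complex_of_real a)) / w"
  have "(LBINT a=0..\<infinity>. exp (- (w * complex_of_real a))) = 0 - (- 1 / w)"
  proof (rule interval_integral_FTC_integrable)
    show "(?F has_vector_derivative exp (- (w * complex_of_real a))) (at a)" for a
      by (rule has_vector_derivative_real_field) (use w0 in \<open>auto intro!: derivative_eq_intros\<close>)
    show "isCont (\<lambda>a. exp (- (w * complex_of_real a))) a" for a by (intro continuous_intros)
    show "set_integrable lborel (einterval 0 \<infinity>) (\<lambda>a. exp (- (w * complex_of_real a)))"
      using i integrable_cong_AE[OF _ _ ae] by (simp add: set_integrable_def zero_ereal_def)
    have "(?F \<longlongrightarrow> - exp (- (w * complex_of_real 0)) / w) (at_right 0)" by (intro tendsto_intros w0)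
    then show "((?F \<circ> real_of_ereal) \<longlongrightarrow> - 1 / w) (at_right 0)" unfolding zero_ereal_def ereal_tendsto_simps by simp
    have "((\<lambda>a. exp (- (Re w * a))) \<longlongrightarrow> 0) at_top" using w by real_asymp
    then have "((\<lambda>a. norm (exp (- (w * complex_of_real a)))) \<longlongrightarrow> 0) at_top" by simp
    then have "((\<lambda>a. exp (- (w * complex_of_real a))) \<longlongrightarrow> 0) at_top" by (rule tendsto_norm_zero_cancel)
    then have "(?F \<longlongrightarrow> - 0 / w) at_top" by (intro tendsto_intros w0)
    then show "((?F \<circ> real_of_ereal) \<longlongrightarrow> 0) (at_left \<infinity>)" unfolding ereal_tendsto_simps by simp
  qed simp
  then show "(LBINT a. indicator {0..} a *\<^sub>R exp (- (w * of_real a))) = 1 / w"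
    using integral_cong_AE[OF _ _ ae] by (simp add: interval_lebesgue_integral_0_infty set_lebesgue_integral_def)
qed

lemma integral_even:
  fixes f :: "real \<Rightarrow> real"
  assumes f: "integrable lborel f" and e: "\<And>x. f (- x) = f x"
  shows "(LBINT x. f x) = 2 * (LBINT x. indicator {0..} x * f x)"
proof -
  have [measurable]: "f \<in> borel_measurable borel" using f by simp
  have i: "integrable lborel (\<lambda>x. indicator A x * f x)" if "A \<in> sets borel" for A
    using integrable_real_mult_indicator[OF _ f, of A] that by (simp add: mult.commute)
  have "(LBINT x. f x) = (LBINT x. indicator {0..} x * f x + indicator {..0} x * f x)"
    by (rule integral_cong_AE; (measurable)?) (use AE_lborel_singleton[of "0::real"] in eventually_elim, auto simp: indicator_def)
  also have "\<dots> = (LBINT x. indicator {0..} x * f x) + (LBINT x. indicator {..0} x * f x)"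
    by (intro Bochner_Integration.integral_add i) auto
  also have "(LBINT x. indicator {..0} x * f x) = (LBINT x. indicator {0..} x * f x)"
    by (subst integral_reflect[symmetric]) (auto simp: e indicator_def)
  finally show ?thesis by simp
qed

lemma integrable_gaussian_moment:
  fixes t :: real assumes t: "t > 0" shows "integrable lborel (\<lambda>a. a * exp (- (t * a\<^sup>2)))"
proof -
  have t2: "t / 2 > 0" using t by simp
  have i: "integrable lborel (\<lambda>a. exp (- (t / 2 * a\<^sup>2)))"
    using integrable_Re[OF gaussian_fourier_1d(1)[OF t2, of 0]] by simp
  show ?thesis
  proof (rule Bochner_Integration.integrable_bound[OF integrable_mult_right[OF i, of "1 / sqrt t"]])
    have "norm (a * exp (- (t * a\<^sup>2))) \<le> norm (1 / sqrt t * exp (- (t / 2 * a\<^sup>2)))" for a :: real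
    proof -
      have "2 * (1 * (sqrt t * \<bar>a\<bar>)) \<le> 1\<^sup>2 + (sqrt t * \<bar>a\<bar>)\<^sup>2" using sum_squares_bound[of 1 "sqrt t * \<bar>a\<bar>"] by simp
      then have "sqrt t * \<bar>a\<bar> \<le> 1 + t / 2 * a\<^sup>2" using t by (simp add: power_mult_distrib)
      also have "\<dots> \<le> exp (t / 2 * a\<^sup>2)" by (rule exp_ge_add_one_self)
      finally have "\<bar>a\<bar> \<le> 1 / sqrt t * exp (t / 2 * a\<^sup>2)" using t by (simp add: field_simps)
      then have "\<bar>a\<bar> * exp (- (t * a\<^sup>2)) \<le> 1 / sqrt t * exp (t / 2 * a\<^sup>2) * exp (- (t * a\<^sup>2))"
        by (intro mult_right_mono) auto
      also have "\<dots> = 1 / sqrt t * exp (- (t / 2 * a\<^sup>2))" by (simp add: mult_exp_exp mult.assoc)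
      finally show ?thesis using t by (simp add: abs_mult)
    qed
    then show "AE a in lborel. norm (a * exp (- (t * a\<^sup>2))) \<le> norm (1 / sqrt t * exp (- (t / 2 * a\<^sup>2)))" by (intro AE_I2)
  qed measurable
qed

text \<open>The right side is the transform of a Gaussian on three-space at a point of norm
  \<open>\<rho>\<close>, so this is the radial formula for Gaussians. Integrating the derivative of
  \<open>sin (a \<rho>) exp (- t a^2)\<close> over the line trades the sine integral for the cosine
  integral, the real part of the one-dimensional transform.\<close>

lemma gaussian_sine_transform:
  assumes t: "t > 0" and \<rho>: "\<rho> > 0"
  shows "integrable lborel (\<lambda>a. indicator {0..} a * (a * sin (a * \<rho>) * exp (- (t * a\<^sup>2))))"
    and "4 * pi / \<rho> * (LBINT a. indicator {0..} a * (a * sin (a * \<rho>) * exp (- (t * a\<^sup>2))))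
      = sqrt (pi / t) ^ 3 * exp (- (\<rho>\<^sup>2 / (4 * t)))"
proof -
  let ?E = "\<lambda>a. exp (- (t * a\<^sup>2))"
  let ?s = "\<lambda>a. a * sin (a * \<rho>) * ?E a" and ?c = "\<lambda>a. cos (a * \<rho>) * ?E a"
  have Re: "Re (iexp (\<rho> * x) * of_real (?E x)) = ?c x" for x by (simp add: Re_exp mult.commute)
  have ic: "integrable lborel ?c"
    using integrable_Re[OF gaussian_fourier_1d(1)[OF t, of \<rho>]] unfolding Re .
  have vc: "(LBINT a. ?c a) = sqrt (pi / t) * exp (- (\<rho>\<^sup>2 / (4 * t)))"
    using Bochner_Integration.integral_Re[OF gaussian_fourier_1d(1)[OF t, of \<rho>]] unfolding Re gaussian_fourier_1d(2)[OF t] by simp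
  have is': "integrable lborel ?s"
    by (rule Bochner_Integration.integrable_bound[OF integrable_gaussian_moment[OF t]])
      (auto simp: abs_mult mult_left_le mult.assoc intro!: mult_left_mono)
  show "integrable lborel (\<lambda>a. indicator {0..} a * (a * sin (a * \<rho>) * ?E a))"
    using integrable_real_mult_indicator[OF _ is', of "{0..}"] by (simp add: mult.commute)
  have "(LBINT a=-\<infinity>..\<infinity>. \<rho> * ?c a - 2 * t * ?s a) = 0 - 0"
  proof (rule interval_integral_FTC_integrable)
    show "((\<lambda>a. sin (a * \<rho>) * ?E a) has_vector_derivative \<rho> * ?c a - 2 * t * ?s a) (at a)" for a
      by (auto intro!: derivative_eq_intros simp: has_real_derivative_iff_has_vector_derivative[symmetric] algebra_simps)
    show "isCont (\<lambda>a. \<rho> * ?c a - 2 * t * ?s a) a" for a by (intro continuous_intros)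
    show "set_integrable lborel (einterval (- \<infinity>) \<infinity>) (\<lambda>a. \<rho> * ?c a - 2 * t * ?s a)"
      using ic is' by (simp add: set_integrable_def)
    have sq: "\<bar>sin (a * \<rho>) * ?E a\<bar> \<le> ?E a" for a by (simp add: abs_mult mult_left_le_one_le)
    have "((\<lambda>a. ?E a) \<longlongrightarrow> 0) at_top" "((\<lambda>a. ?E a) \<longlongrightarrow> 0) at_bot" using t by real_asymp+
    then have "((\<lambda>a. sin (a * \<rho>) * ?E a) \<longlongrightarrow> 0) at_top" "((\<lambda>a. sin (a * \<rho>) * ?E a) \<longlongrightarrow> 0) at_bot"
      using sq by (auto intro: Lim_null_comparison[where g = ?E])
    then show "(((\<lambda>a. sin (a * \<rho>) * ?E a) \<circ> real_of_ereal) \<longlongrightarrow> 0) (at_right (- \<infinity>))"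
      "(((\<lambda>a. sin (a * \<rho>) * ?E a) \<circ> real_of_ereal) \<longlongrightarrow> 0) (at_left \<infinity>)" unfolding ereal_tendsto_simps by auto
  qed simp
  then have "(LBINT a. \<rho> * ?c a - 2 * t * ?s a) = 0"
    by (simp add: interval_lebesgue_integral_def set_lebesgue_integral_def)
  then have "\<rho> * (LBINT a. ?c a) = 2 * t * (LBINT a. ?s a)"
    by (subst (asm) Bochner_Integration.integral_diff) (use ic is' in auto)
  also have "(LBINT a. ?s a) = 2 * (LBINT a. indicator {0..} a * ?s a)"
    by (rule integral_even[OF is']) simp
  finally have I: "(LBINT a. indicator {0..} a * ?s a) = \<rho> / (4 * t) * (sqrt (pi / t) * exp (- (\<rho>\<^sup>2 / (4 * t))))"
    unfolding vc using t by (simp add: field_simps)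
  have "4 * pi / \<rho> * (\<rho> / (4 * t) * Z) = pi / t * Z" for Z using \<rho> t by (simp add: field_simps)
  then have "4 * pi / \<rho> * (LBINT a. indicator {0..} a * ?s a) = pi / t * (sqrt (pi / t) * exp (- (\<rho>\<^sup>2 / (4 * t))))"
    unfolding I .
  also have "\<dots> = sqrt (pi / t) ^ 3 * exp (- (\<rho>\<^sup>2 / (4 * t)))" using t by (simp add: power3_eq_cube)
  finally show "4 * pi / \<rho> * (LBINT a. indicator {0..} a * ?s a) = sqrt (pi / t) ^ 3 * exp (- (\<rho>\<^sup>2 / (4 * t)))" .
qed

text \<open>By Weierstrass it suffices to take a polynomial for \<open>q\<close>, and then both sides are sums of Gaussian integrals.\<close>

lemma radial_fourier_gaussian:
  fixes \<xi> :: "real^3"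
  assumes t: "t > 0" and \<xi>: "\<xi> \<noteq> 0" and [measurable]: "\<phi> \<in> borel_measurable borel"
    and q: "continuous_on {0..1} q" and \<phi>: "\<And>a. a \<ge> 0 \<Longrightarrow> \<phi> a = exp (- (t * a\<^sup>2)) * q (exp (- (t * a\<^sup>2)))"
  shows "(LBINT x. iexp (- (x \<bullet> \<xi>)) * of_real (\<phi> (norm x))) =
    of_real (4 * pi / norm \<xi> * (LBINT a. indicator {0..} a * (a * sin (a * norm \<xi>) * \<phi> a)))"
proof -
  let ?E = "\<lambda>a. exp (- (t * a\<^sup>2))"
  define \<rho> where "\<rho> = norm \<xi>"
  have \<rho>: "\<rho> > 0" unfolding \<rho>_def using \<xi> by simp
  have E01: "?E a \<in> {0..1}" for a using t by simp
  have "\<exists>p. real_polynomial_function p \<and> (\<forall>s\<in>{0..1}. \<bar>q s - p s\<bar> < 1 / Suc n)" for n :: nat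
    using Stone_Weierstrass_real_polynomial_function[OF _ q, of "1 / Suc n"] by (metis compact_Icc zero_less_divide_1_iff of_nat_0_less_iff zero_less_Suc)
  then obtain p where p: "\<And>n. real_polynomial_function (p n)" "\<And>n s. s \<in> {0..1} \<Longrightarrow> \<bar>q s - p n s\<bar> < 1 / Suc n" by metis
  have "\<forall>n. \<exists>c N. p n = (\<lambda>x. \<Sum>i\<le>N. c i * x ^ i)" using p(1) by (auto simp: real_polynomial_function_iff_sum)
  then obtain c N where cN: "\<And>n. p n = (\<lambda>x. \<Sum>i\<le>N n. c n i * x ^ i)" by metis
  have [measurable]: "p n \<in> borel_measurable borel" for n unfolding cN by measurable
  \<comment> \<open>The Gaussian factor in front of \<open>q\<close> turns even the constant
    monomial into an integrable Gaussian; degree \<open>i\<close> has the parameter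
    \<open>t (i + 1)\<close>.\<close>
  have pw: "?E a * (?E a) ^ i = exp (- (t * real (Suc i) * a\<^sup>2))" for a i
    by (simp add: exp_of_nat_mult[symmetric] exp_add[symmetric] algebra_simps)
  have tS: "t * real (Suc i) > 0" for i using t by simp
  have P: "(LBINT x. iexp (- (x \<bullet> \<xi>)) * of_real (?E (norm x) * p n (?E (norm x)))) =
    of_real (4 * pi / \<rho> * (LBINT a. indicator {0..} a * (a * sin (a * \<rho>) * (?E a * p n (?E a)))))" for n
  proof -
    have "(LBINT x. iexp (- (x \<bullet> \<xi>)) * of_real (?E (norm x) * p n (?E (norm x)))) =
      (LBINT x. (\<Sum>i\<le>N n. of_real (c n i) * (iexp (x \<bullet> (- \<xi>)) * of_real (exp (- (t * real (Suc i) * (norm x)\<^sup>2))))))"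
      unfolding cN sum_distrib_left of_real_sum pw[symmetric]
      by (intro Bochner_Integration.integral_cong sum.cong refl) (simp only: of_real_mult inner_minus_right mult_ac)
    also have "\<dots> = (\<Sum>i\<le>N n. of_real (c n i) * (LBINT x. iexp (x \<bullet> (- \<xi>)) * of_real (exp (- (t * real (Suc i) * (norm x)\<^sup>2)))))"
      unfolding integral_mult_right_zero[symmetric]
      by (intro Bochner_Integration.integral_sum integrable_mult_right gaussian_fourier tS)
    also have "\<dots> = (\<Sum>i\<le>N n. of_real (c n i * (4 * pi / \<rho> * (LBINT a. indicator {0..} a * (a * sin (a * \<rho>) * exp (- (t * real (Suc i) * a\<^sup>2)))))))"
      unfolding gaussian_fourier(2)[OF tS] gaussian_sine_transform(2)[OF tS \<rho>] norm_minus_cancel \<rho>_def[symmetric] by simp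
    also have "\<dots> = of_real (4 * pi / \<rho> * (\<Sum>i\<le>N n. c n i * (LBINT a. indicator {0..} a * (a * sin (a * \<rho>) * exp (- (t * real (Suc i) * a\<^sup>2))))))"
      unfolding of_real_sum[symmetric] sum_distrib_left by (simp only: mult_ac)
    also have "(\<Sum>i\<le>N n. c n i * (LBINT a. indicator {0..} a * (a * sin (a * \<rho>) * exp (- (t * real (Suc i) * a\<^sup>2))))) =
      (LBINT a. (\<Sum>i\<le>N n. c n i * (indicator {0..} a * (a * sin (a * \<rho>) * exp (- (t * real (Suc i) * a\<^sup>2))))))"
      unfolding integral_mult_right_zero[symmetric]
      by (intro Bochner_Integration.integral_sum[symmetric] integrable_mult_right gaussian_sine_transform tS \<rho>)
    also have "\<dots> = (LBINT a. indicator {0..} a * (a * sin (a * \<rho>) * (?E a * p n (?E a))))"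
      unfolding cN sum_distrib_left pw[symmetric] by (simp only: mult_ac)
    finally show ?thesis .
  qed
  \<comment> \<open>The polynomials stay within 1 of \<open>q\<close> on the unit interval, so
    \<open>Q + 1\<close> bounds them all and provides the dominating functions.\<close>
  obtain Q where Q: "\<And>s. s \<in> {0..1} \<Longrightarrow> \<bar>q s\<bar> \<le> Q"
    using compact_imp_bounded[OF compact_continuous_image[OF q compact_Icc]] unfolding bounded_iff
    by (metis imageI real_norm_def)
  have pQ: "\<bar>p n s\<bar> \<le> Q + 1" if "s \<in> {0..1}" for n s
  proof -
    have "1 / real (Suc n) \<le> 1" by simp
    then show ?thesis using p(2)[OF that, of n] Q[OF that] by linarith
  qed
  have plim: "(\<lambda>n. ?E a * p n (?E a)) \<longlonglongrightarrow> \<phi> a" if "a \<ge> 0" for a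
  proof -
    have "(\<lambda>n. p n (?E a) - q (?E a)) \<longlonglongrightarrow> 0"
    proof (rule Lim_null_comparison)
      show "\<forall>\<^sub>F n in sequentially. norm (p n (?E a) - q (?E a)) \<le> 1 / Suc n"
        using p(2)[OF E01, of a] by (intro always_eventually allI) (metis abs_minus_commute less_imp_le real_norm_def)
      show "(\<lambda>n. 1 / real (Suc n)) \<longlonglongrightarrow> 0" by (rule LIMSEQ_Suc[OF lim_1_over_n])
    qed
    then have "(\<lambda>n. p n (?E a)) \<longlonglongrightarrow> q (?E a)" by (rule LIM_zero_cancel)
    then show ?thesis unfolding \<phi>[OF that] by (intro tendsto_intros)
  qed
  have iE3: "integrable lborel (\<lambda>x::real^3. ?E (norm x))"
    using integrable_Re[OF gaussian_fourier(1)[OF t, of 0]] by simp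
  have b: "\<bar>?E a * p n (?E a)\<bar> \<le> ?E a * (Q + 1)" for a n
    unfolding abs_mult using pQ[OF E01, of n a] by (simp only: abs_exp_cancel) (intro mult_left_mono, auto)
  have L: "(\<lambda>n. LBINT x. iexp (- (x \<bullet> \<xi>)) * of_real (?E (norm x) * p n (?E (norm x))))
    \<longlonglongrightarrow> (LBINT x. iexp (- (x \<bullet> \<xi>)) * of_real (\<phi> (norm x)))"
  proof (rule integral_dominated_convergence[where w = "\<lambda>x. ?E (norm x) * (Q + 1)"])
    show "AE x in lborel. (\<lambda>n. iexp (- (x \<bullet> \<xi>)) * of_real (?E (norm x) * p n (?E (norm x)))) \<longlonglongrightarrow> iexp (- (x \<bullet> \<xi>)) * of_real (\<phi> (norm x))"
      by (intro AE_I2 tendsto_mult[OF tendsto_const] tendsto_of_real plim norm_ge_zero)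
    show "AE x in lborel. norm (iexp (- (x \<bullet> \<xi>)) * of_real (?E (norm x) * p n (?E (norm x)))) \<le> ?E (norm x) * (Q + 1)" for n
      using b by (intro AE_I2) (simp only: norm_mult[of "iexp _"] norm_of_real norm_exp_i_times mult_1)
  qed (use iE3 in auto)
  have R: "(\<lambda>n. LBINT a. indicator {0..} a * (a * sin (a * \<rho>) * (?E a * p n (?E a))))
    \<longlonglongrightarrow> (LBINT a. indicator {0..} a * (a * sin (a * \<rho>) * \<phi> a))"
  proof (rule integral_dominated_convergence[where w = "\<lambda>a. indicator {0..} a * (a * exp (- (t * a\<^sup>2))) * (Q + 1)"])
    show "AE a in lborel. (\<lambda>n. indicator {0..} a * (a * sin (a * \<rho>) * (?E a * p n (?E a)))) \<longlonglongrightarrow> indicator {0..} a * (a * sin (a * \<rho>) * \<phi> a)"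
    proof (rule AE_I2)
      fix a show "(\<lambda>n. indicator {0..} a * (a * sin (a * \<rho>) * (?E a * p n (?E a)))) \<longlonglongrightarrow> indicator {0..} a * (a * sin (a * \<rho>) * \<phi> a)"
        using plim[of a] by (cases "a \<ge> 0") (auto intro!: tendsto_intros)
    qed
    show "AE a in lborel. norm (indicator {0..} a * (a * sin (a * \<rho>) * (?E a * p n (?E a)))) \<le> indicator {0..} a * (a * exp (- (t * a\<^sup>2))) * (Q + 1)" for n
    proof (rule AE_I2)
      fix a
      show "norm (indicator {0..} a * (a * sin (a * \<rho>) * (?E a * p n (?E a)))) \<le> indicator {0..} a * (a * exp (- (t * a\<^sup>2))) * (Q + 1)"
      proof (cases "a \<ge> 0")
        case True
        have "norm (a * sin (a * \<rho>) * (?E a * p n (?E a))) \<le> (a * 1) * (?E a * (Q + 1))"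
          unfolding real_norm_def abs_mult[of "a * _"] abs_mult[of a] using True
          by (intro mult_mono b) auto
        then show ?thesis using True by (simp add: mult.assoc)
      qed simp
    qed
    show "integrable lborel (\<lambda>a. indicator {0..} a * (a * exp (- (t * a\<^sup>2))) * (Q + 1))"
      using integrable_real_mult_indicator[OF _ integrable_gaussian_moment[OF t], of "{0..}"]
      by (intro integrable_mult_left) (simp add: mult.commute)
  qed measurable
  have "(\<lambda>n. LBINT x. iexp (- (x \<bullet> \<xi>)) * of_real (?E (norm x) * p n (?E (norm x))))
    \<longlonglongrightarrow> of_real (4 * pi / \<rho> * (LBINT a. indicator {0..} a * (a * sin (a * \<rho>) * \<phi> a)))"
    unfolding P by (intro tendsto_of_real tendsto_mult[OF tendsto_const] R)
  from LIMSEQ_unique[OF L this] show ?thesis unfolding \<rho>_def .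
qed

lemma
  fixes \<mu> :: real assumes \<mu>: "\<mu> > 0"
  shows integrable_exp_over_norm: "integrable lborel (\<lambda>x::real^3. exp (- (\<mu> * norm x)) / norm x)"
    and integral_exp_over_norm: "(LINT x::real^3|lborel. exp (- (\<mu> * norm x)) / norm x) = 4 * pi / \<mu>\<^sup>2"
proof -
  have e: "(indicator {0..} a * (4 * pi * a\<^sup>2)) *\<^sub>R (exp (- (\<mu> * a)) / a) = 4 * pi * (indicator {0..} a * (a * exp (- (\<mu> * a))))" for a :: real
    by (simp add: power2_eq_square)
  show "integrable lborel (\<lambda>x::real^3. exp (- (\<mu> * norm x)) / norm x)"
    by (subst integrable_radial_iff, measurable, unfold e) (intro integrable_mult_right integrable_mult_exp_Ici \<mu>)
  show "(LINT x::real^3|lborel. exp (- (\<mu> * norm x)) / norm x) = 4 * pi / \<mu>\<^sup>2"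
    by (subst integral_radial, measurable, unfold e integral_mult_right_zero integral_mult_exp_Ici[OF \<mu>]) simp
qed

text \<open>The quotient is approximated by
  \<open>exp (- \<epsilon> a^2) \<psi> a / (a + \<epsilon>)\<close>: the shift removes the
  singularity at 0, and the Gaussian brings the function into the shape covered by
  \<open>radial_fourier_gaussian\<close>. The integrals are dominated by
  \<open>exp (- \<mu> |x|) / |x|\<close> in space and by \<open>exp (- \<mu> a)\<close> on the
  half-line.\<close>

lemma
  fixes \<xi> :: "real^3"
  assumes \<xi>: "\<xi> \<noteq> 0" and [measurable]: "\<psi> \<in> borel_measurable borel" and \<mu>: "\<mu> > 0"
    and c: "continuous_on {0..} \<psi>" and B: "\<And>a. a \<ge> 0 \<Longrightarrow> \<bar>\<psi> a\<bar> \<le> exp (- (\<mu> * a))"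
  shows integrable_radial_quotient: "integrable lborel (\<lambda>x::real^3. \<psi> (norm x) / norm x)"
    and radial_fourier_quotient: "(LBINT x. iexp (- (x \<bullet> \<xi>)) * of_real (\<psi> (norm x) / norm x)) =
      of_real (4 * pi / norm \<xi> * (LBINT a. indicator {0..} a * (sin (a * norm \<xi>) * \<psi> a)))"
proof -
  define \<rho> where "\<rho> = norm \<xi>"
  have B1: "\<bar>\<psi> a\<bar> \<le> 1" if "a \<ge> 0" for a
  proof -
    have "exp (- (\<mu> * a)) \<le> 1" using that \<mu> by simp
    with B[OF that] show ?thesis by linarith
  qed
  show "integrable lborel (\<lambda>x::real^3. \<psi> (norm x) / norm x)"
    by (rule Bochner_Integration.integrable_bound[OF integrable_exp_over_norm[OF \<mu>]])
      (auto intro!: divide_right_mono B)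
  define \<epsilon> where "\<epsilon> n = 1 / real (Suc n)" for n
  have \<epsilon>: "\<epsilon> n > 0" for n unfolding \<epsilon>_def by simp
  have \<epsilon>0: "\<epsilon> \<longlonglongrightarrow> 0" unfolding \<epsilon>_def by (rule LIMSEQ_Suc[OF lim_1_over_n])
  define \<phi> where "\<phi> n a = exp (- (\<epsilon> n * a\<^sup>2)) * (\<psi> a / (a + \<epsilon> n))" for n a
  have [measurable]: "\<phi> n \<in> borel_measurable borel" for n unfolding \<phi>_def by measurable
  have \<phi>B: "\<bar>\<phi> n a\<bar> \<le> exp (- (\<mu> * a)) / a" if "a > 0" for n a
  proof -
    have "\<bar>\<phi> n a\<bar> = exp (- (\<epsilon> n * a\<^sup>2)) * (\<bar>\<psi> a\<bar> / (a + \<epsilon> n))"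
      unfolding \<phi>_def using that \<epsilon>[of n] by (simp add: abs_mult)
    also have "\<dots> \<le> 1 * (exp (- (\<mu> * a)) / a)"
      using that \<epsilon>[of n] B[of a] by (intro mult_mono frac_le) auto
    finally show ?thesis by simp
  qed
  have \<phi>lim: "(\<lambda>n. \<phi> n a) \<longlonglongrightarrow> \<psi> a / a" if "a > 0" for a
  proof -
    have "(\<lambda>n. \<phi> n a) \<longlonglongrightarrow> exp (- (0 * a\<^sup>2)) * (\<psi> a / (a + 0))"
      unfolding \<phi>_def by (intro tendsto_intros \<epsilon>0) (use that in auto)
    then show ?thesis by simp
  qed
  have step: "(LBINT x. iexp (- (x \<bullet> \<xi>)) * of_real (\<phi> n (norm x))) =
    of_real (4 * pi / \<rho> * (LBINT a. indicator {0..} a * (a * sin (a * \<rho>) * \<phi> n a)))" for n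
  proof -
    \<comment> \<open>\<open>r\<close> inverts \<open>a \<mapsto> exp (- \<epsilon> a^2)\<close> on
      the half-line, so \<open>q\<close> is the second factor of \<open>\<phi> n\<close> in the
      variable \<open>s\<close>. The endpoint \<open>s = 0\<close> corresponds to
      \<open>a = \<infinity>\<close>, where \<open>1 / (r s + \<epsilon>)\<close> tends to
      0.\<close>
    define r where "r s = sqrt (- ln s / \<epsilon> n)" for s
    define q where "q s = (if s \<le> 0 then 0 else \<psi> (r s) / (r s + \<epsilon> n))" for s
    have r0: "r s \<ge> 0" if "s \<in> {0<..1}" for s unfolding r_def using that by (intro real_sqrt_ge_zero divide_nonneg_pos \<epsilon>) auto
    have "continuous (at s within {0..1}) q" if s: "s \<in> {0..1}" for s
    proof (cases "s = 0")
      case True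
      have "((\<lambda>s. 1 / (sqrt (- ln s / \<epsilon> n) + \<epsilon> n)) \<longlongrightarrow> 0) (at_right 0)" using \<epsilon>[of n] by real_asymp
      then have lim: "((\<lambda>s. 1 / (r s + \<epsilon> n)) \<longlongrightarrow> 0) (at_right 0)" unfolding r_def .
      have "(q \<longlongrightarrow> 0) (at_right 0)"
      proof (rule Lim_null_comparison[OF _ lim])
        have "\<forall>\<^sub>F s::real in at_right 0. s \<in> {0<..<1}" by (rule eventually_at_right_real) simp
        then show "\<forall>\<^sub>F s in at_right 0. norm (q s) \<le> 1 / (r s + \<epsilon> n)"
        proof eventually_elim
          case (elim s)
          then have "r s \<ge> 0" by (intro r0) auto
          then show ?case using elim B1 \<epsilon>[of n] unfolding q_def by (auto intro!: divide_right_mono)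
        qed
      qed
      then have "(q \<longlongrightarrow> 0) (at 0 within {0..1})"
        by (simp add: at_within_Icc_at_right)
      then show ?thesis using True by (simp add: continuous_within q_def)
    next
      case False
      have "continuous_on {0<..1} (\<lambda>s. \<psi> (r s) / (r s + \<epsilon> n))"
      proof (intro continuous_intros continuous_on_compose2[OF c])
        show "continuous_on {0<..1} r" unfolding r_def by (intro continuous_intros) (use \<epsilon>[of n] in auto)
        then show "continuous_on {0<..1} r" .
        show "r ` {0<..1} \<subseteq> {0..}" using r0 by auto
        show "\<forall>s\<in>{0<..1}. r s + \<epsilon> n \<noteq> 0" using r0 \<epsilon>[of n] by (metis add_nonneg_pos less_irrefl)
      qed
      then have "continuous_on {0<..1} q" by (rule continuous_on_eq) (auto simp: q_def)
      then have "continuous (at s within {0<..1}) q" using s False by (auto simp: continuous_on_eq_continuous_within)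
      moreover have "at s within {0..1} = at s within {0<..1}"
        by (rule at_within_nhd[of _ "{0<..}"]) (use s False in auto)
      ultimately show ?thesis by (simp add: continuous_within)
    qed
    then have "continuous_on {0..1} q" by (simp add: continuous_on_eq_continuous_within)
    moreover have "\<phi> n a = exp (- (\<epsilon> n * a\<^sup>2)) * q (exp (- (\<epsilon> n * a\<^sup>2)))" if "a \<ge> 0" for a
      using that \<epsilon>[of n] unfolding \<phi>_def q_def r_def by (simp add: real_sqrt_abs)
    ultimately show ?thesis unfolding \<rho>_def by (intro radial_fourier_gaussian[OF \<epsilon>[of n] \<xi>]) auto
  qed
  have n0: "AE x in lborel. (x::real^3) \<noteq> 0" by (rule AE_lborel_singleton)
  have n1: "AE a in lborel. (a::real) \<noteq> 0" by (rule AE_lborel_singleton)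
  have L: "(\<lambda>n. LBINT x. iexp (- (x \<bullet> \<xi>)) * of_real (\<phi> n (norm x)))
    \<longlonglongrightarrow> (LBINT x. iexp (- (x \<bullet> \<xi>)) * of_real (\<psi> (norm x) / norm x))"
  proof (rule integral_dominated_convergence[OF _ _ integrable_exp_over_norm[OF \<mu>]])
    show "AE x in lborel. (\<lambda>n. iexp (- (x \<bullet> \<xi>)) * of_real (\<phi> n (norm x))) \<longlonglongrightarrow> iexp (- (x \<bullet> \<xi>)) * of_real (\<psi> (norm x) / norm x)"
      using n0 by eventually_elim (intro tendsto_mult[OF tendsto_const] tendsto_of_real \<phi>lim, simp)
    show "AE x in lborel. norm (iexp (- (x \<bullet> \<xi>)) * of_real (\<phi> n (norm x))) \<le> exp (- (\<mu> * norm x)) / norm x" for n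
      using n0
    proof eventually_elim
      case (elim x) then show ?case using \<phi>B[of "norm x" n] by (simp add: norm_mult)
    qed
  qed measurable
  have R: "(\<lambda>n. LBINT a. indicator {0..} a * (a * sin (a * \<rho>) * \<phi> n a))
    \<longlonglongrightarrow> (LBINT a. indicator {0..} a * (sin (a * \<rho>) * \<psi> a))"
  proof (rule integral_dominated_convergence[OF _ _ integrable_exp_Ici[OF \<mu>]])
    show "AE a in lborel. (\<lambda>n. indicator {0..} a * (a * sin (a * \<rho>) * \<phi> n a)) \<longlonglongrightarrow> indicator {0..} a * (sin (a * \<rho>) * \<psi> a)"
      using n1
    proof eventually_elim
      case (elim a)
      show ?case
      proof (cases "a > 0")
        case True
        have "(\<lambda>n. indicator {0..} a * (a * sin (a * \<rho>) * \<phi> n a)) \<longlonglongrightarrow> indicator {0..} a * (a * sin (a * \<rho>) * (\<psi> a / a))"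
          by (intro tendsto_intros \<phi>lim True)
        then show ?thesis using True by simp
      qed (use elim in simp)
    qed
    show "AE a in lborel. norm (indicator {0..} a * (a * sin (a * \<rho>) * \<phi> n a)) \<le> indicator {0..} a * exp (- (\<mu> * a))" for n
      using n1
    proof eventually_elim
      case (elim a)
      show ?case
      proof (cases "a > 0")
        case True
        have "\<bar>a * sin (a * \<rho>) * \<phi> n a\<bar> \<le> (a * 1) * (exp (- (\<mu> * a)) / a)"
          unfolding abs_mult using True by (intro mult_mono \<phi>B) auto
        then show ?thesis using True by (simp add: abs_mult)
      qed (use elim in simp)
    qed
  qed measurable
  have "(\<lambda>n. LBINT x. iexp (- (x \<bullet> \<xi>)) * of_real (\<phi> n (norm x)))
    \<longlonglongrightarrow> of_real (4 * pi / \<rho> * (LBINT a. indicator {0..} a * (sin (a * \<rho>) * \<psi> a)))"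
    unfolding step by (intro tendsto_of_real tendsto_mult[OF tendsto_const] R)
  from LIMSEQ_unique[OF L this]
  show "(LBINT x. iexp (- (x \<bullet> \<xi>)) * of_real (\<psi> (norm x) / norm x)) =
      of_real (4 * pi / norm \<xi> * (LBINT a. indicator {0..} a * (sin (a * norm \<xi>) * \<psi> a)))"
    unfolding \<rho>_def .
qed

section \<open>Yukawa kernels and their transforms\<close>

definition yukawa :: "complex \<Rightarrow> cfun3" where
  "yukawa \<kappa> x = exp (- (\<kappa> * of_real (norm x))) / of_real (4 * pi * norm x)"

lemma borel_measurable_yukawa [measurable (raw)]:
  assumes [measurable]: "f \<in> borel_measurable M" "g \<in> borel_measurable M"
  shows "(\<lambda>x. yukawa (f x) (g x)) \<in> borel_measurable M"
  unfolding yukawa_def by measurable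

lemma norm_yukawa: "norm (yukawa \<kappa> x) = exp (- (Re \<kappa> * norm x)) / norm x / (4 * pi)"
  unfolding yukawa_def by (simp add: norm_divide norm_mult)

lemma norm_yukawa_le: "norm (yukawa \<kappa> x) \<le> exp (- (Re \<kappa> * norm x)) / norm x"
proof -
  have "t / (4 * pi) \<le> t" if "t \<ge> 0" for t
    using mult_left_mono[of 1 "4 * pi" t] that pi_ge_two by (simp add: divide_le_eq)
  then show ?thesis unfolding norm_yukawa by (simp only: divide_nonneg_nonneg exp_ge_zero norm_ge_zero)
qed

lemma integrable_yukawa: assumes "Re \<kappa> > 0" shows "integrable lborel (yukawa \<kappa>)"
proof (rule Bochner_Integration.integrable_bound[OF integrable_exp_over_norm[OF assms]])
  show "AE x in lborel. norm (yukawa \<kappa> x) \<le> norm (exp (- (Re \<kappa> * norm x)) / norm x)"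
    using norm_yukawa_le by simp
qed measurable

text \<open>The radial formula is real, so it is applied to the real and the imaginary part of
  \<open>exp (- \<kappa> a)\<close> separately. Recombined, they leave the integral of
  \<open>sin (a \<rho>) exp (- \<kappa> a)\<close>, a difference of two exponential
  integrals.\<close>

theorem yukawa_fourier:
  fixes \<xi> :: "real^3"
  assumes \<kappa>: "Re \<kappa> > 0" and \<xi>: "\<xi> \<noteq> 0"
  shows "(LBINT x. iexp (- (x \<bullet> \<xi>)) * yukawa \<kappa> x) = 1 / (of_real ((norm \<xi>)\<^sup>2) + \<kappa>\<^sup>2)"
proof -
  define \<rho> where "\<rho> = norm \<xi>"
  have \<rho>: "\<rho> > 0" unfolding \<rho>_def using \<xi> by simp
  let ?c = "\<lambda>a. exp (- (Re \<kappa> * a)) * cos (Im \<kappa> * a)" and ?s = "\<lambda>a. - (exp (- (Re \<kappa> * a)) * sin (Im \<kappa> * a))"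
  have wr: "Re (\<kappa> - \<i> * of_real \<rho>) > 0" "Re (\<kappa> + \<i> * of_real \<rho>) > 0" using \<kappa> by simp_all
  have E: "exp (- (\<kappa> * of_real a)) = of_real (?c a) + \<i> * of_real (?s a)" for a
    by (simp add: complex_eq_iff Re_exp Im_exp)
  have cB: "\<bar>?c a\<bar> \<le> exp (- (Re \<kappa> * a))" and sB: "\<bar>?s a\<bar> \<le> exp (- (Re \<kappa> * a))" for a
    by (auto simp: abs_mult mult_left_le)
  have cc: "continuous_on {0..} ?c" and sc: "continuous_on {0..} ?s" by (intro continuous_intros)+
  have cm: "?c \<in> borel_measurable borel" and sm: "?s \<in> borel_measurable borel" by measurable
  note C = integrable_radial_quotient[OF \<xi> cm \<kappa> cc cB] radial_fourier_quotient[OF \<xi> cm \<kappa> cc cB]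
  note S = integrable_radial_quotient[OF \<xi> sm \<kappa> sc sB] radial_fourier_quotient[OF \<xi> sm \<kappa> sc sB]
  have sp: "iexp (- (x \<bullet> \<xi>)) * yukawa \<kappa> x = of_real (1 / (4 * pi)) * (iexp (- (x \<bullet> \<xi>)) * of_real (?c (norm x) / norm x))
    + of_real (1 / (4 * pi)) * \<i> * (iexp (- (x \<bullet> \<xi>)) * of_real (?s (norm x) / norm x))" for x
  proof -
    have "X * ((C + \<i> * S) / (4 * p * n)) = 1 / (4 * p) * (X * (C / n)) + 1 / (4 * p) * \<i> * (X * (S / n))" for X C S p n :: complex
      by (simp add: add_divide_distrib distrib_left mult_ac)
    from this[of "iexp (- (x \<bullet> \<xi>))" "of_real (?c (norm x))" "of_real (?s (norm x))" "of_real pi" "of_real (norm x)"]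
    show ?thesis unfolding yukawa_def E by simp
  qed
  have sinI: "integrable lborel (\<lambda>a. indicator {0..} a * (sin (a * \<rho>) * \<psi> a))"
    if \<psi>: "\<And>a. \<bar>\<psi> a\<bar> \<le> exp (- (Re \<kappa> * a))" and [measurable]: "\<psi> \<in> borel_measurable borel" for \<psi>
  proof (rule Bochner_Integration.integrable_bound[OF integrable_exp_Ici[OF \<kappa>]])
    have "\<bar>sin (a * \<rho>) * \<psi> a\<bar> \<le> 1 * exp (- (Re \<kappa> * a))" for a
      unfolding abs_mult by (intro mult_mono \<psi>) auto
    then show "AE a in lborel. norm (indicator {0..} a * (sin (a * \<rho>) * \<psi> a)) \<le> norm (indicator {0..} a * exp (- (Re \<kappa> * a)))"
      by (auto simp: indicator_def)
  qed measurable
  have "(LBINT x. iexp (- (x \<bullet> \<xi>)) * yukawa \<kappa> x) =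
    of_real (1 / (4 * pi)) * of_real (4 * pi / \<rho> * (LBINT a. indicator {0..} a * (sin (a * \<rho>) * ?c a)))
    + of_real (1 / (4 * pi)) * \<i> * of_real (4 * pi / \<rho> * (LBINT a. indicator {0..} a * (sin (a * \<rho>) * ?s a)))"
    unfolding sp
    by (subst Bochner_Integration.integral_add; (intro integrable_mult_right integrable_iexp_mult integrable_of_real C(1) S(1))?)
      (measurable, simp only: integral_mult_right_zero C(2) S(2) \<rho>_def)
  also have "\<dots> = of_real (1 / \<rho>) * (of_real (LBINT a. indicator {0..} a * (sin (a * \<rho>) * ?c a))
    + \<i> * of_real (LBINT a. indicator {0..} a * (sin (a * \<rho>) * ?s a)))"
  proof -
    have "of_real (1 / (4 * pi)) * of_real (4 * pi / \<rho> * I) + of_real (1 / (4 * pi)) * \<i> * of_real (4 * pi / \<rho> * J)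
      = of_real (1 / \<rho>) * (of_real I + \<i> * complex_of_real J)" for I J by (simp add: distrib_left)
    then show ?thesis .
  qed
  also have "of_real (LBINT a. indicator {0..} a * (sin (a * \<rho>) * ?c a)) + \<i> * of_real (LBINT a. indicator {0..} a * (sin (a * \<rho>) * ?s a))
    = (LBINT a. of_real (indicator {0..} a * (sin (a * \<rho>) * ?c a)) + \<i> * of_real (indicator {0..} a * (sin (a * \<rho>) * ?s a)))"
    by (subst Bochner_Integration.integral_add; (intro integrable_mult_right integrable_of_real sinI cB sB cm sm)?)
      (simp only: integral_mult_right_zero integral_complex_of_real)
  also have "\<dots> = (LBINT a. (1 / (2 * \<i>)) * (indicator {0..} a *\<^sub>R exp (- ((\<kappa> - \<i> * of_real \<rho>) * of_real a)))
      - (1 / (2 * \<i>)) * (indicator {0..} a *\<^sub>R exp (- ((\<kappa> + \<i> * of_real \<rho>) * of_real a))))"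
  proof (intro Bochner_Integration.integral_cong refl)
    fix a
    have "of_real (indicator {0..} a * (sin (a * \<rho>) * ?c a)) + \<i> * of_real (indicator {0..} a * (sin (a * \<rho>) * ?s a))
      = indicator {0..} a *\<^sub>R (of_real (sin (a * \<rho>)) * exp (- (\<kappa> * of_real a)))"
      unfolding E by (simp add: scaleR_conv_of_real algebra_simps)
    also have "of_real (sin (a * \<rho>)) = (1 / (2 * \<i>)) * (exp (\<i> * of_real (a * \<rho>)) - exp (- (\<i> * of_real (a * \<rho>))))"
      by (simp add: sin_exp_eq flip: sin_of_real)
    also have "\<dots> * exp (- (\<kappa> * of_real a)) = (1 / (2 * \<i>)) * (exp (- ((\<kappa> - \<i> * of_real \<rho>) * of_real a)) - exp (- ((\<kappa> + \<i> * of_real \<rho>) * of_real a)))"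
      by (simp add: left_diff_distrib right_diff_distrib mult_exp_exp algebra_simps)
    finally show "of_real (indicator {0..} a * (sin (a * \<rho>) * ?c a)) + \<i> * of_real (indicator {0..} a * (sin (a * \<rho>) * ?s a)) =
      (1 / (2 * \<i>)) * (indicator {0..} a *\<^sub>R exp (- ((\<kappa> - \<i> * of_real \<rho>) * of_real a)))
      - (1 / (2 * \<i>)) * (indicator {0..} a *\<^sub>R exp (- ((\<kappa> + \<i> * of_real \<rho>) * of_real a)))"
      by (simp add: right_diff_distrib scaleR_diff_right)
  qed
  also have "\<dots> = (1 / (2 * \<i>)) * (1 / (\<kappa> - \<i> * of_real \<rho>)) - (1 / (2 * \<i>)) * (1 / (\<kappa> + \<i> * of_real \<rho>))"
    by (subst Bochner_Integration.integral_diff; (intro integrable_mult_right integrable_cexp_Ici wr)?)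
      (simp only: integral_mult_right_zero integral_cexp_Ici[OF wr(1)] integral_cexp_Ici[OF wr(2)])
  also have "\<dots> = of_real \<rho> / (of_real (\<rho>\<^sup>2) + \<kappa>\<^sup>2)"
  proof -
    have n: "\<kappa> - \<i> * of_real \<rho> \<noteq> 0" "\<kappa> + \<i> * of_real \<rho> \<noteq> 0" using \<kappa> by (auto simp: complex_eq_iff)
    have "(\<kappa> - \<i> * of_real \<rho>) * (\<kappa> + \<i> * of_real \<rho>) = of_real (\<rho>\<^sup>2) + \<kappa>\<^sup>2"
      by (simp add: algebra_simps power2_eq_square complex_i_mult_minus)
    moreover have "(1 / (2 * \<i>)) * (1 / (\<kappa> - \<i> * of_real \<rho>)) - (1 / (2 * \<i>)) * (1 / (\<kappa> + \<i> * of_real \<rho>))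
      = of_real \<rho> / ((\<kappa> - \<i> * of_real \<rho>) * (\<kappa> + \<i> * of_real \<rho>))"
    proof -
      have "1 / A - 1 / B = (B - A) / (A * B)" if "A \<noteq> 0" "B \<noteq> 0" for A B :: complex
        using that by (simp add: divide_simps)
      from this[OF n] show ?thesis unfolding right_diff_distrib[symmetric] by simp
    qed
    ultimately show ?thesis by simp
  qed
  finally show ?thesis unfolding \<rho>_def using \<xi> by (simp add: field_simps)
qed

section \<open>Convolutions\<close>

lemma fourier_convolution:
  assumes G: "integrable lborel G" and u: "integrable lborel u"
  shows "fourier (\<lambda>x. LBINT y. G (x - y) * u y) \<xi> = (LBINT x. iexp (- (x \<bullet> \<xi>)) * G x) * fourier u \<xi>"
proof -
  have [measurable]: "G \<in> borel_measurable borel" "u \<in> borel_measurable borel" using G u by auto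
  let ?F = "\<lambda>x y. iexp (- (x \<bullet> \<xi>)) * (G (x - y) * u y)"
  have i: "integrable (lborel \<Otimes>\<^sub>M lborel) (case_prod ?F)"
    by (rule Bochner_Integration.integrable_bound[OF integrable_convolution(2)[OF G u]]) (auto simp: norm_mult)
  have "(LBINT x. iexp (- (x \<bullet> \<xi>)) * (LBINT y. G (x - y) * u y)) = (LBINT x. LBINT y. ?F x y)"
    unfolding integral_mult_right_zero ..
  also have "\<dots> = (LBINT y. LBINT x. ?F x y)" using lborel_pair.Fubini_integral[OF i] by simp
  also have "\<dots> = (LBINT y. (LBINT x. iexp (- (x \<bullet> \<xi>)) * G x) * (iexp (- (y \<bullet> \<xi>)) * u y))"
  proof (intro Bochner_Integration.integral_cong refl)
    fix y
    have e: "iexp (- ((x + y) \<bullet> \<xi>)) = iexp (- (x \<bullet> \<xi>)) * iexp (- (y \<bullet> \<xi>))" for x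
      by (simp add: mult_exp_exp inner_add_left algebra_simps)
    have "(LBINT x. ?F x y) = (LBINT x. ?F (x + y) y)"
      by (rule integral_translate[symmetric]) measurable
    also have "\<dots> = (LBINT x. (iexp (- (x \<bullet> \<xi>)) * G x) * (iexp (- (y \<bullet> \<xi>)) * u y))"
      unfolding e by (simp only: add_diff_cancel_right' mult_ac)
    finally show "(LBINT x. ?F x y) = (LBINT x. iexp (- (x \<bullet> \<xi>)) * G x) * (iexp (- (y \<bullet> \<xi>)) * u y)"
      by (simp only: integral_mult_left_zero)
  qed
  finally show ?thesis unfolding fourier_alt integral_mult_right_zero by (simp only: mult_ac)
qed

text \<open>The multiplier \<open>m\<close> is prescribed only almost everywhere, because the
  transforms of the kernels are computed off the origin and, in one case, also off the sphere of
  radius \<open>l\<close>.\<close>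

lemma convolution_pairing:
  assumes G: "integrable lborel G" and u: "integrable lborel u" and \<psi>: "\<psi> \<in> schwartz"
    and m: "AE \<xi> in lborel. (LBINT x. iexp (- (x \<bullet> \<xi>)) * G x) = m \<xi>" and [measurable]: "m \<in> borel_measurable borel"
  shows "(LBINT x. (LBINT y. G (x - y) * u y) * \<psi> x) = (LBINT \<xi>. m \<xi> * (fourier u \<xi> * fourier_inv \<psi> \<xi>))"
proof -
  have [measurable]: "G \<in> borel_measurable borel" "u \<in> borel_measurable borel" "\<psi> \<in> borel_measurable borel"
    using G u \<psi> by auto
  have [measurable]: "fourier_inv \<psi> \<in> borel_measurable borel" using schwartz_fourier_inv[OF \<psi>] by measurable
  have c: "integrable lborel (\<lambda>x. LBINT y. G (x - y) * u y)"
    by (rule lborel_pair.integrable_fst[OF integrable_convolution(2)[OF G u]])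
  have "(LBINT x. (LBINT y. G (x - y) * u y) * \<psi> x) =
    (LBINT x. (LBINT y. G (x - y) * u y) * fourier (fourier_inv \<psi>) x)"
    unfolding fourier_inversion'[OF \<psi>] ..
  also have "\<dots> = (LBINT \<xi>. fourier (\<lambda>x. LBINT y. G (x - y) * u y) \<xi> * fourier_inv \<psi> \<xi>)"
    by (rule fourier_multiplication[OF c schwartz_integrable[OF schwartz_fourier_inv[OF \<psi>]]])
  also have "\<dots> = (LBINT \<xi>. m \<xi> * (fourier u \<xi> * fourier_inv \<psi> \<xi>))"
    unfolding fourier_convolution[OF G u]
    by (rule integral_cong_AE; (measurable)?) (use m in eventually_elim, simp)
  finally show ?thesis .
qed

section \<open>The sine and cosine integrals\<close>

lemma integral_cexp_Icc:
  fixes w :: complex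
  assumes w: "w \<noteq> 0" and ab: "a \<le> b"
  shows "(LBINT s. indicator {a..b} s *\<^sub>R exp (- (w * of_real s))) = (exp (- (w * of_real a)) - exp (- (w * of_real b))) / w"
proof -
  have "(LBINT s. indicator {a..b} s *\<^sub>R exp (- (w * of_real s))) = - exp (- (w * of_real b)) / w - (- exp (- (w * of_real a)) / w)"
  proof (rule integral_FTC_Icc[OF ab])
    show "((\<lambda>s. - exp (- (w * of_real s)) / w) has_vector_derivative exp (- (w * of_real s))) (at s within {a..b})" for s
      by (rule has_vector_derivative_real_field) (use w in \<open>auto intro!: derivative_eq_intros\<close>)
  qed (intro continuous_intros)
  then show ?thesis using w by (simp add: diff_divide_distrib)
qed

text \<open>A Laplace representation of \<open>\<integral>\<^sub>\<rho>\<^sup>\<infinity> e\<^sup>i\<^sup>s / s ds\<close>, obtained from \<open>1 / s = \<integral>\<^sub>0\<^sup>\<infinity> e\<^sup>-\<^sup>s\<^sup>t dt\<close>; it converges absolutely.\<close>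

definition exp_integral_tail :: "real \<Rightarrow> complex" where
  "exp_integral_tail \<rho> = (LBINT t. indicator {0..} t *\<^sub>R (exp (- ((of_real t - \<i>) * of_real \<rho>)) / (of_real t - \<i>)))"

lemma norm_shift_ge1: "norm (of_real t - \<i>) \<ge> 1" and shift_neq0: "of_real t - \<i> \<noteq> 0"
proof -
  show "norm (of_real t - \<i>) \<ge> 1" using abs_Im_le_cmod[of "of_real t - \<i>"] by simp
  then show "of_real t - \<i> \<noteq> 0" by auto
qed

lemma exp_integral_tail_bound:
  "norm (indicator {0..} t *\<^sub>R (exp (- ((of_real t - \<i>) * of_real \<rho>)) / (of_real t - \<i>))) \<le> indicator {0..} t * exp (- (\<rho> * t))"
proof -
  have "exp (- (t * \<rho>)) / norm (of_real t - \<i>) \<le> exp (- (t * \<rho>)) / 1" by (rule divide_left_mono) (use norm_shift_ge1[of t] in \<open>auto intro: mult_pos_pos\<close>)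
  then show ?thesis by (auto simp: indicator_def norm_divide mult.commute)
qed

lemma
  assumes \<rho>: "\<rho> > 0"
  shows integrable_exp_integral_tail: "integrable lborel (\<lambda>t. indicator {0..} t *\<^sub>R (exp (- ((of_real t - \<i>) * of_real \<rho>)) / (of_real t - \<i>)))"
    and norm_exp_integral_tail: "norm (exp_integral_tail \<rho>) \<le> 1 / \<rho>"
proof -
  show i: "integrable lborel (\<lambda>t. indicator {0..} t *\<^sub>R (exp (- ((of_real t - \<i>) * of_real \<rho>)) / (of_real t - \<i>)))"
    by (rule Bochner_Integration.integrable_bound[OF integrable_exp_Ici[OF \<rho>]])
      (measurable, intro AE_I2 order_trans[OF exp_integral_tail_bound], simp only: real_norm_def abs_ge_self)
  have "norm (exp_integral_tail \<rho>) \<le> (LBINT t. norm (indicator {0..} t *\<^sub>R (exp (- ((of_real t - \<i>) * of_real \<rho>)) / (of_real t - \<i>))))"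
    unfolding exp_integral_tail_def by (rule integral_norm_bound)
  also have "\<dots> \<le> (LBINT t. indicator {0..} t * exp (- (\<rho> * t)))"
    by (intro integral_mono integrable_norm i integrable_exp_Ici \<rho> exp_integral_tail_bound)
  finally show "norm (exp_integral_tail \<rho>) \<le> 1 / \<rho>" unfolding integral_exp_Ici[OF \<rho>] .
qed

text \<open>Fubini for \<open>exp (- (t - i) s)\<close> on \<open>[\<rho>, R]\<close> times the
  half-line: integrated over \<open>t\<close> it gives \<open>iexp s / s\<close>, integrated over
  \<open>s\<close> the difference of two tails.\<close>

lemma integral_iexp_over:
  assumes \<rho>: "0 < \<rho>" and R: "\<rho> \<le> R"
  shows "(LINT s:{\<rho>..R}|lborel. iexp s / of_real s) = exp_integral_tail \<rho> - exp_integral_tail R"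
proof -
  have R0: "R > 0" using \<rho> R by simp
  let ?W = "\<lambda>s t. indicator {\<rho>..R} s *\<^sub>R (indicator {0..} t *\<^sub>R exp (- ((complex_of_real t - \<i>) * of_real s)))"
  have i1: "integrable lborel (\<lambda>s::real. complex_of_real (indicator {\<rho>..R} s))"
    by (intro integrable_of_real integrable_real_indicator) (use R in auto)
  have i2: "integrable lborel (\<lambda>t. complex_of_real (indicator {0..} t * exp (- (\<rho> * t))))"
    by (intro integrable_of_real integrable_exp_Ici \<rho>)
  have i: "integrable (lborel \<Otimes>\<^sub>M lborel) (case_prod ?W)"
  proof (rule integrable_product_bound[OF i1 i2])
    show "case_prod ?W \<in> borel_measurable (lborel \<Otimes>\<^sub>M lborel)" by measurable
    show "norm (case_prod ?W (s, t)) \<le> norm (complex_of_real (indicator {\<rho>..R} s)) * norm (complex_of_real (indicator {0..} t * exp (- (\<rho> * t))))" for s t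
      by (auto simp: indicator_def mult.commute[of t] intro!: mult_right_mono)
  qed
  have "(LBINT s. LBINT t. ?W s t) = (LBINT t. LBINT s. ?W s t)"
    using lborel_pair.Fubini_integral[OF i] by simp
  moreover have "(LBINT t. ?W s t) = indicator {\<rho>..R} s *\<^sub>R (iexp s / of_real s)" for s
  proof (cases "s \<in> {\<rho>..R}")
    case True
    then have s: "Re (complex_of_real s) > 0" using \<rho> by simp
    have "(LBINT t. ?W s t) = (LBINT t. iexp s * (indicator {0..} t *\<^sub>R exp (- (of_real s * of_real t))))"
    proof -
      have "exp (- ((of_real t - \<i>) * of_real s)) = iexp s * exp (- (of_real s * of_real t))" for t
        by (simp add: mult_exp_exp algebra_simps)
      then show ?thesis using True by (simp only: indicator_simps scaleR_one mult_scaleR_right)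
    qed
    also have "\<dots> = iexp s * (1 / of_real s)" by (simp only: integral_mult_right_zero integral_cexp_Ici[OF s])
    finally show ?thesis using True by simp
  qed simp
  moreover have "(LBINT s. ?W s t) = indicator {0..} t *\<^sub>R (exp (- ((of_real t - \<i>) * of_real \<rho>)) / (of_real t - \<i>))
    - indicator {0..} t *\<^sub>R (exp (- ((of_real t - \<i>) * of_real R)) / (of_real t - \<i>))" for t
  proof -
    have "(LBINT s. ?W s t) = indicator {0..} t *\<^sub>R (LBINT s. indicator {\<rho>..R} s *\<^sub>R exp (- ((of_real t - \<i>) * of_real s)))"
      unfolding integral_scaleR_right[symmetric] by (simp only: scaleR_left_commute)
    then show ?thesis unfolding integral_cexp_Icc[OF shift_neq0 R] by (simp add: diff_divide_distrib scaleR_diff_right)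
  qed
  ultimately have "(LINT s:{\<rho>..R}|lborel. iexp s / of_real s) = (LBINT t. indicator {0..} t *\<^sub>R (exp (- ((of_real t - \<i>) * of_real \<rho>)) / (of_real t - \<i>))
    - indicator {0..} t *\<^sub>R (exp (- ((of_real t - \<i>) * of_real R)) / (of_real t - \<i>)))"
    unfolding set_lebesgue_integral_def by simp
  also have "\<dots> = exp_integral_tail \<rho> - exp_integral_tail R"
    unfolding exp_integral_tail_def
    by (intro Bochner_Integration.integral_diff integrable_exp_integral_tail \<rho> R0)
  finally show ?thesis .
qed

text \<open>The tail at \<open>R\<close> is at most \<open>1 / R\<close>, which makes the improper
  integrals converge and identifies their values.\<close>

lemma
  assumes \<rho>: "\<rho> > 0"
  shows ci_eq: "ci \<rho> = Re (exp_integral_tail \<rho>)" and si_eq: "si \<rho> = - Im (exp_integral_tail \<rho>)"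
proof -
  have si: "set_integrable lborel {\<rho>..R} (\<lambda>s. iexp s / of_real s)" for R
    by (rule borel_integrable_atLeastAtMost', intro continuous_intros) (use \<rho> in auto)
  have c: "integral {\<rho>..R} (\<lambda>t. cos t / t) = Re (exp_integral_tail \<rho> - exp_integral_tail R)"
    and s: "integral {\<rho>..R} (\<lambda>t. sin t / t) = Im (exp_integral_tail \<rho> - exp_integral_tail R)" if R: "\<rho> \<le> R" for R
  proof -
    have r: "Re (indicator {\<rho>..R} t *\<^sub>R (iexp t / of_real t)) = indicator {\<rho>..R} t *\<^sub>R (cos t / t)"
      "Im (indicator {\<rho>..R} t *\<^sub>R (iexp t / of_real t)) = indicator {\<rho>..R} t *\<^sub>R (sin t / t)" for t
      by (simp_all add: Re_exp Im_exp Re_divide_of_real Im_divide_of_real)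
    have "set_integrable lborel {\<rho>..R} (\<lambda>t. cos t / t)"
      by (rule borel_integrable_atLeastAtMost', intro continuous_intros) (use \<rho> in auto)
    from set_borel_integral_eq_integral(2)[OF this]
    show "integral {\<rho>..R} (\<lambda>t. cos t / t) = Re (exp_integral_tail \<rho> - exp_integral_tail R)"
      using Bochner_Integration.integral_Re[OF si[unfolded set_integrable_def], of R, unfolded r] integral_iexp_over[OF \<rho> R]
      unfolding set_lebesgue_integral_def by simp
    have "set_integrable lborel {\<rho>..R} (\<lambda>t. sin t / t)"
      by (rule borel_integrable_atLeastAtMost', intro continuous_intros) (use \<rho> in auto)
    from set_borel_integral_eq_integral(2)[OF this]
    show "integral {\<rho>..R} (\<lambda>t. sin t / t) = Im (exp_integral_tail \<rho> - exp_integral_tail R)"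
      using Bochner_Integration.integral_Im[OF si[unfolded set_integrable_def], of R, unfolded r] integral_iexp_over[OF \<rho> R]
      unfolding set_lebesgue_integral_def by simp
  qed
  have ev: "\<forall>\<^sub>F R in at_top. \<rho> \<le> R" by (rule eventually_ge_at_top)
  have "(exp_integral_tail \<longlongrightarrow> 0) at_top"
  proof (rule Lim_null_comparison)
    show "\<forall>\<^sub>F R in at_top. norm (exp_integral_tail R) \<le> 1 / R"
      using eventually_gt_at_top[of "0::real"] by eventually_elim (rule norm_exp_integral_tail)
    show "((\<lambda>R::real. 1 / R) \<longlongrightarrow> 0) at_top" by real_asymp
  qed
  then have l: "((\<lambda>R. exp_integral_tail \<rho> - exp_integral_tail R) \<longlongrightarrow> exp_integral_tail \<rho>) at_top"
    using tendsto_diff[OF tendsto_const] by fastforce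
  have "((\<lambda>R. integral {\<rho>..R} (\<lambda>t. cos t / t)) \<longlongrightarrow> Re (exp_integral_tail \<rho>)) at_top"
    by (rule Lim_transform_eventually[OF tendsto_Re[OF l]]) (use ev in eventually_elim, simp add: c)
  then show "ci \<rho> = Re (exp_integral_tail \<rho>)" unfolding ci_def by (intro tendsto_Lim) auto
  have "((\<lambda>R. integral {\<rho>..R} (\<lambda>t. sin t / t)) \<longlongrightarrow> Im (exp_integral_tail \<rho>)) at_top"
    by (rule Lim_transform_eventually[OF tendsto_Im[OF l]]) (use ev in eventually_elim, simp add: s)
  then have "Lim at_top (\<lambda>R. integral {\<rho>..R} (\<lambda>t. sin t / t)) = Im (exp_integral_tail \<rho>)" by (intro tendsto_Lim) auto
  then show "si \<rho> = - Im (exp_integral_tail \<rho>)" unfolding si_def by simp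
qed

text \<open>Multiplication by \<open>iexp (- \<rho>)\<close> removes the oscillation from the tail,
  and the combination on the left is minus the imaginary part of the product. The imaginary part of
  \<open>1 / (t - i)\<close> is \<open>1 / (1 + t^2)\<close>.\<close>

lemma sin_ci_cos_si:
  assumes \<rho>: "\<rho> > 0"
  shows "sin \<rho> * ci \<rho> + cos \<rho> * si \<rho> = - (LBINT t. indicator {0..} t * (exp (- (\<rho> * t)) / (1 + t\<^sup>2)))"
proof -
  let ?J = "\<lambda>t. indicator {0..} t *\<^sub>R (exp (- ((of_real t - \<i>) * of_real \<rho>)) / (of_real t - \<i>))"
  have e: "iexp (- \<rho>) * ?J t = indicator {0..} t *\<^sub>R (of_real (exp (- (\<rho> * t)) / (1 + t\<^sup>2)) * (of_real t + \<i>))" for t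
  proof -
    have "(of_real t - \<i>) * (of_real t + \<i>) = of_real (1 + t\<^sup>2)" by (simp add: algebra_simps power2_eq_square)
    then have d: "1 / (of_real t - \<i>) = (of_real t + \<i>) / of_real (1 + t\<^sup>2)"
    proof (subst frac_eq_eq[OF shift_neq0])
      show "complex_of_real (1 + t\<^sup>2) \<noteq> 0" unfolding of_real_eq_0_iff by (simp add: add_nonneg_eq_0_iff)
    qed (metis mult.commute mult_1)
    have "iexp (- \<rho>) * exp (- ((of_real t - \<i>) * of_real \<rho>)) = of_real (exp (- (\<rho> * t)))"
      by (simp add: mult_exp_exp algebra_simps flip: exp_of_real)
    then have "iexp (- \<rho>) * ?J t = indicator {0..} t *\<^sub>R (of_real (exp (- (\<rho> * t))) * (1 / (of_real t - \<i>)))"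
      by (simp add: scaleR_conv_of_real mult_ac)
    then show ?thesis unfolding d by simp
  qed
  have "sin \<rho> * ci \<rho> + cos \<rho> * si \<rho> = - Im (iexp (- \<rho>) * exp_integral_tail \<rho>)"
    unfolding ci_eq[OF \<rho>] si_eq[OF \<rho>] by (simp add: Re_exp Im_exp algebra_simps)
  also have "iexp (- \<rho>) * exp_integral_tail \<rho> = (LBINT t. iexp (- \<rho>) * ?J t)"
    unfolding exp_integral_tail_def by (rule integral_mult_right_zero[symmetric])
  also have "Im \<dots> = (LBINT t. Im (iexp (- \<rho>) * ?J t))"
    by (rule Bochner_Integration.integral_Im[symmetric]) (intro integrable_mult_right integrable_exp_integral_tail \<rho>)
  also have "\<dots> = (LBINT t. indicator {0..} t * (exp (- (\<rho> * t)) / (1 + t\<^sup>2)))"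
    unfolding e by simp
  finally show ?thesis .
qed

section \<open>The kernel of \<open>(H\<^sub>0 + \<lambda>)\<^bsup>-1\<^esup>\<close>\<close>

lemma
  assumes c: "c > 0"
  shows integrable_inverse_square_plus: "integrable lborel (\<lambda>k::real. indicator {0..} k / (k\<^sup>2 + c\<^sup>2))"
    and integral_inverse_square_plus: "(LBINT k. indicator {0..} k / (k\<^sup>2 + c\<^sup>2)) = pi / (2 * c)"
proof -
  have c0: "c \<noteq> 0" using c by simp
  have i: "indicator {0..} (c * k) = (indicator {0..} k :: real)" for k :: real using c by (auto simp: indicator_def zero_le_mult_iff)
  have e: "indicator {0..} (c * k) / ((c * k)\<^sup>2 + c\<^sup>2) = (1 / c\<^sup>2) * (indicator {0..} k / (1 + k\<^sup>2))" for k :: real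
    unfolding i using c by (simp add: power_mult_distrib distrib_left[symmetric] add.commute flip: distrib_left)
      (simp add: algebra_simps)
  have e': "indicator {0..} k / (k\<^sup>2 + c\<^sup>2) = (1 / c\<^sup>2) * (indicator {0..} (0 + (1/c) *\<^sub>R k) / (1 + (0 + (1/c) *\<^sub>R k)\<^sup>2))" for k :: real
    using e[of "k / c"] c by simp
  show "integrable lborel (\<lambda>k::real. indicator {0..} k / (k\<^sup>2 + c\<^sup>2))"
    unfolding e' by (intro integrable_mult_right lborel_integrable_affine integrable_inverse_square_plus1) (use c in simp)
  have "(LBINT k. indicator {0..} k / (k\<^sup>2 + c\<^sup>2)) = c * (LBINT k. (1 / c\<^sup>2) * (indicator {0..} k / (1 + k\<^sup>2)))"
    using lborel_integral_affine[OF c0, of "\<lambda>k. indicator {0..} k / (k\<^sup>2 + c\<^sup>2) :: real" 0] c by (simp add: e del: times_divide_eq_left)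
  then show "(LBINT k. indicator {0..} k / (k\<^sup>2 + c\<^sup>2)) = pi / (2 * c)"
    unfolding integral_mult_right_zero integral_inverse_square_plus1 using c by (simp add: power2_eq_square)
qed

text \<open>The identity \<open>1 / (r + l) = (2 / \<pi>) \<integral>\<^sub>0\<^sup>\<infinity> k\<^sup>2 / ((k\<^sup>2 + l\<^sup>2) (k\<^sup>2 + r\<^sup>2)) dk\<close> writes \<open>(H\<^sub>0 + l)\<^bsup>-1\<^esup>\<close> as a
  superposition of the resolvents \<open>(k\<^sup>2 - \<Delta>)\<^bsup>-1\<^esup>\<close>, whose kernels are the Yukawa kernels.\<close>

definition half_kernel :: "real \<Rightarrow> real^3 \<Rightarrow> real" where
  "half_kernel l x = 2 / pi * (LBINT k. indicator {0..} k * (k\<^sup>2 / (k\<^sup>2 + l\<^sup>2) * (exp (- (k * norm x)) / (4 * pi * norm x))))"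

text \<open>The decomposition in \<open>k^2\<close> degenerates at \<open>r = l\<close>. On the
  frequency side this leaves out the sphere of radius \<open>l\<close>, a null set.\<close>

lemma integral_partial_fractions:
  assumes l: "l > 0" and r: "r > 0" and rl: "r \<noteq> l"
  shows "(LBINT k. indicator {0..} k * (k\<^sup>2 / (k\<^sup>2 + l\<^sup>2) * (1 / (r\<^sup>2 + k\<^sup>2)))) = pi / (2 * (r + l))"
proof -
  have n: "r\<^sup>2 - l\<^sup>2 \<noteq> 0" using assms by (simp add: power2_eq_iff)
  have "indicator {0..} k * (k\<^sup>2 / (k\<^sup>2 + l\<^sup>2) * (1 / (r\<^sup>2 + k\<^sup>2))) =
    (r\<^sup>2 / (r\<^sup>2 - l\<^sup>2)) * (indicator {0..} k / (k\<^sup>2 + r\<^sup>2)) - (l\<^sup>2 / (r\<^sup>2 - l\<^sup>2)) * (indicator {0..} k / (k\<^sup>2 + l\<^sup>2))" for k :: real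
  proof -
    have p: "k\<^sup>2 + l\<^sup>2 \<noteq> 0" "k\<^sup>2 + r\<^sup>2 \<noteq> 0" using l r by (auto simp: add_nonneg_eq_0_iff)
    have "K / (K + L) * (1 / (R + K)) = R / (R - L) * (1 / (K + R)) - L / (R - L) * (1 / (K + L))"
      if "K + L \<noteq> 0" "K + R \<noteq> 0" "R - L \<noteq> 0" for K L R :: real
      using that by (simp add: divide_simps) (auto simp: algebra_simps)
    from this[OF p n] show ?thesis by (cases "k \<ge> 0") auto
  qed
  then have "(LBINT k. indicator {0..} k * (k\<^sup>2 / (k\<^sup>2 + l\<^sup>2) * (1 / (r\<^sup>2 + k\<^sup>2)))) =
    (r\<^sup>2 / (r\<^sup>2 - l\<^sup>2)) * (pi / (2 * r)) - (l\<^sup>2 / (r\<^sup>2 - l\<^sup>2)) * (pi / (2 * l))"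
    using integrable_inverse_square_plus[OF l] integrable_inverse_square_plus[OF r]
    by (simp only:, subst Bochner_Integration.integral_diff)
      (auto simp only: integral_mult_right_zero integrable_mult_right integral_inverse_square_plus[OF l] integral_inverse_square_plus[OF r])
  also have "\<dots> = (pi / 2) * ((r - l) / (r\<^sup>2 - l\<^sup>2))"
    using l r n by (simp add: power2_eq_square diff_divide_distrib algebra_simps)
  also have "r\<^sup>2 - l\<^sup>2 = (r - l) * (r + l)" by (simp add: power2_eq_square algebra_simps)
  finally show ?thesis using rl by simp
qed

text \<open>Writing \<open>k^2 / (k^2 + l^2)\<close> as \<open>1 - l^2 / (k^2 + l^2)\<close>
  separates the term in \<open>1 / |x|^2\<close> from an integral that, after
  \<open>k = l t\<close>, is the one of \<open>sin_ci_cos_si\<close> at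
  \<open>l |x|\<close>.\<close>

lemma half_kernel_eq:
  assumes l: "l > 0"
  shows "half_kernel l x = 1 / (2 * pi\<^sup>2 * (norm x)\<^sup>2) + m_ker l x"
proof (cases "x = 0")
  \<comment> \<open>Division by zero makes both sides 0 at the origin.\<close>
  case True then show ?thesis by (simp add: half_kernel_def m_ker_def)
next
  case False
  define a where "a = norm x"
  have a: "a > 0" unfolding a_def using False by simp
  let ?f = "LBINT t. indicator {0..} t * (exp (- (l * a * t)) / (1 + t\<^sup>2))"
  let ?g = "\<lambda>k. indicator {0..} k * (l\<^sup>2 / (k\<^sup>2 + l\<^sup>2) * exp (- (k * a)))"
  have ig: "integrable lborel ?g"
  proof (rule Bochner_Integration.integrable_bound[OF integrable_exp_Ici[OF a]])
    have "l\<^sup>2 / (k\<^sup>2 + l\<^sup>2) * exp (- (k * a)) \<le> 1 * exp (- (a * k))" for k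
      using l by (intro mult_mono) (auto simp: divide_le_eq add_nonneg_pos mult.commute)
    then show "AE k in lborel. norm (?g k) \<le> norm (indicator {0..} k * exp (- (a * k)))"
      by (auto simp: indicator_def abs_mult)
  qed measurable
  have "(LBINT k. ?g k) = l * ?f"
  proof -
    have "?g (0 + l *\<^sub>R t) = indicator {0..} t * (exp (- (l * a * t)) / (1 + t\<^sup>2))" for t
    proof -
      have "l\<^sup>2 / ((l * t)\<^sup>2 + l\<^sup>2) = 1 / (1 + t\<^sup>2)"
      proof -
        have "(l * t)\<^sup>2 + l\<^sup>2 = l\<^sup>2 * (1 + t\<^sup>2)" by (simp add: power_mult_distrib algebra_simps)
        then show ?thesis using l by simp
      qed
      moreover have "indicator {0..} (l * t) = (indicator {0..} t :: real)" using l by (auto simp: indicator_def zero_le_mult_iff)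
      ultimately show ?thesis by (simp add: mult_ac)
    qed
    then show ?thesis using lborel_integral_affine[of l ?g 0] l by simp
  qed
  moreover have "indicator {0..} k * (k\<^sup>2 / (k\<^sup>2 + l\<^sup>2) * (exp (- (k * a)) / (4 * pi * a))) =
    1 / (4 * pi * a) * (indicator {0..} k * exp (- (a * k)) - ?g k)" for k
  proof -
    have "k\<^sup>2 / (k\<^sup>2 + l\<^sup>2) = 1 - l\<^sup>2 / (k\<^sup>2 + l\<^sup>2)" using l by (simp add: field_simps add_nonneg_eq_0_iff)
    then show ?thesis by (simp add: mult.commute[of k] left_diff_distrib right_diff_distrib diff_divide_distrib)
  qed
  ultimately have "half_kernel l x = 2 / pi * (1 / (4 * pi * a) * (1 / a - l * ?f))"
    unfolding half_kernel_def a_def[symmetric]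
    using Bochner_Integration.integral_diff[OF integrable_exp_Ici[OF a] ig] by (simp only: integral_mult_right_zero integral_exp_Ici[OF a])
  also have "?f = - (sin (l * a) * ci (l * a) + cos (l * a) * si (l * a))"
    using sin_ci_cos_si[of "l * a"] l a by simp
  also have "2 / pi * (1 / (4 * pi * a) * (1 / a - l * - S)) = 1 / (2 * pi\<^sup>2 * a\<^sup>2) + l / (2 * pi\<^sup>2 * a) * S" for S
    using a by (simp add: field_simps power2_eq_square)
  finally show ?thesis unfolding m_ker_def a_def .
qed

text \<open>The Yukawa kernel with parameter \<open>k\<close> has mass \<open>1 / k^2\<close>, so
  after weighting the mass in \<open>x\<close> is \<open>1 / (k^2 + l^2)\<close>. This is integrable
  in \<open>k\<close>, which makes the superposition integrable and lets the transform be taken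
  under the integral.\<close>

lemma
  assumes l: "l > 0"
  shows integrable_half_kernel: "integrable lborel (half_kernel l)"
    and half_kernel_fourier: "\<xi> \<noteq> 0 \<Longrightarrow> norm \<xi> \<noteq> l \<Longrightarrow>
      (LBINT x. iexp (- (x \<bullet> \<xi>)) * of_real (half_kernel l x)) = 1 / of_real (norm \<xi> + l)"
proof -
  let ?w = "\<lambda>k. indicator {0..} k * (k\<^sup>2 / (k\<^sup>2 + l\<^sup>2))"
  let ?H = "\<lambda>k x. complex_of_real (?w k) * yukawa (of_real k) x"
  have yr: "yukawa (of_real k) x = of_real (exp (- (k * norm x)) / (4 * pi * norm x))" for k x
    unfolding yukawa_def by (simp flip: exp_of_real)
  have half: "complex_of_real (half_kernel l x) = of_real (2 / pi) * (LBINT k. ?H k x)" for x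
    unfolding half_kernel_def yr by (simp only: of_real_mult[symmetric] integral_complex_of_real mult.assoc)
  have n0: "AE k in lborel. (k::real) \<noteq> 0" by (rule AE_lborel_singleton)
  have i: "integrable (lborel \<Otimes>\<^sub>M lborel) (case_prod ?H)"
  proof (rule lborel_pair.Fubini_integrable)
    show "case_prod ?H \<in> borel_measurable (lborel \<Otimes>\<^sub>M lborel)" by measurable
    have "AE k in lborel. indicator {0..} k / (k\<^sup>2 + l\<^sup>2) = (LBINT x. norm (case (k, x) of (k, x) \<Rightarrow> ?H k x))"
      using n0
    proof eventually_elim
      case (elim k)
      show ?case
      proof (cases "k > 0")
        case True
        have "norm (?H k x) = ?w k * (1 / (4 * pi) * (exp (- (k * norm x)) / norm x))" for x
          unfolding norm_mult norm_yukawa norm_of_real using True by simp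
        then have "(LBINT x. norm (?H k x)) = ?w k * (1 / (4 * pi) * (4 * pi / k\<^sup>2))"
          by (simp only: integral_mult_right_zero integral_exp_over_norm[OF True])
        then show ?thesis using True by simp
      qed (use elim in simp)
    qed
    then show "integrable lborel (\<lambda>k. LBINT x. norm (case (k, x) of (k, x) \<Rightarrow> ?H k x))"
      by (rule integrable_cong_AE[THEN iffD1, rotated 2, OF _ integrable_inverse_square_plus[OF l]]) measurable
    show "AE k in lborel. integrable lborel (\<lambda>x. case (k, x) of (k, x) \<Rightarrow> ?H k x)"
      using n0
    proof eventually_elim
      case (elim k)
      show ?case
      proof (cases "k > 0")
        case True
        have "Re (complex_of_real k) > 0" using True by simp
        from integrable_mult_right[OF integrable_yukawa[OF this]] show ?thesis by simp
      qed (use elim in simp)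
    qed
  qed
  have "integrable lborel (\<lambda>x. complex_of_real (half_kernel l x))"
    unfolding half by (intro integrable_mult_right lborel_pair.integrable_snd[OF i])
  from integrable_Re[OF this] show "integrable lborel (half_kernel l)" by simp
  assume \<xi>: "\<xi> \<noteq> 0" "norm \<xi> \<noteq> l"
  let ?K = "\<lambda>k x. iexp (- (x \<bullet> \<xi>)) * ?H k x"
  have iK: "integrable (lborel \<Otimes>\<^sub>M lborel) (case_prod ?K)"
    by (rule Bochner_Integration.integrable_bound[OF i]) (measurable, intro AE_I2,
      simp only: case_prod_unfold norm_mult[of "iexp _"] norm_exp_i_times mult_1 order_refl)
  have "(LBINT x. iexp (- (x \<bullet> \<xi>)) * of_real (half_kernel l x)) = of_real (2 / pi) * (LBINT x. LBINT k. ?K k x)"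
    unfolding half integral_mult_right_zero[symmetric] by (simp only: mult.left_commute)
  also have "(LBINT x. LBINT k. ?K k x) = (LBINT k. LBINT x. ?K k x)"
    using lborel_pair.Fubini_integral[OF iK] by simp
  also have "\<dots> = (LBINT k. complex_of_real (indicator {0..} k * (k\<^sup>2 / (k\<^sup>2 + l\<^sup>2) * (1 / ((norm \<xi>)\<^sup>2 + k\<^sup>2)))))"
  proof (rule integral_cong_AE)
    show "AE k in lborel. (LBINT x. ?K k x) = complex_of_real (indicator {0..} k * (k\<^sup>2 / (k\<^sup>2 + l\<^sup>2) * (1 / ((norm \<xi>)\<^sup>2 + k\<^sup>2))))"
      using n0
    proof eventually_elim
      case (elim k)
      show ?case
      proof (cases "k > 0")
        case True
        then have k: "Re (complex_of_real k) > 0" by simp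
        have "(LBINT x. ?K k x) = of_real (?w k) * (LBINT x. iexp (- (x \<bullet> \<xi>)) * yukawa (of_real k) x)"
          unfolding mult.left_commute[of _ "complex_of_real (?w k)"] integral_mult_right_zero ..
        then show ?thesis unfolding yukawa_fourier[OF k \<xi>(1)] by (simp add: mult.assoc)
      qed (use elim in simp)
    qed
  qed measurable
  also have "\<dots> = of_real (pi / (2 * (norm \<xi> + l)))"
    unfolding integral_complex_of_real using l \<xi> by (subst integral_partial_fractions) auto
  also have "of_real (2 / pi) * complex_of_real (pi / (2 * (norm \<xi> + l))) = 1 / of_real (norm \<xi> + l)"
  proof -
    have "2 / pi * (pi / (2 * c)) = 1 / c" for c by simp
    then show ?thesis unfolding of_real_mult[symmetric] by (simp only: of_real_divide of_real_1)
  qed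
  finally show "(LBINT x. iexp (- (x \<bullet> \<xi>)) * of_real (half_kernel l x)) = 1 / of_real (norm \<xi> + l)" .
qed

section \<open>Passage to the limit\<close>

text \<open>As \<open>Re \<kappa>\<close> tends to 0 the Yukawa kernel is bounded uniformly by a
  multiple of \<open>1 / |x|\<close>, which is not integrable at infinity. An integrable function
  plus a constant dominates it.\<close>

lemma inverse_norm_le: "1 / norm x \<le> exp 1 * (exp (- (1 * norm x)) / norm x) + 1"
proof (cases "norm x \<le> 1")
  case True
  have "1 / norm x \<le> exp (1 - norm x) / norm x" using True by (intro divide_right_mono) auto
  then show ?thesis by (simp add: exp_diff exp_minus field_simps)
next
  case False
  then have "1 / norm x \<le> 1" by (simp add: divide_le_eq)
  also have "1 \<le> exp 1 * (exp (- (1 * norm x)) / norm x) + 1" by simp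
  finally show ?thesis .
qed

text \<open>The integrable part of the bound is paired with the supremum of \<open>u\<close>, the
  constant with its L^1 norm, so the convolutions are bounded uniformly in \<open>x\<close> and in
  the parameter. When \<open>Re \<kappa>0 = 0\<close> the limit kernel is not itself integrable, and
  the two integrability claims come from this bound.\<close>

lemma yukawa_convolution_tendsto:
  fixes \<kappa> :: "nat \<Rightarrow> complex"
  assumes u: "u \<in> schwartz" and \<psi>: "integrable lborel \<psi>"
    and \<kappa>: "\<And>n. Re (\<kappa> n) \<ge> 0" "\<kappa> \<longlonglongrightarrow> \<kappa>0"
  shows "(\<lambda>n. LBINT x. (LBINT y. yukawa (\<kappa> n) (x - y) * u y) * \<psi> x)
      \<longlonglongrightarrow> (LBINT x. (LBINT y. yukawa \<kappa>0 (x - y) * u y) * \<psi> x)"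
    and "integrable lborel (\<lambda>y. yukawa \<kappa>0 (x - y) * u y)"
    and "integrable lborel (\<lambda>x. (LBINT y. yukawa \<kappa>0 (x - y) * u y) * \<psi> x)"
proof -
  have [measurable]: "u \<in> borel_measurable borel" "\<psi> \<in> borel_measurable borel" using u \<psi> by auto
  obtain B where B: "B \<ge> 0" "\<And>y. norm (u y) \<le> B" using schwartz_bounded[OF u] by blast
  have ui: "integrable lborel u" using u by (rule schwartz_integrable)
  define D where "D w = B * (exp 1 * (exp (- (1 * norm w)) / norm w))" for w :: "real^3"
  have iD: "integrable lborel D" unfolding D_def by (intro integrable_mult_right integrable_exp_over_norm) simp
  have \<kappa>0: "Re \<kappa>0 \<ge> 0"
    by (rule LIMSEQ_le_const[OF tendsto_Re[OF \<kappa>(2)]]) (use \<kappa>(1) in auto)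
  have bd: "norm (yukawa k (x - y) * u y) \<le> D (x - y) + norm (u y)" if k: "Re k \<ge> 0" for k x y
  proof -
    have "norm (yukawa k (x - y)) \<le> exp (- (Re k * norm (x - y))) / norm (x - y)" by (rule norm_yukawa_le)
    also have "\<dots> \<le> 1 / norm (x - y)" using k by (intro divide_right_mono) auto
    also have "\<dots> \<le> exp 1 * (exp (- (1 * norm (x - y))) / norm (x - y)) + 1" by (rule inverse_norm_le)
    finally have "norm (yukawa k (x - y) * u y) \<le> (exp 1 * (exp (- (1 * norm (x - y))) / norm (x - y)) + 1) * norm (u y)"
      unfolding norm_mult by (rule mult_right_mono) simp
    also have "\<dots> = exp 1 * (exp (- (1 * norm (x - y))) / norm (x - y)) * norm (u y) + norm (u y)" by (simp add: distrib_right)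
    also have "\<dots> \<le> exp 1 * (exp (- (1 * norm (x - y))) / norm (x - y)) * B + norm (u y)"
      by (intro add_right_mono mult_left_mono B) auto
    finally show ?thesis unfolding D_def by (simp only: mult_ac)
  qed
  have iDu: "integrable lborel (\<lambda>y. D (x - y) + norm (u y))" for x
    by (intro Bochner_Integration.integrable_add integrable_translate_reflect[OF iD] integrable_norm ui)
  have inn: "integrable lborel (\<lambda>y. yukawa k (x - y) * u y)" if k: "Re k \<ge> 0" for k x
  proof (rule Bochner_Integration.integrable_bound[OF iDu])
    show "AE y in lborel. norm (yukawa k (x - y) * u y) \<le> norm (D (x - y) + norm (u y))"
      by (intro AE_I2 order_trans[OF bd[OF k]]) (simp only: real_norm_def abs_ge_self)
  qed measurable
  show "integrable lborel (\<lambda>y. yukawa \<kappa>0 (x - y) * u y)" by (rule inn[OF \<kappa>0])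
  define M where "M = integral\<^sup>L lborel D + (LBINT y. norm (u y))"
  have innB: "norm (LBINT y. yukawa k (x - y) * u y) \<le> M" if k: "Re k \<ge> 0" for k x
  proof -
    have "norm (LBINT y. yukawa k (x - y) * u y) \<le> (LBINT y. norm (yukawa k (x - y) * u y))" by (rule integral_norm_bound)
    also have "\<dots> \<le> (LBINT y. D (x - y) + norm (u y))" by (intro integral_mono integrable_norm inn k iDu bd)
    also have "\<dots> = M" unfolding M_def using integrable_translate_reflect[OF iD] ui iD
      by (subst Bochner_Integration.integral_add) (auto simp: integral_translate_reflect)
    finally show ?thesis .
  qed
  have outB: "norm ((LBINT y. yukawa k (x - y) * u y) * \<psi> x) \<le> M * norm (\<psi> x)" if k: "Re k \<ge> 0" for k x
    unfolding norm_mult by (rule mult_right_mono[OF innB[OF k]]) simp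
  have iM: "integrable lborel (\<lambda>x. M * norm (\<psi> x))" using \<psi> by (intro integrable_mult_right integrable_norm)
  show "integrable lborel (\<lambda>x. (LBINT y. yukawa \<kappa>0 (x - y) * u y) * \<psi> x)"
  proof (rule Bochner_Integration.integrable_bound[OF iM])
    show "AE x in lborel. norm ((LBINT y. yukawa \<kappa>0 (x - y) * u y) * \<psi> x) \<le> norm (M * norm (\<psi> x))"
      by (intro AE_I2 order_trans[OF outB[OF \<kappa>0]]) (simp only: real_norm_def abs_ge_self)
  qed measurable
  have il: "(\<lambda>n. LBINT y. yukawa (\<kappa> n) (x - y) * u y) \<longlonglongrightarrow> (LBINT y. yukawa \<kappa>0 (x - y) * u y)" for x
  proof (rule integral_dominated_convergence[OF _ _ iDu])
    have "(\<lambda>n. yukawa (\<kappa> n) w) \<longlonglongrightarrow> yukawa \<kappa>0 w" for w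
      unfolding yukawa_def divide_inverse by (intro tendsto_intros \<kappa>(2))
    then show "AE y in lborel. (\<lambda>n. yukawa (\<kappa> n) (x - y) * u y) \<longlonglongrightarrow> yukawa \<kappa>0 (x - y) * u y"
      by (intro AE_I2 tendsto_intros)
    show "AE y in lborel. norm (yukawa (\<kappa> n) (x - y) * u y) \<le> D (x - y) + norm (u y)" for n
      by (intro AE_I2 bd \<kappa>(1))
  qed measurable
  show "(\<lambda>n. LBINT x. (LBINT y. yukawa (\<kappa> n) (x - y) * u y) * \<psi> x)
      \<longlonglongrightarrow> (LBINT x. (LBINT y. yukawa \<kappa>0 (x - y) * u y) * \<psi> x)"
  proof (rule integral_dominated_convergence[OF _ _ iM])
    show "AE x in lborel. (\<lambda>n. (LBINT y. yukawa (\<kappa> n) (x - y) * u y) * \<psi> x) \<longlonglongrightarrow> (LBINT y. yukawa \<kappa>0 (x - y) * u y) * \<psi> x"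
      by (intro AE_I2 tendsto_intros il)
    show "AE x in lborel. norm ((LBINT y. yukawa (\<kappa> n) (x - y) * u y) * \<psi> x) \<le> M * norm (\<psi> x)" for n
      by (intro AE_I2 outB \<kappa>(1))
  qed measurable
qed

lemma pairing_R0_split:
  assumes u: "u \<in> schwartz" and v: "v \<in> schwartz" and l: "l > 0" and \<sigma>: "\<sigma> = 1 \<or> \<sigma> = -1" and \<mu>: "\<mu> > 0"
  defines "z \<equiv> Complex l (\<sigma> * \<mu>)" and "\<psi> \<equiv> \<lambda>x. cnj (v x)"
  shows "pairing (R0 z u) v = (LBINT \<xi>. 1 / (of_real (norm \<xi>) + z) * (fourier u \<xi> * fourier_inv \<psi> \<xi>))
    + 2 * z * (LBINT x. (LBINT y. yukawa (Complex \<mu> (- (\<sigma> * l))) (x - y) * u y) * \<psi> x)"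
proof -
  define \<kappa> where "\<kappa> = Complex \<mu> (- (\<sigma> * l))"
  have \<psi>: "\<psi> \<in> schwartz" unfolding \<psi>_def by (rule schwartz_cnj[OF v])
  have Rk: "Re \<kappa> > 0" unfolding \<kappa>_def using \<mu> by simp
  have Imz: "Im z \<noteq> 0" unfolding z_def using \<sigma> \<mu> by auto
  \<comment> \<open>\<open>\<kappa> = - i \<sigma> z\<close> is the square root of
    \<open>- z^2\<close> with positive real part. Demanding decay is what ties the side from which
    the real axis is approached to the sign in the exponent of the limit wave.\<close>
  have k2: "\<kappa>\<^sup>2 = - z\<^sup>2"
    unfolding \<kappa>_def z_def using \<sigma> by (auto simp: complex_eq_iff power2_eq_square)
  define W where "W \<xi> = fourier u \<xi> * fourier_inv \<psi> \<xi>" for \<xi>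
  have iW: "integrable lborel W" unfolding W_def
    by (intro tempered_schwartz_integrable L2_tempered schwartz_L2w schwartz_fourier schwartz_fourier_inv u \<psi>)
  then have [measurable]: "W \<in> borel_measurable borel" by simp
  have n1: "of_real r - z \<noteq> 0" for r using Imz by (auto simp: complex_eq_iff)
  have n2: "of_real r + z \<noteq> 0" for r using Imz by (auto simp: complex_eq_iff)
  have b1: "norm (1 / (of_real r + z)) \<le> 1 / \<bar>Im z\<bar>" and b2: "norm (1 / (of_real r - z)) \<le> 1 / \<bar>Im z\<bar>" for r
    using abs_Im_le_cmod[of "of_real r + z"] abs_Im_le_cmod[of "of_real r - z"] Imz n1[of r] n2[of r]
    by (auto simp: norm_divide intro!: divide_left_mono)
  have pf: "1 / (of_real r - z) = 1 / (of_real r + z) + 2 * z * (1 / (of_real (r\<^sup>2) + \<kappa>\<^sup>2))" for r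
  proof -
    have "of_real (r\<^sup>2) + \<kappa>\<^sup>2 = (of_real r - z) * (of_real r + z)" unfolding k2 by (simp add: power2_eq_square algebra_simps)
    moreover have "1 / A = 1 / C + (C - A) * (1 / (A * C))" if "A \<noteq> 0" "C \<noteq> 0" for A C :: complex
      using that by (simp add: divide_simps)
    from this[OF n1 n2] have "1 / (of_real r - z) = 1 / (of_real r + z) + (of_real r + z - (of_real r - z)) * (1 / ((of_real r - z) * (of_real r + z)))" .
    ultimately show ?thesis by simp
  qed
  have i1: "integrable lborel (\<lambda>\<xi>. 1 / (of_real (norm \<xi>) + z) * W \<xi>)"
  proof (rule Bochner_Integration.integrable_bound[OF integrable_mult_right[OF integrable_norm[OF iW], of "1 / \<bar>Im z\<bar>"]])
    show "AE \<xi> in lborel. norm (1 / (of_real (norm \<xi>) + z) * W \<xi>) \<le> norm (1 / \<bar>Im z\<bar> * norm (W \<xi>))"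
      using b1 by (intro AE_I2) (simp only: norm_mult real_norm_def abs_mult abs_norm_cancel abs_divide abs_one abs_abs mult_right_mono norm_ge_zero)
  qed measurable
  have i2: "integrable lborel (\<lambda>\<xi>. 1 / (of_real (norm \<xi>) - z) * W \<xi>)"
  proof (rule Bochner_Integration.integrable_bound[OF integrable_mult_right[OF integrable_norm[OF iW], of "1 / \<bar>Im z\<bar>"]])
    show "AE \<xi> in lborel. norm (1 / (of_real (norm \<xi>) - z) * W \<xi>) \<le> norm (1 / \<bar>Im z\<bar> * norm (W \<xi>))"
      using b2 by (intro AE_I2) (simp only: norm_mult real_norm_def abs_mult abs_norm_cancel abs_divide abs_one abs_abs mult_right_mono norm_ge_zero)
  qed measurable
  have e: "2 * z * (1 / (of_real ((norm \<xi>)\<^sup>2) + \<kappa>\<^sup>2) * W \<xi>) = 1 / (of_real (norm \<xi>) - z) * W \<xi> - 1 / (of_real (norm \<xi>) + z) * W \<xi>" for \<xi>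
    unfolding pf by (simp add: algebra_simps)
  have "2 * z * (LBINT x. (LBINT y. yukawa \<kappa> (x - y) * u y) * \<psi> x) = 2 * z * (LBINT \<xi>. 1 / (of_real ((norm \<xi>)\<^sup>2) + \<kappa>\<^sup>2) * W \<xi>)"
  proof -
    have "AE \<xi> in lborel. (\<xi> :: real^3) \<noteq> 0" by (rule AE_lborel_singleton)
    then have "AE \<xi> in lborel. (LBINT x. iexp (- (x \<bullet> \<xi>)) * yukawa \<kappa> x) = 1 / (of_real ((norm \<xi>)\<^sup>2) + \<kappa>\<^sup>2)"
      by eventually_elim (rule yukawa_fourier[OF Rk])
    then show ?thesis unfolding W_def
      by (subst convolution_pairing[OF integrable_yukawa[OF Rk] schwartz_integrable[OF u] \<psi>]) measurable
  qed
  also have "\<dots> = (LBINT \<xi>. 1 / (of_real (norm \<xi>) - z) * W \<xi>) - (LBINT \<xi>. 1 / (of_real (norm \<xi>) + z) * W \<xi>)"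
    unfolding integral_mult_right_zero[symmetric] e by (intro Bochner_Integration.integral_diff i1 i2)
  also have "(LBINT \<xi>. 1 / (of_real (norm \<xi>) - z) * W \<xi>) = pairing (R0 z u) v"
    unfolding pairing_R0[OF u v Imz] W_def \<psi>_def by simp
  finally show ?thesis unfolding \<kappa>_def W_def by simp
qed

lemma g_ker_eq:
  assumes "l > 0" shows "g_ker \<sigma> l x = of_real (half_kernel l x) + 2 * of_real l * yukawa (Complex 0 (- (\<sigma> * l))) x"
proof -
  have "- (Complex 0 (- (\<sigma> * l)) * of_real (norm x)) = \<i> * of_real (\<sigma> * l * norm x)" by (simp add: complex_eq_iff)
  then show ?thesis unfolding g_ker_def half_kernel_eq[OF assms] yukawa_def by simp
qed

theorem theorem4p1:
  fixes s l \<sigma> :: real and T :: "cfun3 \<Rightarrow> cfun3" and u v :: cfun3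
  assumes "s > 1/2" and "l > 0" and "\<sigma> = 1 \<or> \<sigma> = -1"
    and "R0_boundary_value \<sigma> s l T"
    and "u \<in> C0_infty" and "v \<in> C0_infty"
  shows "pairing (T u) v =
    (LINT x|lborel. (LINT y|lborel. g_ker \<sigma> l (x - y) * u y) * cnj (v x))"
proof -
  note l = assms(2) and \<sigma> = assms(3)
  have u: "u \<in> schwartz" and v: "v \<in> schwartz" using assms(5,6) C0_infty_schwartz by auto
  define \<psi> where "\<psi> x = cnj (v x)" for x
  have \<psi>: "\<psi> \<in> schwartz" unfolding \<psi>_def by (rule schwartz_cnj[OF v])
  have [measurable]: "u \<in> borel_measurable borel" "\<psi> \<in> borel_measurable borel" using u \<psi> by measurable
  \<comment> \<open>Dominated convergence is used along sequences, so the one-sided limit is sampled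
    at \<open>1 / (n + 1)\<close>.\<close>
  define \<mu> where "\<mu> n = 1 / real (Suc n)" for n
  have \<mu>: "\<mu> n > 0" for n unfolding \<mu>_def by simp
  have \<mu>0: "\<mu> \<longlonglongrightarrow> 0" unfolding \<mu>_def by (rule LIMSEQ_Suc[OF lim_1_over_n])
  define z where "z n = Complex l (\<sigma> * \<mu> n)" for n
  have z0: "z \<longlonglongrightarrow> of_real l"
    using tendsto_Complex[OF tendsto_const tendsto_mult[OF tendsto_const \<mu>0], of l \<sigma>]
    unfolding z_def by (simp add: complex_of_real_def)
  define \<kappa> where "\<kappa> n = Complex (\<mu> n) (- (\<sigma> * l))" for n
  define \<kappa>0 where "\<kappa>0 = Complex 0 (- (\<sigma> * l))"
  have \<kappa>: "Re (\<kappa> n) \<ge> 0" for n unfolding \<kappa>_def using \<mu>[of n] by simp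
  have \<kappa>lim: "\<kappa> \<longlonglongrightarrow> \<kappa>0" unfolding \<kappa>_def \<kappa>0_def by (intro tendsto_Complex \<mu>0 tendsto_const)
  note Y = yukawa_convolution_tendsto[OF u schwartz_integrable[OF \<psi>] \<kappa> \<kappa>lim]
  define W where "W \<xi> = fourier u \<xi> * fourier_inv \<psi> \<xi>" for \<xi>
  have iW: "integrable lborel W" unfolding W_def
    by (intro tempered_schwartz_integrable L2_tempered schwartz_L2w schwartz_fourier schwartz_fourier_inv u \<psi>)
  then have [measurable]: "W \<in> borel_measurable borel" by simp
  have "filterlim \<mu> (at_right 0) sequentially"
    unfolding filterlim_at using \<mu>0 \<mu> by (auto simp: less_imp_neq[symmetric])
  from filterlim_compose[OF pairing_R0_tendsto[OF assms(4) _ u v] this]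
  have L: "(\<lambda>n. pairing (R0 (z n) u) v) \<longlonglongrightarrow> pairing (T u) v" unfolding z_def using \<sigma> by auto
  have half: "(LINT \<xi>|lborel. 1 / (of_real (norm \<xi>) + of_real l) * W \<xi>) =
    (LINT x|lborel. (LINT y|lborel. of_real (half_kernel l (x - y)) * u y) * \<psi> x)"
  proof -
    have "AE \<xi> in lborel. (\<xi> :: real^3) \<noteq> 0" by (rule AE_lborel_singleton)
    \<comment> \<open>The frequencies left out by \<open>half_kernel_fourier\<close> form a null
      set.\<close>
    moreover have "AE \<xi> in lborel. (\<xi> :: real^3) \<notin> sphere 0 l"
      by (rule AE_not_in) (use negligible_sphere[of "0 :: real^3" l] in \<open>simp add: negligible_iff_null_sets null_sets_completion_iff\<close>)
    ultimately have m: "AE \<xi> in lborel. (LINT x|lborel. iexp (- (x \<bullet> \<xi>)) * complex_of_real (half_kernel l x)) = 1 / (of_real (norm \<xi>) + of_real l)"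
      by eventually_elim (rule half_kernel_fourier[OF l, unfolded of_real_add], simp_all)
    show ?thesis unfolding W_def
      by (rule convolution_pairing[OF integrable_of_real[OF integrable_half_kernel[OF l]] schwartz_integrable[OF u] \<psi> m, symmetric]) measurable
  qed
  have "(\<lambda>n. LINT \<xi>|lborel. 1 / (of_real (norm \<xi>) + z n) * W \<xi>) \<longlonglongrightarrow> (LINT \<xi>|lborel. 1 / (of_real (norm \<xi>) + of_real l) * W \<xi>)"
  proof (rule integral_dominated_convergence[where w = "\<lambda>\<xi>. 1 / l * norm (W \<xi>)"])
    have nz: "of_real (norm \<xi>) + complex_of_real l \<noteq> 0" for \<xi> :: "real^3"
      unfolding of_real_add[symmetric] of_real_eq_0_iff using l by (simp add: add_nonneg_pos less_imp_neq[symmetric])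
    show "AE \<xi> in lborel. (\<lambda>n. 1 / (of_real (norm \<xi>) + z n) * W \<xi>) \<longlonglongrightarrow> 1 / (of_real (norm \<xi>) + of_real l) * W \<xi>"
      by (intro AE_I2 tendsto_intros z0 nz)
    show "integrable lborel (\<lambda>\<xi>. 1 / l * norm (W \<xi>))" by (intro integrable_mult_right integrable_norm iW)
    have "norm (1 / (of_real (norm \<xi>) + z n)) \<le> 1 / l" for \<xi> :: "real^3" and n
    proof -
      have "l \<le> Re (of_real (norm \<xi>) + z n)" unfolding z_def by simp
      also have "\<dots> \<le> norm (of_real (norm \<xi>) + z n)" by (rule complex_Re_le_cmod)
      finally show ?thesis using l by (simp add: norm_divide frac_le)
    qed
    then show "AE \<xi> in lborel. norm (1 / (of_real (norm \<xi>) + z n) * W \<xi>) \<le> 1 / l * norm (W \<xi>)" for n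
      unfolding norm_mult by (intro AE_I2 mult_right_mono) auto
  qed measurable
  from tendsto_add[OF this tendsto_mult[OF tendsto_mult[OF tendsto_const z0] Y(1)], of 2]
  have "(\<lambda>n. pairing (R0 (z n) u) v) \<longlonglongrightarrow>
    (LINT x|lborel. (LINT y|lborel. of_real (half_kernel l (x - y)) * u y) * \<psi> x)
    + 2 * of_real l * (LINT x|lborel. (LINT y|lborel. yukawa \<kappa>0 (x - y) * u y) * \<psi> x)"
    unfolding half unfolding W_def z_def \<kappa>_def \<psi>_def pairing_R0_split[OF u v l \<sigma> \<mu>] .
  from LIMSEQ_unique[OF L this]
  have "pairing (T u) v = (LINT x|lborel. (LINT y|lborel. of_real (half_kernel l (x - y)) * u y) * \<psi> x)
    + 2 * of_real l * (LINT x|lborel. (LINT y|lborel. yukawa \<kappa>0 (x - y) * u y) * \<psi> x)" .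
  \<comment> \<open>The two kernels were treated in separate integrals. Merging them into
    \<open>g_ker\<close> takes integrability at both the outer and the inner level, which for the
    wave part is \<open>Y(3)\<close> and \<open>Y(2)\<close>.\<close>
  also have "\<dots> = (LINT x|lborel. (LINT y|lborel. of_real (half_kernel l (x - y)) * u y) * \<psi> x
    + 2 * of_real l * ((LINT y|lborel. yukawa \<kappa>0 (x - y) * u y) * \<psi> x))"
  proof -
    obtain B where B: "\<And>x. norm (\<psi> x) \<le> B" using schwartz_bounded[OF \<psi>] by blast
    have c: "integrable lborel (\<lambda>x. LINT y|lborel. of_real (half_kernel l (x - y)) * u y)"
      by (rule lborel_pair.integrable_fst[OF integrable_convolution(2)[OF integrable_of_real[OF integrable_half_kernel[OF l]] schwartz_integrable[OF u]]])
    have "integrable lborel (\<lambda>x. (LINT y|lborel. of_real (half_kernel l (x - y)) * u y) * \<psi> x)"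
    proof (rule Bochner_Integration.integrable_bound[OF integrable_mult_left[OF integrable_norm[OF c], of B]])
      show "(\<lambda>x. (LINT y|lborel. of_real (half_kernel l (x - y)) * u y) * \<psi> x) \<in> borel_measurable lborel"
        using c by measurable
      show "AE x in lborel. norm ((LINT y|lborel. of_real (half_kernel l (x - y)) * u y) * \<psi> x)
        \<le> norm (norm (LINT y|lborel. of_real (half_kernel l (x - y)) * u y) * B)"
        unfolding norm_mult[of _ "\<psi> _"] real_norm_def abs_mult
        by (intro AE_I2 mult_mono order_trans[OF B abs_ge_self]) auto
    qed
    then show ?thesis using Y(3) by (subst Bochner_Integration.integral_add) (auto simp only: integrable_mult_right integral_mult_right_zero)
  qed
  also have "\<dots> = (LINT x|lborel. (LINT y|lborel. g_ker \<sigma> l (x - y) * u y) * cnj (v x))"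
  proof (intro Bochner_Integration.integral_cong refl)
    fix x
    obtain B where B: "\<And>x. norm (u x) \<le> B" using schwartz_bounded[OF u] by blast
    have hm: "(\<lambda>x. complex_of_real (half_kernel l x)) \<in> borel_measurable borel" using integrable_half_kernel[OF l] by simp
    have "integrable lborel (\<lambda>y. of_real (half_kernel l (x - y)) * u y)"
    proof (rule Bochner_Integration.integrable_bound[OF integrable_mult_left[OF integrable_translate_reflect[OF integrable_half_kernel[OF l], of x], of B]])
      show "(\<lambda>y. of_real (half_kernel l (x - y)) * u y) \<in> borel_measurable lborel" using hm by measurable
      show "AE y in lborel. norm (of_real (half_kernel l (x - y)) * u y) \<le> norm (half_kernel l (x - y) * B)"
        unfolding norm_mult norm_of_real real_norm_def abs_mult by (intro AE_I2 mult_left_mono order_trans[OF B abs_ge_self]) auto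
    qed
    moreover have "g_ker \<sigma> l w * u y = of_real (half_kernel l w) * u y + 2 * of_real l * (yukawa \<kappa>0 w * u y)" for w y
      unfolding g_ker_eq[OF l] \<kappa>0_def by (simp add: distrib_right mult.assoc)
    ultimately have "(LINT y|lborel. g_ker \<sigma> l (x - y) * u y) = (LINT y|lborel. of_real (half_kernel l (x - y)) * u y)
      + 2 * of_real l * (LINT y|lborel. yukawa \<kappa>0 (x - y) * u y)"
      using Y(2)[of x] by (simp only:) (subst Bochner_Integration.integral_add, auto simp only: integrable_mult_right integral_mult_right_zero)
    then show "(LINT y|lborel. of_real (half_kernel l (x - y)) * u y) * \<psi> x + 2 * of_real l * ((LINT y|lborel. yukawa \<kappa>0 (x - y) * u y) * \<psi> x)
      = (LINT y|lborel. g_ker \<sigma> l (x - y) * u y) * cnj (v x)"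
      unfolding \<psi>_def by (simp only: distrib_right mult.assoc)
  qed
  finally show ?thesis .
qed

end
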